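(* Let $\omega$ be an open strict interval of $\mathbb T$. Let $T>0$ and $f_0\in\mathcal{NC}_{H^2}(\omega,T)$. There exists $C>0$ such that for every $T'>0$, there exists $u\in L^2([0,T']\times\omega)$ with (1) $S(T')f_0 + \mathcal F_{T'}^+ u = 0$; (2) $\|u\|_{L^2([0,T']\times\omega)} \leq C\max(1,T'^{-3/2})$.
   Context: $\mathbb T$ is the complex unit circle, identified with $\mathbb R/2\pi\mathbb Z$ via $x\mapsto e^{ix}$. An open strict interval of $\mathbb T$ is an open arc $\{e^{ix}:a<x<b\}$ with $0<b-a<2\pi$. Functions are complex valued; $f\in L^2(\mathbb T)$ is written $f(e^{ix})=\sum_{n\in\mathbb Z}\widehat f(n)e^{inx}$. The Riesz projector is $P_+f(e^{ix})=\sum_{n\ge 0}\widehat f(n)e^{inx}$, and $H^2=P_+L^2(\mathbb T)$. Let $S(t)f(e^{ix})=\sum_{n}\widehat f(n)e^{-|n|t}e^{inx}$. For $T>0$ the input-to-output map $\mathcal F_T^+:L^2([0,T]\times\omega)\to H^2$ is $\mathcal F_T^+u=\int_0^TS(T-s)\big(P_+\mathbf 1_\omega u(s,\cdot)\big)\,ds$, where $\mathbf 1_\omega u$ is the extension of $u$ by $0$ outside $\omega$. $\mathcal{NC}_{H^2}(\omega,T)$ is the set of $f_0\in H^2$ for which there is $u\in L^2([0,T]\times\omega)$ with $S(T)f_0+\mathcal F_T^+u=0$, i.e. such that the solution of $(\partial_t+|D|)f=P_+\mathbf 1_\omega u$, $f(0,\cdot)=f_0$, satisfies $f(T,\cdot)=0$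 (here $|D|f=\sum_n|n|\widehat f(n)e^{inx}$). *)

theory Defs
  imports "HOL-Analysis.Analysis"
begin

text \<open>
  Elements of an \<open>L\<^sup>2\<close> space are represented by functions; identities in \<open>L\<^sup>2\<close> are
  identities almost everywhere.
\<close>

definition L2 :: "'a measure \<Rightarrow> ('a \<Rightarrow> complex) set" where
  "L2 M = {f \<in> borel_measurable M. integrable M (\<lambda>x. (cmod (f x))\<^sup>2)}"

definition L2_norm :: "'a measure \<Rightarrow> ('a \<Rightarrow> complex) \<Rightarrow> real" where
  "L2_norm M f = sqrt (LINT x|M. (cmod (f x))\<^sup>2)"

text \<open>The unit circle in the complex plane with arc length (total mass \<open>2\<pi>\<close>).\<close>

definition circle :: "complex measure" where
  "circle = distr (restrict_space lborel {0..<2 * pi}) (restrict_space borel (sphere 0 1)) cis"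

definition open_strict_interval :: "complex set \<Rightarrow> bool" where
  "open_strict_interval \<omega> \<longleftrightarrow>
     (\<exists>a b. 0 < b - a \<and> b - a < 2 * pi \<and> \<omega> = {cis x |x. a < x \<and> x < b})"

definition fourier_coeff :: "(complex \<Rightarrow> complex) \<Rightarrow> int \<Rightarrow> complex" where
  "fourier_coeff f n = (LINT z|circle. f z * z powi (- n)) / complex_of_real (2 * pi)"

text \<open>
  For \<open>f \<in> L\<^sup>2\<close> the series defining \<open>P\<^sub>+ f\<close> converges in \<open>L\<^sup>2\<close>; its sum is determined up to
  a null set, and a representative is chosen.
\<close>

definition riesz_projector :: "(complex \<Rightarrow> complex) \<Rightarrow> complex \<Rightarrow> complex" where
  "riesz_projector f =
     (SOME g. g \<in> L2 circle \<and>
        (\<lambda>N. L2_norm circle (\<lambda>z. g z - (\<Sum>n<N. fourier_coeff f (int n) * z ^ n)))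
          \<longlonglongrightarrow> 0)"

definition H2 :: "(complex \<Rightarrow> complex) set" where
  "H2 = {f \<in> L2 circle. \<exists>g \<in> L2 circle. AE z in circle. f z = riesz_projector g z}"

text \<open>
  For \<open>t > 0\<close> and \<open>f \<in> L\<^sup>2\<close> the coefficients decay exponentially and the series converges
  absolutely at every point of the circle. For \<open>t = 0\<close> the series is the Fourier series
  of \<open>f\<close>, whose sum in \<open>L\<^sup>2\<close> is \<open>f\<close> itself.
\<close>

definition semigroup_S :: "real \<Rightarrow> (complex \<Rightarrow> complex) \<Rightarrow> complex \<Rightarrow> complex" where
  "semigroup_S t f z =
     (if t = 0 then f z
      else (\<Sum>\<^sub>\<infinity>n\<in>UNIV. fourier_coeff f n * exp (- real_of_int \<bar>n\<bar> * t) * z powi n))"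

text \<open>The measure space \<open>[0,T] \<times> \<omega>\<close>.\<close>

definition control_space :: "real \<Rightarrow> complex set \<Rightarrow> (real \<times> complex) measure" where
  "control_space T \<omega> = restrict_space lborel {0..T} \<Otimes>\<^sub>M restrict_space circle \<omega>"

definition extend_by_zero :: "complex set \<Rightarrow> (complex \<Rightarrow> complex) \<Rightarrow> complex \<Rightarrow> complex" where
  "extend_by_zero \<omega> v z = (if z \<in> \<omega> then v z else 0)"

text \<open>
  The \<open>L\<^sup>2\<close>-valued integral is taken pointwise in \<open>z\<close>. Let \<open>u \<in> L2 (control_space T \<omega>)\<close>. For
  almost every \<open>s\<close> the function \<open>u (s, _)\<close> is in \<open>L\<^sup>2\<close>, and for \<open>s < T\<close> the integrand is then an
  absolutely convergent series in \<open>z\<close> which does not depend on the representative chosen by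
  \<open>riesz_projector\<close>. Up to a null set of \<open>s\<close> (which the Lebesgue integral ignores) the integrand
  is jointly measurable, and it is integrable in \<open>(s, z)\<close>. Hence by Fubini the integral exists
  for almost every \<open>z\<close>, and as a function of \<open>z\<close> it represents the Bochner integral in \<open>L\<^sup>2\<close>.
\<close>

definition input_to_output ::
    "complex set \<Rightarrow> real \<Rightarrow> (real \<times> complex \<Rightarrow> complex) \<Rightarrow> complex \<Rightarrow> complex" where
  "input_to_output \<omega> T u z =
     (LINT s:{0..T}|lebesgue.
        semigroup_S (T - s) (riesz_projector (extend_by_zero \<omega> (\<lambda>w. u (s, w)))) z)"

definition null_controllable :: "complex set \<Rightarrow> real \<Rightarrow> (complex \<Rightarrow> complex) set" where
  "null_controllable \<omega> T =
     {f0 \<in> H2. \<exists>u \<in> L2 (control_space T \<omega>).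
        AE z in circle. semigroup_S T f0 z + input_to_output \<omega> T u z = 0}"

end

theory Submission
  imports Defs "HOL-Complex_Analysis.Complex_Analysis"
begin

text \<open>
  Write \<open>f(t)\<close> for the controlled solution, which vanishes at time \<open>T\<close>. If \<open>v\<close> solves
  \<open>\<partial>\<^sub>t v - i \<partial>\<^sub>x v = 1\<^sub>\<omega> u\<close> backwards from \<open>v(T) = 0\<close>, then \<open>P\<^sub>+ v(t) = f(t)\<close>. As \<open>v\<close> satisfies the
  Cauchy-Riemann equation away from \<open>\<omega>\<close>, unique continuation gives \<open>v = 0\<close> there, hence
  \<open>f(t) = P\<^sub>+ 1\<^sub>\<omega> v(t)\<close>: the state itself has the form of a control term. For \<open>\<theta>(t) = 1 - t / T'\<close> the
  function \<open>\<theta> f\<close> therefore solves the equation with the control \<open>\<theta>' v + \<theta> u\<close>, which steers \<open>f\<^sub>0\<close> to \<open>0\<close>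
  in time \<open>T' \<le> T\<close> at cost \<open>O(1 / T')\<close>.

  Explicitly \<open>v(t, z) = f\<^sub>0(e\<^sup>-\<^sup>t z) + (2 \<pi>)\<^sup>-\<^sup>1 \<integral> u(s, w) / (1 - e\<^sup>s\<^sup>-\<^sup>t z w\<^sup>*) ds dw\<close> with \<open>w\<^sup>*\<close> the
  conjugate of \<open>w\<close>. The integral is a Cauchy transform of \<open>u\<close>; it is bounded on \<open>L\<^sup>2\<close> by Schur's
  test, and null controllability fixes its Taylor coefficients at the origin.
\<close>

section \<open>The circle\<close>

text \<open>No weak solution of either equation is handled; everything is reduced to moments. For
  \<open>n >= 0\<close>, mode \<open>n\<close> of the state at time \<open>t\<close> is
  \<open>exp (- n t)\<close> times the sum of the datum coefficient and \<open>1 / (2 pi)\<close>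
  times the integral over \<open>s < t\<close> of \<open>u(s, w) * exp (n s) * cnj w ^ n\<close>. So
  \<open>u\<close> is a null control iff the full integrals, its moments, are \<open>- 2 pi\<close>
  times the coefficients of the datum. The final time enters only through the support of
  \<open>u\<close>, and controls for different times are compared by their moments alone.

  The kernel of \<open>v\<close> arises as follows. For \<open>s < t\<close> it is a series in
  nonnegative powers of \<open>z\<close>, the forward Duhamel formula. For \<open>s > t\<close> it
  is minus a series in strictly negative powers, the stable backward solution on the modes
  \<open>n < 0\<close>. That the modes \<open>n >= 0\<close> vanish at time \<open>T\<close> as well
  is null controllability.

  The obstacle is the singularity of size
  \<open>1 / (\<bar>s - t\<bar> + \<bar>z - w\<bar>)\<close>, which is not square integrable in
  \<open>(s, w)\<close>: values of \<open>v\<close> exist only almost everywhere, and weights have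
  to replace pointwise estimates.\<close>

lemma space_circle [simp]: "space circle = sphere 0 1"
  and sets_circle [measurable_cong]: "sets circle = sets (restrict_space borel (sphere 0 1))"
  by (auto simp: circle_def space_restrict_space)

lemma measurable_ident_circle [measurable (raw)]: "(\<lambda>z. z) \<in> borel_measurable circle"
  using measurable_restrict_space1[OF measurable_ident, of borel "sphere 0 1"]
  by (simp add: measurable_cong_sets[OF sets_circle refl] id_def)

lemma measurable_cis [measurable]: "cis \<in> borel_measurable borel"
  by (intro borel_measurable_continuous_onI continuous_intros)

lemma measurable_snd_circle [measurable]: "snd \<in> borel_measurable (M \<Otimes>\<^sub>M circle)"
  by (rule measurable_compose[OF measurable_snd measurable_ident_circle])

lemma measurable_cis_circle:
  "cis \<in> restrict_space lborel {0..<2 * pi} \<rightarrow>\<^sub>M restrict_space borel (sphere 0 1)"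
  by (intro measurable_restrict_space2 measurable_restrict_space1)
     (auto intro!: borel_measurable_continuous_onI continuous_intros)

lemma emeasure_circle: "emeasure circle (space circle) = ennreal (2 * pi)"
  unfolding circle_def
  by (subst emeasure_distr[OF measurable_cis_circle])
     (auto simp: space_restrict_space emeasure_restrict_space vimage_def sets_restrict_space
       intro!: arg_cong[of _ _ ennreal])

interpretation circle: finite_measure circle
  by (rule finite_measureI) (simp only: emeasure_circle ennreal_neq_top infinity_ennreal_def not_False_eq_True simp_thms)

interpretation nu: pair_sigma_finite lborel circle ..

lemma nn_integral_circle:
  assumes "f \<in> borel_measurable borel"
  shows "(\<integral>\<^sup>+z. f z \<partial>circle) = (\<integral>\<^sup>+x\<in>{0..<2*pi}. f (cis x) \<partial>lborel)"
  using assms unfolding circle_def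
  by (subst nn_integral_distr[OF measurable_cis_circle])
     (auto simp: nn_integral_restrict_space intro: measurable_restrict_space1)

text \<open>Serves to discard the end points of the arc, where \<open>\<omega>\<close> and its
  closure may differ.\<close>

lemma circle_singleton_null: "{z} \<in> null_sets circle" if "cmod z = 1"
proof -
  have s: "{z} \<in> sets circle"
    using that by (auto simp: sets_circle sets_restrict_space image_iff intro!: bexI[of _ "{z}"])
  have "emeasure circle {z} = (\<integral>\<^sup>+y. indicator {z} y \<partial>circle)" using s by simp
  also have "\<dots> = (\<integral>\<^sup>+x\<in>{0..<2*pi}. indicator {z} (cis x) \<partial>lborel)"
    by (rule nn_integral_circle) simp
  also have "\<dots> \<le> (\<integral>\<^sup>+x. indicator {Arg2pi z} x \<partial>lborel)"
  proof (rule nn_integral_mono)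
    fix x show "indicator {z} (cis x) * indicator {0..<2*pi} x \<le> (indicator {Arg2pi z} x :: ennreal)"
      using Arg2pi_unique[of 1 x z] by (auto simp: indicator_def cis_conv_exp mult.commute)
  qed
  also have "\<dots> = 0" by simp
  finally show ?thesis using s by (auto simp: null_sets_def)
qed

lemma powi_circle_minus:
  assumes "cmod z = 1"
  shows "z powi (- int n) = cnj z ^ n"
proof -
  have "z * cnj z = 1" using assms by (simp add: complex_norm_square[symmetric])
  then have "inverse z = cnj z" by (rule inverse_unique)
  then show ?thesis by (simp add: power_int_minus flip: power_inverse)
qed

lemma borel_measurable_powi [measurable (raw)]:
  "f \<in> borel_measurable M \<Longrightarrow> (\<lambda>x. f x powi n :: complex) \<in> borel_measurable M"
  unfolding power_int_def by (cases "n \<ge> 0") simp_all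

lemma integral_powi_circle: "(LINT z|circle. z powi n) = (if n = 0 then complex_of_real (2 * pi) else 0)"
proof -
  have "(LINT z|circle. z powi n) = (LINT x|restrict_space lborel {0..<2*pi}. cis x powi n)"
    unfolding circle_def 
    by (rule integral_distr[OF measurable_cis_circle]) (auto intro!: measurable_restrict_space1)
  also have "\<dots> = (LINT x:{0..<2*pi}|lborel. cis (n * x))"
    by (subst integral_restrict_space) (auto simp: cis_power_int set_lebesgue_integral_def)
  also have "\<dots> = (LINT x:{0..2*pi}|lborel. cis (n * x))"
    unfolding set_lebesgue_integral_def
  proof (rule integral_cong_AE)
    show "AE x in lborel. indicator {0..<2*pi} x *\<^sub>R cis (n * x) = indicator {0..2*pi} x *\<^sub>R cis (n * x)"
      using AE_lborel_singleton[of "2*pi"] by eventually_elim (auto simp: indicator_def)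
  qed (simp_all flip: cis_power_int)
  also have "\<dots> = (if n = 0 then complex_of_real (2 * pi) else 0)"
  proof (cases "n = 0")
    case True
    then show ?thesis by (simp add: set_lebesgue_integral_def scaleR_conv_of_real)
  next
    case False
    have "((\<lambda>x. cis (n * x)) has_integral (cis (n * (2*pi)) / (\<i> * n) - cis (real_of_int n * 0) / (\<i> * n))) {0..2*pi}"
    proof (rule fundamental_theorem_of_calculus)
      fix x assume "x \<in> {0..2*pi}"
      show "((\<lambda>x. cis (n * x) / (\<i> * n)) has_vector_derivative cis (n * x)) (at x within {0..2*pi})"
        unfolding has_vector_derivative_def has_real_derivative_iff_has_vector_derivative
        using False by (auto intro!: derivative_eq_intros simp: scaleR_conv_of_real field_simps)
    qed auto
    moreover have "cis (n * (2*pi)) = 1"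
      using cis_power_int[of "2*pi" n] by simp
    ultimately have "((\<lambda>x. cis (n * x)) has_integral 0) {0..2*pi}" by simp
    moreover have "set_integrable lborel {0..2*pi} (\<lambda>x. cis (n * x))"
      unfolding set_integrable_def by (rule borel_integrable_compact) (auto intro!: continuous_intros)
    ultimately show ?thesis using False
      by (simp add: set_borel_integral_eq_integral integral_unique)
  qed
  finally show ?thesis .
qed

lemma integrable_circle_bounded:
  fixes f :: "complex \<Rightarrow> complex"
  assumes "f \<in> borel_measurable circle" "\<And>z. cmod z = 1 \<Longrightarrow> cmod (f z) \<le> B"
  shows "integrable circle f"
  by (rule circle.integrable_const_bound[of _ B]) (use assms in auto)

lemma integral_circle_bounded:
  fixes f :: "complex \<Rightarrow> complex"
  assumes "f \<in> borel_measurable circle" "\<And>z. cmod z = 1 \<Longrightarrow> cmod (f z) \<le> B"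
  shows "cmod (LINT z|circle. f z) \<le> 2 * pi * B"
proof -
  have "cmod (LINT z|circle. f z) \<le> (LINT z|circle. B)"
    by (rule Bochner_Integration.integral_norm_bound_integral) (use assms integrable_circle_bounded[OF assms] in auto)
  also have "\<dots> = 2 * pi * B"
    using emeasure_circle by (simp add: measure_def)
  finally show ?thesis .
qed

lemma one_minus_ge: 
  assumes "cmod z = 1"
  shows "\<bar>1 - cmod a\<bar> \<le> cmod (1 - a * z)"
  using norm_triangle_ineq3[of 1 "a*z"] assms by (simp add: norm_mult)

text \<open>The integrals \<open>J m\<close> of \<open>z powi m / (1 - a * z)\<close> satisfy a
  two-term recursion by orthogonality and are bounded uniformly in \<open>m\<close>; iterating in
  the contracting direction determines them. The dichotomy is the causality of the problem: with
  \<open>cmod a = exp (s - t)\<close> only times \<open>s < t\<close> contribute to the modes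
  \<open>n >= 0\<close>, since for \<open>cmod a > 1\<close> the kernel has strictly negative powers
  of \<open>z\<close> only.\<close>

lemma integral_cauchy_kernel:
  assumes a: "cmod a \<noteq> 1"
  shows "(LINT z|circle. cnj z ^ n / (1 - a * z)) =
    (if cmod a < 1 then complex_of_real (2 * pi) * a ^ n else 0)"
proof -
  define J where "J m = (LINT z|circle. z powi m / (1 - a * z))" for m
  define B where "B = 1 / \<bar>1 - cmod a\<bar>"
  have bd: "cmod (z powi m / (1 - a * z)) \<le> B" if "cmod z = 1" for z m
    using one_minus_ge[OF that, of a] a that 
    by (auto simp: B_def norm_divide norm_power_int intro!: divide_left_mono mult_pos_pos)
  have nz: "1 - a * z \<noteq> 0" if "cmod z = 1" for z
    using one_minus_ge[OF that, of a] a by auto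
  have int: "integrable circle (\<lambda>z. z powi m / (1 - a * z))" for m
    by (rule integrable_circle_bounded[of _ B]) (auto intro: bd)
  have Jb: "cmod (J m) \<le> 2 * pi * B" for m
    unfolding J_def by (rule integral_circle_bounded) (auto intro: bd)
  have rec: "J m - a * J (m + 1) = (if m = 0 then complex_of_real (2 * pi) else 0)" for m
  proof -
    have "J m - a * J (m + 1) = (LINT z|circle. z powi m / (1 - a * z) - a * (z powi (m + 1) / (1 - a * z)))"
      unfolding J_def
      by (subst Bochner_Integration.integral_diff)
         (auto intro!: int integrable_mult_right simp del: times_divide_eq_right)
    also have "\<dots> = (LINT z|circle. z powi m)"
    proof (rule Bochner_Integration.integral_cong[OF refl])
      fix z assume "z \<in> space circle"
      then have z: "cmod z = 1" "z \<noteq> 0" by auto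
      have "z powi m / (1 - a * z) - a * (z powi (m + 1) / (1 - a * z)) = z powi m * (1 - a * z) / (1 - a * z)"
        using z(2) by (simp only: diff_divide_distrib[symmetric] times_divide_eq_right)
           (simp add: power_int_add algebra_simps)
      then show "z powi m / (1 - a * z) - a * (z powi (m + 1) / (1 - a * z)) = z powi m"
        using nz[OF z(1)] by simp
    qed
    finally show ?thesis by (simp add: integral_powi_circle)
  qed
  have Jn: "(LINT z|circle. cnj z ^ n / (1 - a * z)) = J (- int n)"
    unfolding J_def by (rule Bochner_Integration.integral_cong[OF refl]) (simp add: powi_circle_minus)
  \<comment> \<open>Rigidity of bounded solutions of the recursion: a number equal to
    \<open>c ^ k\<close> times a bounded quantity for every \<open>k\<close> is zero.\<close>
  have van: "x = 0" if "cmod c < 1" "\<And>k. x = c ^ k * y k" "\<And>k. cmod (y k) \<le> 2 * pi * B" for x c y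
  proof -
    have bx: "cmod x \<le> cmod c ^ k * (2 * pi * B)" for k
      by (subst that(2)[of k]) (simp add: norm_mult norm_power mult_left_mono that(3))
    have "(\<lambda>k. cmod c ^ k * (2 * pi * B)) \<longlonglongrightarrow> 0 * (2 * pi * B)"
      using that(1) by (intro tendsto_intros LIMSEQ_power_zero) auto
    then have "cmod x \<le> 0" 
      by (intro LIMSEQ_le_const[of _ 0]) (use bx in auto)
    then show ?thesis by simp
  qed
  show ?thesis
  proof (cases "cmod a < 1")
    case True
    \<comment> \<open>Upwards from index \<open>1\<close> the inhomogeneity of \<open>rec\<close>,
      located at \<open>m = 0\<close>, is never met.\<close>
    have "J 1 = a ^ k * J (1 + int k)" for k
    proof (induction k)
      case (Suc k)
      then show ?case using rec[of "1 + int k"] by (simp add: algebra_simps)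
    qed simp
    then have "J 1 = 0"
      by (rule van[OF True _ Jb])
    then have J0: "J 0 = complex_of_real (2 * pi)" using rec[of 0] by simp
    have "J (- int n) = complex_of_real (2 * pi) * a ^ n"
    proof (induction n)
      case (Suc n)
      then show ?case using rec[of "- int (Suc n)"] by (simp add: algebra_simps)
    qed (simp add: J0)
    then show ?thesis using True Jn by simp
  next
    case False
    then have a1: "cmod (1 / a) < 1" "a \<noteq> 0" using a by (auto simp: norm_divide divide_less_eq_1)
    \<comment> \<open>Downwards from \<open>- n\<close> each step uses \<open>rec\<close> at a
      strictly negative index, where its right-hand side is zero.\<close>
    have "J (- int n) = (1/a) ^ k * J (- int n - int k)" for k
    proof (induction k)
      case (Suc k)
      have "J (- int n - int k) = (1/a) * J (- int n - int (Suc k))"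
      proof -
        have "X = (1/a) * Y" if "Y - a * X = 0" for X Y
          using that a1 by (simp add: field_simps)
        moreover have "J (- int n - int (Suc k)) - a * J (- int n - int k) = 0"
        proof -
          have e: "- int n - int (Suc k) + 1 = - int n - int k" and ne: "- int n - int (Suc k) \<noteq> 0" by auto
          show ?thesis using rec[of "- int n - int (Suc k)"] unfolding e if_not_P[OF ne] .
        qed
        ultimately show ?thesis .
      qed
      then show ?case using Suc by simp
    qed simp
    then have "J (- int n) = 0"
      by (rule van[OF a1(1) _ Jb])
    then show ?thesis using False Jn by simp
  qed
qed


section \<open>Square integrable functions and Bessel's inequality\<close>

lemma borel_measurable_cnj [measurable (raw)]:
  "f \<in> borel_measurable M \<Longrightarrow> (\<lambda>x. cnj (f x)) \<in> borel_measurable M"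
  by (rule borel_measurable_continuous_on[where f = cnj]) (intro continuous_intros)

lemma L2_measurable: "f \<in> L2 M \<Longrightarrow> f \<in> borel_measurable M"
  and L2_integrable: "f \<in> L2 M \<Longrightarrow> integrable M (\<lambda>x. (cmod (f x))\<^sup>2)"
  by (auto simp: L2_def)

lemma L2_iff_nn_integral:
  "f \<in> L2 M \<longleftrightarrow> f \<in> borel_measurable M \<and> (\<integral>\<^sup>+x. ennreal ((cmod (f x))\<^sup>2) \<partial>M) < \<infinity>"
  by (auto simp: L2_def integrable_iff_bounded)

lemma L2_norm_nn_integral:
  assumes "f \<in> L2 M"
  shows "(\<integral>\<^sup>+x. ennreal ((cmod (f x))\<^sup>2) \<partial>M) = ennreal ((L2_norm M f)\<^sup>2)"
  using nn_integral_eq_integral[OF L2_integrable[OF assms]] by (simp add: L2_norm_def)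

lemma L2_norm_nonneg: "0 \<le> L2_norm M f"
  by (simp add: L2_norm_def)

lemma cmod_add_square_le: "(cmod (a + b))\<^sup>2 \<le> 2 * (cmod a)\<^sup>2 + 2 * (cmod b)\<^sup>2"
proof -
  have "(cmod (a + b))\<^sup>2 \<le> (cmod a + cmod b)\<^sup>2"
    by (intro power_mono norm_triangle_ineq) auto
  also have "\<dots> \<le> 2 * (cmod a)\<^sup>2 + 2 * (cmod b)\<^sup>2"
    using zero_le_power2[of "cmod a - cmod b"] by (simp add: power2_eq_square algebra_simps)
  finally show ?thesis .
qed

lemma L2_add: "(\<lambda>x. f x + g x) \<in> L2 M" if "f \<in> L2 M" "g \<in> L2 M"
proof -
  have [measurable]: "f \<in> borel_measurable M" "g \<in> borel_measurable M"
    using that by (auto simp: L2_def)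
  have "integrable M (\<lambda>x. 2 * (cmod (f x))\<^sup>2 + 2 * (cmod (g x))\<^sup>2)"
    using that by (auto simp: L2_def)
  then have "integrable M (\<lambda>x. (cmod (f x + g x))\<^sup>2)"
    by (rule Bochner_Integration.integrable_bound) (auto intro: order_trans[OF cmod_add_square_le])
  then show ?thesis by (simp add: L2_def)
qed

lemma L2_cmult: "(\<lambda>x. c * f x) \<in> L2 M" if "f \<in> L2 M"
  using that by (auto simp: L2_def norm_mult power_mult_distrib)

lemma L2_diff: "(\<lambda>x. f x - g x) \<in> L2 M" if "f \<in> L2 M" "g \<in> L2 M"
  using L2_add[OF that(1) L2_cmult[OF that(2), of "-1"]] by simp

lemma L2_circle_bounded:
  assumes "f \<in> borel_measurable circle" "\<And>z. cmod z = 1 \<Longrightarrow> cmod (f z) \<le> B"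
  shows "f \<in> L2 circle"
proof -
  have [measurable]: "f \<in> borel_measurable circle" by fact
  have "integrable circle (\<lambda>x. (cmod (f x))\<^sup>2)"
    by (rule circle.integrable_const_bound[of _ "B\<^sup>2"]) (use assms(2) in \<open>auto intro!: AE_I2 power_mono\<close>)
  then show ?thesis by (simp add: L2_def)
qed

lemma L2_circle_integrable: "integrable circle f" if "f \<in> L2 circle"
proof (rule Bochner_Integration.integrable_bound)
  show "integrable circle (\<lambda>x. 1 + (cmod (f x))\<^sup>2)" using L2_integrable[OF that] by simp
  show "AE x in circle. cmod (f x) \<le> norm (1 + (cmod (f x))\<^sup>2)"
  proof (rule AE_I2)
    fix x show "cmod (f x) \<le> norm (1 + (cmod (f x))\<^sup>2)"
      using zero_le_power2[of "2 * cmod (f x) - 1"] by (simp add: power2_eq_square algebra_simps)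
  qed
qed (rule L2_measurable[OF that])

text \<open>Cauchy-Schwarz against the constant \<open>1\<close>, whose norm is
  \<open>sqrt (2 * pi)\<close>. It makes Fourier coefficients continuous in the \<open>L2\<close>
  norm.\<close>

lemma norm_integral_circle_le_L2_norm:
  assumes f: "f \<in> L2 circle" and g: "g \<in> borel_measurable circle" "\<And>z. cmod z = 1 \<Longrightarrow> cmod (g z) \<le> 1"
  shows "cmod (LINT z|circle. f z * g z) \<le> sqrt (2 * pi) * L2_norm circle f"
proof -
  note [measurable] = L2_measurable[OF f] g(1)
  have fi: "integrable circle (\<lambda>z. f z * g z)"
    by (rule Bochner_Integration.integrable_bound[OF L2_circle_integrable[OF f]])
       (use g(2) in \<open>auto simp: norm_mult intro!: mult_left_le\<close>)
  have "(\<integral>\<^sup>+z. ennreal (cmod (f z)) * 1 \<partial>circle)\<^sup>2 \<le>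
     (\<integral>\<^sup>+z. (ennreal (cmod (f z)))\<^sup>2 \<partial>circle) * (\<integral>\<^sup>+z. 1\<^sup>2 \<partial>circle)"
    by (rule Cauchy_Schwarz_nn_integral) auto
  also have "\<dots> = ennreal ((sqrt (2 * pi) * L2_norm circle f)\<^sup>2)"
    using emeasure_circle L2_norm_nn_integral[OF f]
    by (simp add: ennreal_power power_mult_distrib ennreal_mult mult.commute)
  finally have "ennreal ((LINT z|circle. cmod (f z))\<^sup>2) \<le> ennreal ((sqrt (2 * pi) * L2_norm circle f)\<^sup>2)"
    using nn_integral_eq_integral[OF integrable_norm[OF L2_circle_integrable[OF f]]]
    by (simp add: ennreal_power)
  then have "(LINT z|circle. cmod (f z)) \<le> sqrt (2 * pi) * L2_norm circle f"
    by (simp add: ennreal_le_iff L2_norm_nonneg)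
  moreover have "cmod (LINT z|circle. f z * g z) \<le> (LINT z|circle. cmod (f z))"
    by (rule Bochner_Integration.integral_norm_bound_integral[OF fi integrable_norm[OF L2_circle_integrable[OF f]]])
       (use g(2) in \<open>auto simp: norm_mult intro!: mult_left_le\<close>)
  ultimately show ?thesis by linarith
qed

lemma fourier_coeff_cnj: "fourier_coeff f (int n) = (LINT z|circle. f z * cnj z ^ n) / complex_of_real (2 * pi)"
  unfolding fourier_coeff_def
  by (intro arg_cong2[of _ _ _ _ "(/)"] Bochner_Integration.integral_cong) (auto simp: powi_circle_minus)

lemma trig_poly_measurable [measurable]: "(\<lambda>z. \<Sum>n\<in>A. c n * z ^ n :: complex) \<in> borel_measurable borel"
  by measurable

lemma trig_poly_bound:
  assumes "cmod z = 1" shows "cmod (\<Sum>n\<in>A. c n * z ^ n) \<le> (\<Sum>n\<in>A. cmod (c n))"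
  by (rule order_trans[OF norm_sum]) (simp add: norm_mult norm_power assms)

lemma trig_poly_L2: "(\<lambda>z. \<Sum>n\<in>A. c n * z ^ n) \<in> L2 circle"
  by (rule L2_circle_bounded[OF _ trig_poly_bound]) measurable

lemma cnj_power_circle: "cmod z = 1 \<Longrightarrow> z ^ m * cnj z ^ n = z powi (int m - int n)"
  by (subst power_int_diff) (auto simp: power_int_minus powi_circle_minus[of z n, symmetric] divide_inverse)

lemma trig_poly_square:
  assumes "finite A"
  shows "(\<integral>\<^sup>+z. ennreal ((cmod (\<Sum>n\<in>A. c n * z ^ n))\<^sup>2) \<partial>circle) = ennreal (2 * pi * (\<Sum>n\<in>A. (cmod (c n))\<^sup>2))"
proof -
  let ?p = "\<lambda>z. \<Sum>n\<in>A. c n * z ^ n"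
  have int: "integrable circle (\<lambda>z. c m * cnj (c n) * z powi (int m - int n))" for m n
    by (rule integrable_circle_bounded[of _ "cmod (c m * cnj (c n))"]) (auto simp: norm_mult norm_power_int)
  have "complex_of_real (LINT z|circle. (cmod (?p z))\<^sup>2) = (LINT z|circle. complex_of_real ((cmod (?p z))\<^sup>2))"
    by (rule integral_complex_of_real[symmetric])
  also have "\<dots> = (LINT z|circle. (\<Sum>m\<in>A. \<Sum>n\<in>A. c m * cnj (c n) * z powi (int m - int n)))"
  proof (rule Bochner_Integration.integral_cong[OF refl])
    fix z assume "z \<in> space circle"
    then have z: "cmod z = 1" by simp
    show "complex_of_real ((cmod (?p z))\<^sup>2) = (\<Sum>m\<in>A. \<Sum>n\<in>A. c m * cnj (c n) * z powi (int m - int n))"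
      unfolding complex_norm_square cnj_sum sum_product
      by (intro sum.cong refl) (simp flip: cnj_power_circle[OF z] add: ac_simps)
  qed
  also have "\<dots> = (\<Sum>m\<in>A. \<Sum>n\<in>A. c m * cnj (c n) * (if m = n then complex_of_real (2 * pi) else 0))"
    using int by (simp add: Bochner_Integration.integral_sum integrable_sum integral_powi_circle)
  also have "\<dots> = complex_of_real (2 * pi * (\<Sum>n\<in>A. (cmod (c n))\<^sup>2))"
    using assms by (simp add: if_distrib[of "\<lambda>x. _ * x"] sum.delta complex_norm_square[symmetric] sum_distrib_left mult.commute cong: if_cong)
  finally have "(LINT z|circle. (cmod (?p z))\<^sup>2) = 2 * pi * (\<Sum>n\<in>A. (cmod (c n))\<^sup>2)"
    by (simp only: of_real_eq_iff)
  with nn_integral_eq_integral[OF L2_integrable[OF trig_poly_L2[of c A]]] show ?thesis by simp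
qed

text \<open>The mean square of \<open>g - ?p\<close> is nonnegative, where \<open>?p\<close> is the
  partial Fourier sum; the inner product of \<open>g\<close> with \<open>?p\<close> and the square
  of \<open>?p\<close> integrate to the same sum.\<close>

lemma bessel:
  assumes g: "g \<in> L2 circle"
  shows "2 * pi * (\<Sum>n<N. (cmod (fourier_coeff g (int n)))\<^sup>2) \<le> (LINT z|circle. (cmod (g z))\<^sup>2)"
proof -
  define c where "c n = fourier_coeff g (int n)" for n
  let ?p = "\<lambda>z. \<Sum>n<N. c n * z ^ n"
  have int: "integrable circle (\<lambda>z. cnj (c n) * (g z * cnj z ^ n))" for n
  proof -
    note [measurable] = L2_measurable[OF g]
    have "integrable circle (\<lambda>z. g z * cnj z ^ n)"
      by (rule Bochner_Integration.integrable_bound[OF L2_circle_integrable[OF g]])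
         (auto simp: norm_mult norm_power)
    then show ?thesis by simp
  qed
  have ip: "(LINT z|circle. g z * cnj (?p z)) = complex_of_real (2 * pi * (\<Sum>n<N. (cmod (c n))\<^sup>2))"
  proof -
    have "(LINT z|circle. g z * cnj (?p z)) = (LINT z|circle. (\<Sum>n<N. cnj (c n) * (g z * cnj z ^ n)))"
      by (simp add: sum_distrib_left ac_simps)
    also have "\<dots> = (\<Sum>n<N. cnj (c n) * (c n * complex_of_real (2 * pi)))"
      using int by (simp add: Bochner_Integration.integral_sum c_def fourier_coeff_cnj)
    moreover have "(complex_of_real (cmod x))\<^sup>2 = x * cnj x" for x
      using complex_norm_square[of x] by simp
    ultimately show ?thesis
      by (simp add: sum_distrib_left sum_distrib_right ac_simps)
  qed
  have intg: "integrable circle (\<lambda>z. g z * cnj (?p z))"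
    using int by (simp add: sum_distrib_left ac_simps)
  have pp: "(LINT z|circle. (cmod (?p z))\<^sup>2) = 2 * pi * (\<Sum>n<N. (cmod (c n))\<^sup>2)"
    using nn_integral_eq_integral[OF L2_integrable[OF trig_poly_L2[of c "{..<N}"]]] trig_poly_square[of "{..<N}" c]
    by (simp add: sum_nonneg)
  have eq: "(cmod (a - b))\<^sup>2 = (cmod a)\<^sup>2 - 2 * Re (a * cnj b) + (cmod b)\<^sup>2" for a b
    unfolding cmod_power2 by (simp add: power2_eq_square algebra_simps)
  have "0 \<le> (LINT z|circle. (cmod (g z - ?p z))\<^sup>2)" by simp
  also have "\<dots> = (LINT z|circle. (cmod (g z))\<^sup>2) - 2 * Re (LINT z|circle. g z * cnj (?p z)) + (LINT z|circle. (cmod (?p z))\<^sup>2)"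
  proof -
    have "(LINT z|circle. A z - 2 * Re (G z) + P z) = (LINT z|circle. A z) - 2 * Re (LINT z|circle. G z) + (LINT z|circle. P z)"
      if "integrable circle A" "integrable circle G" "integrable circle P" for A P :: "complex \<Rightarrow> real" and G
      using that by (simp add: integral_Re[OF that(2)])
    from this[OF L2_integrable[OF g] intg L2_integrable[OF trig_poly_L2[of c "{..<N}"]]] show ?thesis
      unfolding eq .
  qed
  finally show ?thesis using ip pp by (simp add: c_def)
qed

lemma fourier_coeff_square_summable:
  assumes "g \<in> L2 circle"
  shows "summable (\<lambda>n. (cmod (fourier_coeff g (int n)))\<^sup>2)"
  by (rule summableI_nonneg_bounded[of _ "(LINT z|circle. (cmod (g z))\<^sup>2) / (2 * pi)"])
     (use bessel[OF assms] in \<open>auto simp: field_simps\<close>)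


section \<open>The Riesz projector\<close>

text \<open>\<open>riesz_projector\<close> is a choice of an \<open>L2\<close> limit, of which
  nothing is known until such a limit exists. A fast subsequence of the partial sums converges
  almost everywhere, and Fatou's lemma transfers the tail estimate to its limit.\<close>

theorem riesz_fischer_circle:
  fixes c :: "nat \<Rightarrow> complex"
  assumes sm: "summable (\<lambda>n. (cmod (c n))\<^sup>2)"
  obtains g where "g \<in> L2 circle"
    "(\<lambda>N. L2_norm circle (\<lambda>z. g z - (\<Sum>n<N. c n * z ^ n))) \<longlonglongrightarrow> 0"
proof -
  define S where "S N z = (\<Sum>n<N. c n * z ^ n)" for N z
  define r where "r N = (\<Sum>n. (cmod (c (n + N)))\<^sup>2)" for N
  have smr: "summable (\<lambda>n. (cmod (c (n + M)))\<^sup>2)" for M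
    by (rule summable_ignore_initial_segment[OF sm])
  have r0: "r \<longlonglongrightarrow> 0" unfolding r_def by (rule suminf_exist_split2[OF sm])
  have "\<exists>N. \<forall>M\<ge>N. r M \<le> (1/4) ^ k" for k
  proof -
    have "eventually (\<lambda>M. r M < (1/4) ^ k) sequentially"
      by (rule order_tendstoD(2)[OF r0]) simp
    then show ?thesis unfolding eventually_sequentially by (meson less_imp_le)
  qed
  then obtain N0 where N0: "\<And>k M. N0 k \<le> M \<Longrightarrow> r M \<le> (1/4) ^ k" by metis
  \<comment> \<open>Nondecreasing in \<open>k\<close>, at least \<open>k\<close>, and at least
    \<open>N0 k\<close>: all that the subsequence has to satisfy.\<close>
  define N where "N k = k + (\<Sum>j\<le>k. N0 j)" for k
  have Nmono: "N k \<le> N (Suc k)" for k by (simp add: N_def)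
  have Nge: "k \<le> N k" for k by (simp add: N_def)
  have rN: "r (N k) \<le> (1/4) ^ k" for k
  proof (rule N0)
    have "N0 k \<le> (\<Sum>j\<le>k. N0 j)" by (rule member_le_sum) auto
    then show "N0 k \<le> N k" by (simp add: N_def)
  qed
  have Smeas [measurable]: "S M \<in> borel_measurable circle" for M
    unfolding S_def by measurable
  have Sdiff: "(\<integral>\<^sup>+z. ennreal ((cmod (S M' z - S M z))\<^sup>2) \<partial>circle) \<le> ennreal (2 * pi * r M)" if "M \<le> M'" for M M'
  proof -
    have "S M' z - S M z = (\<Sum>n\<in>{M..<M'}. c n * z ^ n)" for z
      unfolding S_def using that by (simp add: sum_diff_nat_ivl lessThan_atLeast0)
    moreover have "(\<Sum>n\<in>{M..<M'}. (cmod (c n))\<^sup>2) \<le> r M"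
    proof -
      have "(\<Sum>n\<in>{M..<M'}. (cmod (c n))\<^sup>2) = (\<Sum>n<M' - M. (cmod (c (n + M)))\<^sup>2)"
        by (rule sum.reindex_bij_witness[of _ "\<lambda>n. n + M" "\<lambda>n. n - M"]) (use that in auto)
      also have "\<dots> \<le> r M" unfolding r_def
        by (rule sum_le_suminf) (use smr in auto)
      finally show ?thesis .
    qed
    ultimately show ?thesis by (simp add: trig_poly_square ennreal_leI)
  qed
  define d where "d k z = S (N (Suc k)) z - S (N k) z" for k z
  have dmeas [measurable]: "d k \<in> borel_measurable circle" for k unfolding d_def by measurable
  \<comment> \<open>An \<open>L1\<close> bound from an \<open>L2\<close> bound by
    \<open>x <= 2^-k + 2^k x^2\<close>: tails of size \<open>4^-k\<close> turn into the summable
    \<open>2^-k\<close>.\<close>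
  have dL1: "(\<integral>\<^sup>+z. ennreal (cmod (d k z)) \<partial>circle) \<le> ennreal (4 * pi * (1/2) ^ k)" for k
  proof -
    have "(\<integral>\<^sup>+z. ennreal (cmod (d k z)) \<partial>circle) \<le> (\<integral>\<^sup>+z. ennreal ((1/2) ^ k) + ennreal (2 ^ k) * ennreal ((cmod (d k z))\<^sup>2) \<partial>circle)"
    proof (rule nn_integral_mono)
      fix z
      have "0 \<le> (2 ^ k * cmod (d k z) - 1)\<^sup>2 + 2 ^ k * cmod (d k z)" by simp
      then have "2 ^ k * cmod (d k z) \<le> 1 + 2 ^ k * (2 ^ k * (cmod (d k z))\<^sup>2)"
        by (simp add: power2_eq_square algebra_simps)
      then have "cmod (d k z) \<le> (1/2) ^ k + 2 ^ k * (cmod (d k z))\<^sup>2"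
        by (simp add: field_simps power_divide)
      then show "ennreal (cmod (d k z)) \<le> ennreal ((1/2) ^ k) + ennreal (2 ^ k) * ennreal ((cmod (d k z))\<^sup>2)"
        by (simp flip: ennreal_plus ennreal_mult add: ennreal_leI del: ennreal_power)
    qed
    also have "\<dots> = ennreal ((1/2) ^ k) * ennreal (2 * pi) + ennreal (2 ^ k) * (\<integral>\<^sup>+z. ennreal ((cmod (d k z))\<^sup>2) \<partial>circle)"
      using emeasure_circle by (simp add: nn_integral_add nn_integral_cmult del: ennreal_power)
    also have "\<dots> \<le> ennreal ((1/2) ^ k) * ennreal (2 * pi) + ennreal (2 ^ k) * ennreal (2 * pi * (1/4) ^ k)"
      unfolding d_def
      by (intro add_left_mono mult_left_mono order_trans[OF Sdiff[OF Nmono]] ennreal_leI) (use rN in auto)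
    also have "\<dots> = ennreal ((1/2) ^ k * (2 * pi) + 2 ^ k * (2 * pi * (1/4) ^ k))"
      by (simp flip: ennreal_plus ennreal_mult del: ennreal_power)
    also have "(1/2) ^ k * (2 * pi) + 2 ^ k * (2 * pi * (1/4) ^ k) = 4 * pi * (1/2::real) ^ k"
    proof -
      have "(2::real) ^ k * (1/4) ^ k = (1/2) ^ k" by (simp flip: power_mult_distrib)
      then show ?thesis by (simp add: algebra_simps)
    qed
    finally show ?thesis .
  qed
  have "(\<integral>\<^sup>+z. (\<Sum>k. ennreal (cmod (d k z))) \<partial>circle) = (\<Sum>k. (\<integral>\<^sup>+z. ennreal (cmod (d k z)) \<partial>circle))"
    by (rule nn_integral_suminf) measurable
  also have "\<dots> \<le> (\<Sum>k. ennreal (4 * pi * (1/2) ^ k))"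
    by (intro suminf_le dL1) auto
  also have "\<dots> = ennreal (\<Sum>k. 4 * pi * (1/2) ^ k)"
    by (rule suminf_ennreal2) (auto intro!: summable_mult summable_geometric)
  finally have fin: "(\<integral>\<^sup>+z. (\<Sum>k. ennreal (cmod (d k z))) \<partial>circle) < \<infinity>"
    by (simp add: le_less_trans)
  have "AE z in circle. (\<Sum>k. ennreal (cmod (d k z))) \<noteq> \<infinity>"
    by (rule nn_integral_noteq_infinite) (use fin in auto)
  then have conv: "AE z in circle. (\<lambda>k. S (N k) z) \<longlonglongrightarrow> lim (\<lambda>k. S (N k) z)"
  proof eventually_elim
    case (elim z)
    then have "summable (\<lambda>k. cmod (d k z))"
      by (intro summable_suminf_not_top) auto
    then have "summable (\<lambda>k. d k z)" by (rule summable_norm_cancel)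
    then have "convergent (\<lambda>k. \<Sum>j<k. d j z)" by (simp add: summable_iff_convergent)
    then have "convergent (\<lambda>k. S (N 0) z + (\<Sum>j<k. d j z))" by (intro convergent_add convergent_const)
    moreover have "S (N 0) z + (\<Sum>j<k. d j z) = S (N k) z" for k
      unfolding d_def by (subst sum_lessThan_telescope[of "\<lambda>j. S (N j) z"]) simp
    ultimately show ?case by (simp add: convergent_LIMSEQ_iff)
  qed
  define g where "g z = lim (\<lambda>k. S (N k) z)" for z
  have [measurable]: "g \<in> borel_measurable circle"
    unfolding g_def by measurable
  \<comment> \<open>Fatou along the subsequence with \<open>M\<close> fixed, so the estimate holds
    for every partial sum and not only for those of the subsequence.\<close>
  have gS: "(\<integral>\<^sup>+z. ennreal ((cmod (g z - S M z))\<^sup>2) \<partial>circle) \<le> ennreal (2 * pi * r M)" for M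
  proof -
    have "(\<integral>\<^sup>+z. ennreal ((cmod (g z - S M z))\<^sup>2) \<partial>circle)
        = (\<integral>\<^sup>+z. liminf (\<lambda>k. ennreal ((cmod (S (N k) z - S M z))\<^sup>2)) \<partial>circle)"
    proof (rule nn_integral_cong_AE, use conv in eventually_elim)
      case (elim z)
      then have "(\<lambda>k. ennreal ((cmod (S (N k) z - S M z))\<^sup>2)) \<longlonglongrightarrow> ennreal ((cmod (g z - S M z))\<^sup>2)"
        unfolding g_def by (intro tendsto_intros tendsto_ennrealI)
      then show ?case by (rule lim_imp_Liminf[OF sequentially_bot, symmetric])
    qed
    also have "\<dots> \<le> liminf (\<lambda>k. (\<integral>\<^sup>+z. ennreal ((cmod (S (N k) z - S M z))\<^sup>2) \<partial>circle))"
      by (rule nn_integral_liminf) measurable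
    also have "\<dots> \<le> liminf (\<lambda>k. ennreal (2 * pi * r M))"
    proof (rule Liminf_mono, rule eventually_mono[OF eventually_ge_at_top[of M]])
      fix k assume "M \<le> k"
      then have "M \<le> N k" using Nge[of k] by simp
      then show "(\<integral>\<^sup>+z. ennreal ((cmod (S (N k) z - S M z))\<^sup>2) \<partial>circle) \<le> ennreal (2 * pi * r M)"
        by (rule Sdiff)
    qed
    also have "\<dots> = ennreal (2 * pi * r M)" by (simp add: Liminf_const)
    finally show ?thesis .
  qed
  have gL2: "g \<in> L2 circle"
    unfolding L2_iff_nn_integral using gS[of 0] by (auto simp: S_def intro: le_less_trans)
  have "(\<lambda>M. L2_norm circle (\<lambda>z. g z - S M z)) \<longlonglongrightarrow> 0"
  proof (rule tendsto_sandwich[of "\<lambda>_. 0" _ _ "\<lambda>M. sqrt (2 * pi * r M)"])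
    have r_nonneg: "0 \<le> r M" for M unfolding r_def by (rule suminf_nonneg) (use smr in auto)
    show "eventually (\<lambda>M. L2_norm circle (\<lambda>z. g z - S M z) \<le> sqrt (2 * pi * r M)) sequentially"
    proof (rule always_eventually, rule allI)
      fix M
      have "S M \<in> L2 circle" unfolding S_def by (rule trig_poly_L2)
      from L2_norm_nn_integral[OF L2_diff[OF gL2 this]] gS[of M] r_nonneg[of M]
      have "(L2_norm circle (\<lambda>z. g z - S M z))\<^sup>2 \<le> 2 * pi * r M" by (simp add: ennreal_le_iff)
      then show "L2_norm circle (\<lambda>z. g z - S M z) \<le> sqrt (2 * pi * r M)" by (rule real_le_rsqrt)
    qed
    show "(\<lambda>M. sqrt (2 * pi * r M)) \<longlonglongrightarrow> 0"
      using tendsto_real_sqrt[OF tendsto_mult_left[OF r0, of "2 * pi"]] by simp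
  qed (auto simp: L2_norm_nonneg)
  with gL2 show ?thesis by (intro that) (auto simp: S_def)
qed

lemma riesz_projector_spec:
  assumes "g \<in> L2 circle"
  shows riesz_projector_L2: "riesz_projector g \<in> L2 circle"
    and riesz_projector_tendsto: "(\<lambda>N. L2_norm circle (\<lambda>z. riesz_projector g z -
           (\<Sum>n<N. fourier_coeff g (int n) * z ^ n))) \<longlonglongrightarrow> 0"
proof -
  obtain h where "h \<in> L2 circle"
    "(\<lambda>N. L2_norm circle (\<lambda>z. h z - (\<Sum>n<N. fourier_coeff g (int n) * z ^ n))) \<longlonglongrightarrow> 0"
    using riesz_fischer_circle[OF fourier_coeff_square_summable[OF assms]] .
  then have "\<exists>h. h \<in> L2 circle \<and>
    (\<lambda>N. L2_norm circle (\<lambda>z. h z - (\<Sum>n<N. fourier_coeff g (int n) * z ^ n))) \<longlonglongrightarrow> 0" by blast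
  from someI_ex[OF this] show "riesz_projector g \<in> L2 circle"
    "(\<lambda>N. L2_norm circle (\<lambda>z. riesz_projector g z -
           (\<Sum>n<N. fourier_coeff g (int n) * z ^ n))) \<longlonglongrightarrow> 0"
    unfolding riesz_projector_def by auto
qed

lemma fourier_coeff_trig_poly:
  "fourier_coeff (\<lambda>z. \<Sum>n<N. c n * z ^ n) m = (if 0 \<le> m \<and> m < int N then c (nat m) else 0)"
proof -
  have "(LINT z|circle. (\<Sum>n<N. c n * z ^ n) * z powi (- m)) = (LINT z|circle. (\<Sum>n<N. c n * z powi (int n - m)))"
  proof (rule Bochner_Integration.integral_cong[OF refl])
    fix z assume "z \<in> space circle"
    then have "z \<noteq> 0" by auto
    then show "(\<Sum>n<N. c n * z ^ n) * z powi (- m) = (\<Sum>n<N. c n * z powi (int n - m))"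
      by (simp add: sum_distrib_right power_int_diff power_int_minus divide_inverse mult.assoc)
  qed
  also have "\<dots> = (\<Sum>n<N. c n * (LINT z|circle. z powi (int n - m)))"
  proof -
    have "integrable circle (\<lambda>z. c n * z powi (int n - m))" for n
      by (rule integrable_circle_bounded[of _ "cmod (c n)"]) (auto simp: norm_mult norm_power_int)
    then show ?thesis by (simp add: Bochner_Integration.integral_sum)
  qed
  also have "\<dots> = (\<Sum>n<N. if n = nat m \<and> 0 \<le> m then c n * complex_of_real (2 * pi) else 0)"
    by (intro sum.cong refl) (auto simp: integral_powi_circle)
  also have "\<dots> = (if 0 \<le> m \<and> m < int N then c (nat m) * complex_of_real (2 * pi) else 0)"
    by (cases "0 \<le> m") (auto simp: sum.delta nat_less_iff)
  finally show ?thesis unfolding fourier_coeff_def by auto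
qed

text \<open>Coefficients are continuous in the \<open>L2\<close> norm, and those of the partial sums
  are eventually constant. Together with membership in \<open>L2\<close> this carries every later
  use of the projector, so the representative picked by choice does not matter.\<close>

lemma fourier_coeff_riesz:
  assumes g: "g \<in> L2 circle"
  shows "fourier_coeff (riesz_projector g) n = (if 0 \<le> n then fourier_coeff g n else 0)"
proof -
  define R where "R = riesz_projector g"
  define S where "S N z = (\<Sum>n<N. fourier_coeff g (int n) * z ^ n)" for N z
  define e where "e z = z powi (- n)" for z :: complex
  have R: "R \<in> L2 circle" and S: "S N \<in> L2 circle" for N
    unfolding R_def S_def by (rule riesz_projector_L2[OF g] trig_poly_L2)+
  have e: "e \<in> borel_measurable circle" "\<And>z. cmod z = 1 \<Longrightarrow> cmod (e z) \<le> 1"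
    unfolding e_def by (auto simp: norm_power_int)
  have int: "integrable circle (\<lambda>z. f z * e z)" if "f \<in> L2 circle" for f
  proof -
    note [measurable] = L2_measurable[OF that] e(1)
    show ?thesis
      by (rule Bochner_Integration.integrable_bound[OF L2_circle_integrable[OF that]])
         (use e(2) in \<open>auto simp: norm_mult intro!: mult_left_le\<close>)
  qed
  have bd: "cmod (fourier_coeff R n - fourier_coeff (S N) n) \<le> (sqrt (2 * pi) * L2_norm circle (\<lambda>z. R z - S N z)) / (2 * pi)" for N
  proof -
    have "fourier_coeff R n - fourier_coeff (S N) n = (LINT z|circle. (R z - S N z) * e z) / complex_of_real (2 * pi)"
      unfolding fourier_coeff_def e_def[symmetric] left_diff_distrib
      by (subst Bochner_Integration.integral_diff[OF int[OF R] int[OF S]]) (rule diff_divide_distrib[symmetric])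
    then show ?thesis
      using norm_integral_circle_le_L2_norm[OF L2_diff[OF R S] e, of N]
      by (simp add: norm_divide divide_right_mono)
  qed
  have "(\<lambda>N. fourier_coeff R n - fourier_coeff (S N) n) \<longlonglongrightarrow> 0"
  proof (rule Lim_null_comparison[OF always_eventually[OF allI[OF bd]]])
    show "(\<lambda>N. (sqrt (2 * pi) * L2_norm circle (\<lambda>z. R z - S N z)) / (2 * pi)) \<longlonglongrightarrow> 0"
      using tendsto_divide[OF tendsto_mult_left[OF riesz_projector_tendsto[OF g], of "sqrt (2 * pi)"] tendsto_const[of "2 * pi"]]
      by (simp add: R_def S_def)
  qed
  moreover have "(\<lambda>N. fourier_coeff R n - fourier_coeff (S N) n) \<longlonglongrightarrow> fourier_coeff R n - (if 0 \<le> n then fourier_coeff g n else 0)"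
  proof (rule tendsto_eventually, rule eventually_mono[OF eventually_gt_at_top[of "nat n"]])
    fix N assume "nat n < N"
    then show "fourier_coeff R n - fourier_coeff (S N) n = fourier_coeff R n - (if 0 \<le> n then fourier_coeff g n else 0)"
      unfolding S_def[abs_def] fourier_coeff_trig_poly by (auto simp: nat_less_iff)
  qed
  ultimately show ?thesis using LIMSEQ_unique by (fastforce simp: R_def)
qed


section \<open>Weights dominating the Cauchy kernel\<close>

lemma inverse_ennreal_antimono:
  assumes "0 \<le> a" "a \<le> b"
  shows "inverse (ennreal b) \<le> inverse (ennreal a)"
proof (cases "a = 0")
  case False
  then show ?thesis using assms by (auto simp: inverse_ennreal intro!: ennreal_leI le_imp_inverse_le)
qed simp

lemma nn_integral_abs_powr_finite:
  fixes a k R :: real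
  assumes a: "0 < a" "a < 1" and k: "0 < k" and R: "0 \<le> R"
  shows "(\<integral>\<^sup>+x\<in>{-R..R}. inverse (ennreal ((k * \<bar>x\<bar>) powr a)) \<partial>lborel) < \<infinity>"
proof -
  let ?f = "\<lambda>x. inverse (ennreal ((k * \<bar>x\<bar>) powr a))"
  have "(\<integral>\<^sup>+x\<in>{0..R}. ?f x \<partial>lborel) = (\<integral>\<^sup>+x\<in>{0..R}. ennreal (k powr (-a) * x powr (-a)) \<partial>lborel)"
  proof (rule nn_integral_cong_AE, use AE_lborel_singleton[of 0] in eventually_elim)
    case (elim x)
    have "?f x = ennreal (k powr (-a) * x powr (-a))" if "0 \<le> x"
    proof -
      have "?f x = ennreal (inverse ((k * x) powr a))"
        using that elim k by (subst inverse_ennreal) auto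
      then show ?thesis using that k by (simp add: powr_mult powr_minus)
    qed
    then show ?case by (auto simp: indicator_def)
  qed
  also have "\<dots> < \<infinity>"
  proof -
    have "((\<lambda>x. k powr (-a) * (x powr (-a))) has_integral (k powr (-a) * (R powr (-a + 1) / (-a + 1)))) {0..R}"
      by (intro has_integral_mult_right has_integral_powr_from_0) (use a R in auto)
    from nn_integral_has_integral_lebesgue'[OF _ this] show ?thesis by simp
  qed
  finally have half: "(\<integral>\<^sup>+x\<in>{0..R}. ?f x \<partial>lborel) < \<infinity>" .
  have "(\<integral>\<^sup>+x\<in>{-R..0}. ?f x \<partial>lborel) = (\<integral>\<^sup>+x\<in>{0..R}. ?f x \<partial>lborel)"
    by (subst nn_integral_real_affine[of _ "-1" 0]) (auto intro!: nn_integral_cong simp: indicator_def)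
  moreover have "(\<integral>\<^sup>+x\<in>{-R..R}. ?f x \<partial>lborel) \<le> (\<integral>\<^sup>+x. ?f x * indicator {-R..0} x + ?f x * indicator {0..R} x \<partial>lborel)"
    by (rule nn_integral_mono) (auto simp: indicator_def)
  moreover have "\<dots> = (\<integral>\<^sup>+x\<in>{-R..0}. ?f x \<partial>lborel) + (\<integral>\<^sup>+x\<in>{0..R}. ?f x \<partial>lborel)"
    by (rule nn_integral_add) auto
  ultimately show ?thesis using half by (auto simp: le_less_trans)
qed

lemma nn_integral_shift_le:
  fixes f :: "real \<Rightarrow> ennreal"
  assumes [measurable]: "f \<in> borel_measurable borel" and "\<And>x. x \<in> A \<Longrightarrow> \<bar>x - c\<bar> \<le> R"
  shows "(\<integral>\<^sup>+x\<in>A. f (x - c) \<partial>lborel) \<le> (\<integral>\<^sup>+x\<in>{-R..R}. f x \<partial>lborel)"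
proof -
  have "(\<integral>\<^sup>+x\<in>A. f (x - c) \<partial>lborel) \<le> (\<integral>\<^sup>+x. f (x - c) * indicator {-R..R} (x - c) \<partial>lborel)"
    by (rule nn_integral_mono) (use assms(2) in \<open>fastforce simp: indicator_def\<close>)
  also have "\<dots> = (\<integral>\<^sup>+x\<in>{-R..R}. f x \<partial>lborel)"
    by (subst nn_integral_real_affine[of "\<lambda>x. f x * indicator {-R..R} x" 1 "-c"]) auto
  finally show ?thesis .
qed

text \<open>A crude Jordan inequality: on \<open>[0, pi/4]\<close> the cosine is at least
  \<open>1/2\<close>, which bounds \<open>sin (u / 2)\<close> below by \<open>u / 4\<close>; the
  double-angle formula then brings in the factor \<open>2 * cos (u / 2)\<close>, at least
  \<open>1\<close>.\<close>

lemma sin_ge_quarter: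
  fixes u :: real assumes "0 \<le> u" "u \<le> pi / 2" shows "u / 4 \<le> sin u"
proof -
  have cos_half: "1 / 2 \<le> cos v" if "0 \<le> v" "v \<le> pi / 4" for v :: real
  proof -
    have "cos (pi / 3) \<le> cos v" by (rule cos_monotone_0_pi_le) (use that in auto)
    then show ?thesis by (simp add: cos_60)
  qed
  have "sin 0 - 0 / 2 \<le> sin (u / 2) - (u / 2) / 2"
  proof (rule DERIV_nonneg_imp_nondecreasing[of 0 "u / 2" "\<lambda>x. sin x - x / 2"])
    fix x assume "0 \<le> x" "x \<le> u / 2"
    then show "\<exists>y. ((\<lambda>x. sin x - x / 2) has_real_derivative y) (at x) \<and> 0 \<le> y"
      by (intro exI[of _ "cos x - 1 / 2"] conjI) (use cos_half[of x] assms in \<open>auto intro!: derivative_eq_intros\<close>)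
  qed (use assms in auto)
  then have "u / 4 \<le> sin (u / 2)" by simp
  moreover have "1 / 2 \<le> cos (u / 2)" by (rule cos_half) (use assms in auto)
  ultimately have "u / 4 * (1 / 2) \<le> sin (u / 2) * cos (u / 2)"
    by (intro mult_mono) (use assms in auto)
  then show ?thesis using sin_double[of "u / 2"] by simp
qed

text \<open>The chord is \<open>2 * sin (\<bar>x - y\<bar> / 2)\<close>. The minimum is the angular
  distance modulo \<open>2 * pi\<close>, written out so that a function of the chord can be
  dominated by a sum of three translates of a function on the line.\<close>

lemma cmod_cis_diff_ge:
  assumes x: "0 \<le> x" "x < 2 * pi" and y: "0 \<le> y" "y < 2 * pi"
  shows "min \<bar>x - y\<bar> (min \<bar>x - (y + 2 * pi)\<bar> \<bar>x - (y - 2 * pi)\<bar>) / 4 \<le> cmod (cis x - cis y)"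
proof -
  have sq: "(cmod (cis x - cis y))\<^sup>2 = (2 * sin (\<bar>x - y\<bar> / 2))\<^sup>2"
  proof -
    have "(cmod (cis x - cis y))\<^sup>2 = (cos x - cos y)\<^sup>2 + (sin x - sin y)\<^sup>2"
      by (simp add: cmod_power2)
    also have "\<dots> = ((sin x)\<^sup>2 + (cos x)\<^sup>2) + ((sin y)\<^sup>2 + (cos y)\<^sup>2) - 2 * cos (x - y)"
      unfolding cos_diff by (simp add: power2_eq_square algebra_simps)
    also have "\<dots> = 2 - 2 * cos \<bar>x - y\<bar>" by (simp add: cos_abs_real)
    also have "\<dots> = (2 * sin (\<bar>x - y\<bar> / 2))\<^sup>2"
      using cos_double_sin[of "\<bar>x - y\<bar> / 2"] by (simp add: power2_eq_square)
    finally show ?thesis .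
  qed
  have d: "0 \<le> \<bar>x - y\<bar> / 2" "\<bar>x - y\<bar> / 2 \<le> pi" using x y by auto
  then have "0 \<le> sin (\<bar>x - y\<bar> / 2)" by (rule sin_ge_zero)
  then have eq: "cmod (cis x - cis y) = 2 * sin (\<bar>x - y\<bar> / 2)"
    by (intro power2_eq_imp_eq[OF sq]) simp_all
  show ?thesis
  proof (cases "\<bar>x - y\<bar> \<le> pi")
    case True
    then have "\<bar>x - y\<bar> / 2 / 4 \<le> sin (\<bar>x - y\<bar> / 2)" by (intro sin_ge_quarter) auto
    then show ?thesis unfolding eq by linarith
  next
    case False
    have "(pi - \<bar>x - y\<bar> / 2) / 4 \<le> sin (pi - \<bar>x - y\<bar> / 2)" by (intro sin_ge_quarter) (use False d in auto)
    then have "(2 * pi - \<bar>x - y\<bar>) / 4 \<le> cmod (cis x - cis y)" unfolding eq sin_pi_minus by (simp add: field_simps)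
    moreover have m: "min \<bar>x - (y + 2 * pi)\<bar> \<bar>x - (y - 2 * pi)\<bar> \<le> 2 * pi - \<bar>x - y\<bar>"
      using x y by linarith
    have "min \<bar>x - y\<bar> (min \<bar>x - (y + 2 * pi)\<bar> \<bar>x - (y - 2 * pi)\<bar>) / 4 \<le> (2 * pi - \<bar>x - y\<bar>) / 4"
      by (rule divide_right_mono[OF order_trans[OF min.cobounded2 m]]) simp
    ultimately show ?thesis by (meson order_trans)
  qed
qed

text \<open>The Cauchy kernel is of size \<open>1 / (\<bar>s - t\<bar> + cmod (z - w))\<close>.
  Splitting the exponent \<open>1\<close> into \<open>1/4\<close> in time and \<open>3/4\<close> in
  space leaves both factors integrable, and the time factor even square integrable. The inverse is
  taken in \<open>ennreal\<close> and is infinite at \<open>z = w\<close>, so the domination of the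
  kernel holds at its singularity too.\<close>

definition chord_weight :: "complex \<Rightarrow> complex \<Rightarrow> ennreal" where
  "chord_weight z w = inverse (ennreal (cmod (z - w) powr (3/4)))"

lemma chord_weight_commute: "chord_weight z w = chord_weight w z"
  by (simp add: chord_weight_def norm_minus_commute)

lemma chord_weight_measurable [measurable (raw)]:
  "f \<in> borel_measurable M \<Longrightarrow> g \<in> borel_measurable M \<Longrightarrow> (\<lambda>x. chord_weight (f x) (g x)) \<in> borel_measurable M"
  unfolding chord_weight_def by measurable

lemma chord_weight_integral_bounded:
  obtains Q where "Q < \<infinity>" "\<And>z. cmod z = 1 \<Longrightarrow> (\<integral>\<^sup>+w. chord_weight w z \<partial>circle) \<le> Q"
proof -
  let ?f = "\<lambda>x::real. inverse (ennreal ((1/4 * \<bar>x\<bar>) powr (3/4)))"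
  \<comment> \<open>The three differences of angles met below have modulus less than
    \<open>4 * pi\<close>; \<open>6 * pi\<close> leaves room.\<close>
  define A where "A = (\<integral>\<^sup>+x\<in>{-(6*pi)..6*pi}. ?f x \<partial>lborel)"
  have A: "A < \<infinity>" unfolding A_def by (rule nn_integral_abs_powr_finite) auto
  have "(\<integral>\<^sup>+w. chord_weight w z \<partial>circle) \<le> A + (A + A)" if z: "cmod z = 1" for z
  proof -
    obtain y where y: "0 \<le> y" "y < 2 * pi" "z = cis y"
      using Arg2pi_ge_0[of z] Arg2pi_lt_2pi[of z] Arg2pi_eq[of z] z by (metis cis_conv_exp mult_1 of_real_1)
    have "(\<integral>\<^sup>+w. chord_weight w z \<partial>circle) = (\<integral>\<^sup>+x\<in>{0..<2*pi}. chord_weight (cis x) (cis y) \<partial>lborel)"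
      unfolding y(3) by (rule nn_integral_circle) measurable
    also have "\<dots> \<le> (\<integral>\<^sup>+x. ?f (x - y) * indicator {0..<2*pi} x + (?f (x - (y + 2 * pi)) * indicator {0..<2*pi} x
        + ?f (x - (y - 2 * pi)) * indicator {0..<2*pi} x) \<partial>lborel)"
    proof (rule nn_integral_mono)
      fix x
      have le: "chord_weight (cis x) (cis y) \<le> ?f d" if "\<bar>d\<bar> / 4 \<le> cmod (cis x - cis y)" for d
        unfolding chord_weight_def 
        by (intro inverse_ennreal_antimono powr_mono2) (use that in auto)
      show "chord_weight (cis x) (cis y) * indicator {0..<2*pi} x \<le> ?f (x - y) * indicator {0..<2*pi} x 
        + (?f (x - (y + 2 * pi)) * indicator {0..<2*pi} x + ?f (x - (y - 2 * pi)) * indicator {0..<2*pi} x)"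
      proof (cases "x \<in> {0..<2*pi}")
        case True
        have "min \<bar>x - y\<bar> (min \<bar>x - (y + 2 * pi)\<bar> \<bar>x - (y - 2 * pi)\<bar>) / 4 \<le> cmod (cis x - cis y)"
          by (intro cmod_cis_diff_ge) (use True y in auto)
        then consider "\<bar>x - y\<bar> / 4 \<le> cmod (cis x - cis y)" | "\<bar>x - (y + 2 * pi)\<bar> / 4 \<le> cmod (cis x - cis y)"
          | "\<bar>x - (y - 2 * pi)\<bar> / 4 \<le> cmod (cis x - cis y)"
          by (auto simp: min_def split: if_splits)
        then have "chord_weight (cis x) (cis y) \<le> ?f (x - y) + (?f (x - (y + 2 * pi)) + ?f (x - (y - 2 * pi)))"
        proof cases
          case 1 show ?thesis by (rule add_increasing2[OF _ le[OF 1]]) simp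
        next
          case 2 show ?thesis by (rule add_increasing[OF _ add_increasing2[OF _ le[OF 2]]]) simp_all
        next
          case 3 show ?thesis by (rule add_increasing[OF _ add_increasing[OF _ le[OF 3]]]) simp_all
        qed
        then show ?thesis using True by simp
      qed simp
    qed
    also have "\<dots> = (\<integral>\<^sup>+x\<in>{0..<2*pi}. ?f (x - y) \<partial>lborel) + ((\<integral>\<^sup>+x\<in>{0..<2*pi}. ?f (x - (y + 2 * pi)) \<partial>lborel)
        + (\<integral>\<^sup>+x\<in>{0..<2*pi}. ?f (x - (y - 2 * pi)) \<partial>lborel))"
      by (simp add: nn_integral_add)
    also have "\<dots> \<le> A + (A + A)"
      unfolding A_def by (intro add_mono nn_integral_shift_le) (use y in auto)
    finally show ?thesis .
  qed
  with A show ?thesis by (intro that[of "A + (A + A)"]) auto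
qed

definition time_weight :: "real \<Rightarrow> ennreal" where
  "time_weight t = inverse (ennreal (\<bar>t\<bar> powr (1/4)))"

lemma time_weight_minus: "time_weight (s - t) = time_weight (t - s)"
  by (simp add: time_weight_def abs_minus_commute)

lemma time_weight_measurable [measurable]: "time_weight \<in> borel_measurable borel"
  unfolding time_weight_def by measurable

text \<open>The bound on the square is what a merely square integrable control requires when
  \<open>t\<close> is held fixed.\<close>

lemma time_weight_integral_bounded:
  assumes "0 \<le> T"
  obtains P where "P < \<infinity>" "\<And>t. t \<in> {0..T} \<Longrightarrow> (\<integral>\<^sup>+s\<in>{0..T}. time_weight (s - t) \<partial>lborel) \<le> P"
    "\<And>t. t \<in> {0..T} \<Longrightarrow> (\<integral>\<^sup>+s\<in>{0..T}. (time_weight (s - t))\<^sup>2 \<partial>lborel) \<le> P"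
proof -
  define A where "A a = (\<integral>\<^sup>+x\<in>{-T..T}. inverse (ennreal ((1 * \<bar>x\<bar>) powr a)) \<partial>lborel)" for a
  have "A a < \<infinity>" if "0 < a" "a < 1" for a
    unfolding A_def by (rule nn_integral_abs_powr_finite[OF that zero_less_one assms])
  from this[of "1/4"] this[of "1/2"] have fin: "A (1/4) + A (1/2) < \<infinity>" by simp
  have sq: "(time_weight x)\<^sup>2 = inverse (ennreal ((1 * \<bar>x\<bar>) powr (1/2)))" for x
  proof -
    have "(\<bar>x\<bar> powr (1/4))\<^sup>2 = \<bar>x\<bar> powr (1/2)"
      by (simp add: power2_eq_square flip: powr_add)
    then show ?thesis
      by (simp add: time_weight_def ennreal_inverse_power[symmetric] ennreal_power)
  qed
  have "(\<integral>\<^sup>+s\<in>{0..T}. time_weight (s - t) \<partial>lborel) \<le> A (1/4)" if "t \<in> {0..T}" for t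
  proof -
    have "(\<integral>\<^sup>+s\<in>{0..T}. time_weight (s - t) \<partial>lborel) \<le> (\<integral>\<^sup>+s\<in>{-T..T}. time_weight s \<partial>lborel)"
      by (rule nn_integral_shift_le) (use that in auto)
    then show ?thesis by (simp add: A_def time_weight_def)
  qed
  moreover have "(\<integral>\<^sup>+s\<in>{0..T}. (time_weight (s - t))\<^sup>2 \<partial>lborel) \<le> A (1/2)" if "t \<in> {0..T}" for t
    unfolding A_def sq[symmetric] by (rule nn_integral_shift_le) (use that in auto)
  ultimately show ?thesis using fin
    by (intro that[of "A (1/4) + A (1/2)"]) (auto intro: add_increasing2 add_increasing)
qed

text \<open>With \<open>\<rho> = z * cnj w\<close> the denominator \<open>D\<close> is at least
  \<open>exp (- T) * \<bar>s - t\<bar>\<close> by its radial part and at least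
  \<open>cmod (z - w) / 2\<close> by the triangle inequality. Writing
  \<open>D = D powr (1/4) * D powr (3/4)\<close> and using one bound in each factor gives the
  weights; the constant is rounded up to \<open>2 * exp T\<close>.\<close>

lemma kernel_bound:
  assumes s: "s \<in> {0..T}" and t: "t \<in> {0..T}" and z: "cmod z = 1" and w: "cmod w = 1"
  shows "ennreal (1 / cmod (1 - of_real (exp (- t)) * z * of_real (exp s) * cnj w))
    \<le> ennreal (2 * exp T) * (time_weight (s - t) * chord_weight z w)"
proof -
  define D where "D = cmod (1 - of_real (exp (- t)) * z * of_real (exp s) * cnj w)"
  define \<rho> where "\<rho> = z * cnj w"
  have D: "D = cmod (1 - of_real (exp (s - t)) * \<rho>)"
    by (simp add: D_def \<rho>_def exp_diff exp_minus field_simps)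
  have \<rho>: "cmod \<rho> = 1" using z w by (simp add: \<rho>_def norm_mult)
  have D1: "\<bar>1 - exp (s - t)\<bar> \<le> D"
    using one_minus_ge[OF \<rho>, of "of_real (exp (s - t))"] by (simp add: D)
  have "exp (- T) * \<bar>s - t\<bar> \<le> \<bar>1 - exp (s - t)\<bar>"
  proof (cases "t \<le> s")
    case True
    have "exp (- T) * (s - t) \<le> 1 * (s - t)" by (intro mult_right_mono) (use True s in auto)
    also have "\<dots> \<le> exp (s - t) - 1" using exp_ge_add_one_self[of "s - t"] by (simp add: algebra_simps)
    finally show ?thesis using True by simp
  next
    case False
    have "exp (- T) * (t - s) \<le> exp (s - t) * (exp (t - s) - 1)"
    proof (intro mult_mono)
      show "t - s \<le> exp (t - s) - 1" using exp_ge_add_one_self[of "t - s"] by (simp add: algebra_simps)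
    qed (use False s t in auto)
    also have "\<dots> = 1 - exp (s - t)" by (simp add: right_diff_distrib flip: exp_add)
    finally show ?thesis using False by simp
  qed
  with D1 have Dt: "exp (- T) * \<bar>s - t\<bar> \<le> D" by linarith
  have "w * cnj w = 1" using w by (simp flip: complex_norm_square)
  then have "z - w = w * (\<rho> - 1)" by (simp add: \<rho>_def algebra_simps)
  then have "cmod (z - w) = cmod (1 - \<rho>)" using w by (simp add: norm_mult norm_minus_commute)
  \<comment> \<open>Replacing the radius \<open>exp (s - t)\<close> by \<open>1\<close> costs its
    distance to \<open>1\<close>, which is itself at most \<open>D\<close>; hence the factor
    \<open>2\<close>.\<close>
  also have "\<dots> \<le> D + cmod (of_real (exp (s - t)) * \<rho> - \<rho>)"
    unfolding D using norm_triangle_ineq[of "1 - of_real (exp (s - t)) * \<rho>" "of_real (exp (s - t)) * \<rho> - \<rho>"] by simp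
  also have "cmod (of_real (exp (s - t)) * \<rho> - \<rho>) = \<bar>1 - exp (s - t)\<bar>"
  proof -
    have "of_real (exp (s - t)) * \<rho> - \<rho> = of_real (exp (s - t) - 1) * \<rho>" by (simp add: algebra_simps)
    then show ?thesis using \<rho> by (simp only: norm_mult norm_of_real) (simp add: abs_minus_commute)
  qed
  finally have Dz: "cmod (z - w) / 2 \<le> D" using D1 by simp
  define X where "X = \<bar>s - t\<bar> powr (1/4) * cmod (z - w) powr (3/4)"
  have eT: "0 < exp (- T)" "exp (- T) \<le> 1" using s by auto
  have "exp (- T) / 2 * X \<le> (exp (- T) powr (1/4) * (1/2) powr (3/4)) * X"
  proof (intro mult_right_mono)
    have "exp (- T) powr 1 \<le> exp (- T) powr (1/4)" by (rule powr_mono') (use eT in auto)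
    moreover have "(1/2::real) powr 1 \<le> (1/2) powr (3/4)" by (rule powr_mono') auto
    ultimately have "exp (- T) powr 1 * (1/2::real) powr 1 \<le> exp (- T) powr (1/4) * (1/2) powr (3/4)"
      by (intro mult_mono) auto
    then show "exp (- T) / 2 \<le> exp (- T) powr (1/4) * (1/2) powr (3/4)" by simp
  qed (simp add: X_def)
  also have "\<dots> = (exp (- T) * \<bar>s - t\<bar>) powr (1/4) * (cmod (z - w) / 2) powr (3/4)"
    by (simp add: X_def powr_mult powr_divide)
  also have "\<dots> \<le> D powr (1/4) * D powr (3/4)"
    by (intro mult_mono powr_mono2 Dt Dz) auto
  also have "\<dots> = D" by (simp add: D_def flip: powr_add)
  finally have XD: "exp (- T) / 2 * X \<le> D" .
  have rhs: "time_weight (s - t) * chord_weight z w = inverse (ennreal X)"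
    unfolding time_weight_def chord_weight_def X_def
    by (simp add: ennreal_mult ennreal_inverse_mult)
  show ?thesis
  proof (cases "X = 0")
    case True
    then show ?thesis unfolding rhs by (simp add: ennreal_mult_top)
  next
    case False
    then have X: "0 < X" by (simp add: X_def)
    then have pos: "0 < exp (- T) / 2 * X" by simp
    have "1 / D \<le> 1 / (exp (- T) / 2 * X)" by (intro divide_left_mono XD) (use pos XD in auto)
    also have "\<dots> = 2 * exp T * inverse X" by (simp add: exp_minus divide_simps)
    finally show ?thesis unfolding rhs D_def[symmetric] using X
      by (simp add: inverse_ennreal ennreal_leI flip: ennreal_mult)
  qed
qed


section \<open>Cauchy transforms of controls\<close>

text \<open>The holomorphic extension to the disc of the Riesz projection of \<open>f\<close>:
  negative coefficients are not read.\<close>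

definition power_ext :: "(complex \<Rightarrow> complex) \<Rightarrow> complex \<Rightarrow> complex" where
  "power_ext f \<zeta> = (\<Sum>n. fourier_coeff f (int n) * \<zeta> ^ n)"

lemma fourier_coeff_cong_AE:
  assumes "f \<in> borel_measurable circle" "g \<in> borel_measurable circle" "AE z in circle. f z = g z"
  shows "fourier_coeff f n = fourier_coeff g n"
proof -
  note [measurable] = assms(1,2)
  have "(LINT z|circle. f z * z powi (- n)) = (LINT z|circle. g z * z powi (- n))"
    by (rule integral_cong_AE) (use assms(3) in auto)
  then show ?thesis by (simp add: fourier_coeff_def)
qed

lemma fourier_coeff_bound:
  assumes "integrable circle f"
  shows "cmod (fourier_coeff f n) \<le> (LINT z|circle. cmod (f z)) / (2 * pi)"
proof -
  have [measurable]: "f \<in> borel_measurable circle" using assms by auto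
  have "integrable circle (\<lambda>z. f z * z powi (- n))"
    by (rule Bochner_Integration.integrable_bound[OF assms]) (auto simp: norm_mult norm_power_int)
  then have "cmod (LINT z|circle. f z * z powi (- n)) \<le> (LINT z|circle. cmod (f z))"
    by (rule Bochner_Integration.integral_norm_bound_integral)
       (use assms in \<open>auto simp: norm_mult norm_power_int\<close>)
  then show ?thesis by (simp add: fourier_coeff_def norm_divide divide_right_mono)
qed

lemma power_ext_summable:
  assumes "integrable circle f" "cmod \<zeta> < 1"
  shows "summable (\<lambda>n. cmod (fourier_coeff f (int n) * \<zeta> ^ n))"
proof (rule summable_comparison_test')
  show "summable (\<lambda>n. (LINT z|circle. cmod (f z)) / (2 * pi) * cmod \<zeta> ^ n)"
    by (intro summable_mult summable_geometric) (use assms(2) in auto)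
  show "norm (cmod (fourier_coeff f (int n) * \<zeta> ^ n)) \<le> (LINT z|circle. cmod (f z)) / (2 * pi) * cmod \<zeta> ^ n" for n
    using mult_right_mono[OF fourier_coeff_bound[OF assms(1), of "int n"], of "cmod \<zeta> ^ n"]
    by (simp add: norm_mult norm_power)
qed

text \<open>On functions without negative modes the damping \<open>exp (- \<bar>n\<bar> * t)\<close>
  is a dilation of the argument by \<open>exp (- t)\<close>: time corresponds to a radius in the
  disc.\<close>

lemma semigroup_S_eq_power_ext:
  assumes f: "integrable circle f" "\<And>n. n < 0 \<Longrightarrow> fourier_coeff f n = 0"
    and t: "0 < t" and z: "cmod z = 1"
  shows "semigroup_S t f z = power_ext f (of_real (exp (- t)) * z)"
proof -
  let ?a = "\<lambda>n. fourier_coeff f n * exp (- real_of_int \<bar>n\<bar> * t) * z powi n"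
  have eq: "?a (int n) = fourier_coeff f (int n) * (of_real (exp (- t)) * z) ^ n" for n
    by (simp add: power_mult_distrib exp_of_nat_mult[symmetric] flip: of_real_power)
  have "(\<Sum>\<^sub>\<infinity>n\<in>UNIV. ?a n) = (\<Sum>\<^sub>\<infinity>n\<in>range int. ?a n)"
  proof (rule infsum_cong_neutral)
    fix n assume "n \<in> UNIV - range int"
    then have "n < 0" by (metis DiffE nonneg_int_cases not_le rangeI)
    then show "?a n = 0" using f(2) by simp
  qed auto
  also have "\<dots> = (\<Sum>\<^sub>\<infinity>n\<in>UNIV. ?a (int n))"
    by (subst infsum_reindex) (auto simp: o_def)
  also have "\<dots> = (\<Sum>\<^sub>\<infinity>n\<in>UNIV. fourier_coeff f (int n) * (of_real (exp (- t)) * z) ^ n)"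
    by (simp only: eq)
  also have "\<dots> = power_ext f (of_real (exp (- t)) * z)"
    unfolding power_ext_def
    by (intro infsumI norm_summable_imp_has_sum summable_sums[OF summable_norm_cancel] power_ext_summable f)
       (use t z in \<open>auto simp: norm_mult\<close>)
  finally show ?thesis using t by (simp add: semigroup_S_def)
qed

text \<open>Cauchy's formula for the projection of an integrable function, by expanding the kernel
  in a geometric series. Applied to the time slices of a control it produces the space-time
  kernel.\<close>

lemma power_ext_cauchy:
  assumes f: "integrable circle f" and \<zeta>: "cmod \<zeta> < 1"
  shows "power_ext f \<zeta> = (LINT w|circle. f w / (1 - \<zeta> * cnj w)) / complex_of_real (2 * pi)"
proof -
  have [measurable]: "f \<in> borel_measurable circle" using f by auto
  let ?g = "\<lambda>n w. \<zeta> ^ n * (f w * cnj w ^ n)"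
  have i: "integrable circle (\<lambda>w. f w * cnj w ^ n)" for n
    by (rule Bochner_Integration.integrable_bound[OF f]) (auto simp: norm_mult norm_power)
  have nrm: "cmod (?g n w) = cmod \<zeta> ^ n * cmod (f w)" if "cmod w = 1" for n w
    using that by (simp add: norm_mult norm_power)
  have "(\<lambda>n. LINT w|circle. ?g n w) sums (LINT w|circle. (\<Sum>n. ?g n w))"
  proof (rule sums_integral)
    show "integrable circle (?g n)" for n using i by simp
    show "AE w in circle. summable (\<lambda>n. norm (?g n w))"
      by (rule AE_I2) (use \<zeta> in \<open>auto simp: nrm intro!: summable_mult2 summable_geometric\<close>)
    have "(LINT w|circle. norm (?g n w)) = cmod \<zeta> ^ n * (LINT w|circle. cmod (f w))" for n
      by (subst Bochner_Integration.integral_mult_right_zero[symmetric], rule Bochner_Integration.integral_cong[OF refl]) (simp add: nrm)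
    then show "summable (\<lambda>n. LINT w|circle. norm (?g n w))"
      using \<zeta> by (auto intro!: summable_mult2 summable_geometric)
  qed
  also have "(LINT w|circle. (\<Sum>n. ?g n w)) = (LINT w|circle. f w / (1 - \<zeta> * cnj w))"
  proof (rule Bochner_Integration.integral_cong[OF refl])
    fix w assume "w \<in> space circle"
    then have "cmod (\<zeta> * cnj w) < 1" using \<zeta> by (simp add: norm_mult)
    from sums_mult[OF geometric_sums[OF this], of "f w"]
    have "(\<lambda>n. ?g n w) sums (f w / (1 - \<zeta> * cnj w))" by (simp add: power_mult_distrib mult_ac)
    then show "(\<Sum>n. ?g n w) = f w / (1 - \<zeta> * cnj w)" by (rule sums_unique[symmetric])
  qed
  finally have "(\<lambda>n. \<zeta> ^ n * (LINT w|circle. f w * cnj w ^ n)) sums (LINT w|circle. f w / (1 - \<zeta> * cnj w))"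
    using i by simp
  from sums_divide[OF this, of "complex_of_real (2 * pi)"] show ?thesis
    unfolding power_ext_def fourier_coeff_cnj by (simp add: sums_iff mult_ac)
qed

section \<open>Integration over the space-time cylinder\<close>

abbreviation cylinder :: "(real \<times> complex) measure" where
  "cylinder \<equiv> lborel \<Otimes>\<^sub>M circle"

lemma measurable_fst_circle [measurable]: "fst \<in> borel_measurable (circle \<Otimes>\<^sub>M M)"
  by (rule measurable_compose[OF measurable_fst measurable_ident_circle])

interpretation cyl_cyl: pair_sigma_finite cylinder cylinder ..
interpretation circ_cyl: pair_sigma_finite circle cylinder ..

text \<open>Lets controls be treated as functions on the whole cylinder that vanish outside
  \<open>{0..T} \<times> \<omega>\<close>, so that control spaces for different times can be
  compared.\<close>

lemma pair_restrict_space: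
  assumes M: "sigma_finite_measure M" and N: "sigma_finite_measure N"
    and A: "A \<in> sets M" and B: "B \<in> sets N"
  shows "restrict_space M A \<Otimes>\<^sub>M restrict_space N B = restrict_space (M \<Otimes>\<^sub>M N) (A \<times> B)"
proof (rule pair_measure_eqI)
  interpret N: sigma_finite_measure N by fact
  have AB: "A \<times> B \<in> sets (M \<Otimes>\<^sub>M N)" using A B by simp
  show "sigma_finite_measure (restrict_space M A)" "sigma_finite_measure (restrict_space N B)"
    using M N A B by (auto intro: sigma_finite_measure_restrict_space)
  show "sets (restrict_space M A \<Otimes>\<^sub>M restrict_space N B) = sets (restrict_space (M \<Otimes>\<^sub>M N) (A \<times> B))"
  proof
    show "sets (restrict_space M A \<Otimes>\<^sub>M restrict_space N B) \<subseteq> sets (restrict_space (M \<Otimes>\<^sub>M N) (A \<times> B))"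
      by (rule sets_pair_in_sets) (use A B in \<open>auto simp: sets_restrict_space_iff\<close>)
    have sub: "A \<subseteq> space M" "B \<subseteq> space N" using A B sets.sets_into_space by auto
    have "fst \<in> restrict_space M A \<Otimes>\<^sub>M restrict_space N B \<rightarrow>\<^sub>M M" "snd \<in> restrict_space M A \<Otimes>\<^sub>M restrict_space N B \<rightarrow>\<^sub>M N"
      by (auto intro!: measurable_compose[OF measurable_fst] measurable_compose[OF measurable_snd] measurable_restrict_space1)
    then have "(\<lambda>p. (fst p, snd p)) \<in> restrict_space M A \<Otimes>\<^sub>M restrict_space N B \<rightarrow>\<^sub>M M \<Otimes>\<^sub>M N"
      by (rule measurable_Pair)
    then have m: "(\<lambda>p. p) \<in> restrict_space M A \<Otimes>\<^sub>M restrict_space N B \<rightarrow>\<^sub>M M \<Otimes>\<^sub>M N" by simp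
    show "sets (restrict_space (M \<Otimes>\<^sub>M N) (A \<times> B)) \<subseteq> sets (restrict_space M A \<Otimes>\<^sub>M restrict_space N B)"
    proof
      fix X assume "X \<in> sets (restrict_space (M \<Otimes>\<^sub>M N) (A \<times> B))"
      then have X: "X \<in> sets (M \<Otimes>\<^sub>M N)" "X \<subseteq> A \<times> B" using AB by (auto simp: sets_restrict_space_iff)
      have "X = (\<lambda>p. p) -` X \<inter> space (restrict_space M A \<Otimes>\<^sub>M restrict_space N B)"
        using X(2) sub by (auto simp: space_pair_measure space_restrict_space)
      also have "\<dots> \<in> sets (restrict_space M A \<Otimes>\<^sub>M restrict_space N B)"
        by (rule measurable_sets[OF m X(1)])
      finally show "X \<in> sets (restrict_space M A \<Otimes>\<^sub>M restrict_space N B)" .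
    qed
  qed
  fix a b assume "a \<in> sets (restrict_space M A)" "b \<in> sets (restrict_space N B)"
  then have ab: "a \<subseteq> A" "a \<in> sets M" "b \<subseteq> B" "b \<in> sets N" using A B by (auto simp: sets_restrict_space_iff)
  have "emeasure (restrict_space (M \<Otimes>\<^sub>M N) (A \<times> B)) (a \<times> b) = emeasure (M \<Otimes>\<^sub>M N) (a \<times> b)"
    by (rule emeasure_restrict_space) (use AB ab in auto)
  then show "emeasure (restrict_space M A) a * emeasure (restrict_space N B) b = emeasure (restrict_space (M \<Otimes>\<^sub>M N) (A \<times> B)) (a \<times> b)"
    using A B ab by (simp add: emeasure_restrict_space N.emeasure_pair_measure_Times)
qed

lemma control_space_eq:
  assumes "\<omega> \<in> sets circle"
  shows "control_space T \<omega> = restrict_space cylinder ({0..T} \<times> \<omega>)"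
  unfolding control_space_def
  by (rule pair_restrict_space) (use assms in \<open>auto intro: sigma_finite_lborel circle.sigma_finite_measure_axioms\<close>)

lemma L2_restrict_space:
  assumes "S \<in> sets M"
  shows "u \<in> L2 (restrict_space M S) \<longleftrightarrow> (\<lambda>p. indicator S p *\<^sub>R u p) \<in> L2 M" (is ?A)
    and "L2_norm (restrict_space M S) u = L2_norm M (\<lambda>p. indicator S p *\<^sub>R u p)" (is ?B)
proof -
  have S: "S \<inter> space M \<in> sets M" using assms by auto
  have eq: "(cmod (indicator S p *\<^sub>R u p))\<^sup>2 = indicator S p *\<^sub>R (cmod (u p))\<^sup>2" for p
    by (simp add: indicator_def)
  show ?A unfolding L2_def mem_Collect_eq eq integrable_restrict_space[OF S] borel_measurable_restrict_space_iff[OF S] ..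
  show ?B unfolding L2_norm_def eq integral_restrict_space[OF S] ..
qed

text \<open>Cauchy-Schwarz for the measure with density \<open>k x\<close> gives \<open>A\<close>
  times the integral of \<open>k x y\<close> against the square of \<open>f\<close>; Tonelli then
  integrates in \<open>x\<close> first, which gives \<open>B\<close>.\<close>

lemma nn_integral_schur:
  assumes "pair_sigma_finite M N"
    and k [measurable]: "(\<lambda>(x, y). k x y) \<in> borel_measurable (M \<Otimes>\<^sub>M N)" and f [measurable]: "f \<in> borel_measurable N"
    and A: "\<And>x. x \<in> space M \<Longrightarrow> (\<integral>\<^sup>+y. k x y \<partial>N) \<le> A"
    and B: "\<And>y. y \<in> space N \<Longrightarrow> (\<integral>\<^sup>+x. k x y \<partial>M) \<le> B"
  shows "(\<integral>\<^sup>+x. (\<integral>\<^sup>+y. k x y * f y \<partial>N)\<^sup>2 \<partial>M) \<le> A * B * (\<integral>\<^sup>+y. (f y)\<^sup>2 \<partial>N)"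
proof -
  interpret pair_sigma_finite M N by fact
  have "(\<integral>\<^sup>+y. k x y * f y \<partial>N)\<^sup>2 \<le> A * (\<integral>\<^sup>+y. k x y * (f y)\<^sup>2 \<partial>N)" if x: "x \<in> space M" for x
  proof -
    have [measurable]: "k x \<in> borel_measurable N" using measurable_Pair2[OF k x] by simp
    have "(\<integral>\<^sup>+y. f y * 1 \<partial>density N (k x))\<^sup>2 \<le> (\<integral>\<^sup>+y. (f y)\<^sup>2 \<partial>density N (k x)) * (\<integral>\<^sup>+y. 1\<^sup>2 \<partial>density N (k x))"
      by (rule Cauchy_Schwarz_nn_integral) auto
    then have "(\<integral>\<^sup>+y. k x y * f y \<partial>N)\<^sup>2 \<le> (\<integral>\<^sup>+y. k x y * (f y)\<^sup>2 \<partial>N) * (\<integral>\<^sup>+y. k x y \<partial>N)"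
      by (subst (asm) (1 2 3) nn_integral_density) (simp_all add: emeasure_density)
    also have "\<dots> \<le> (\<integral>\<^sup>+y. k x y * (f y)\<^sup>2 \<partial>N) * A" by (intro mult_left_mono A x) simp
    finally show ?thesis by (simp add: mult.commute)
  qed
  then have "(\<integral>\<^sup>+x. (\<integral>\<^sup>+y. k x y * f y \<partial>N)\<^sup>2 \<partial>M) \<le> (\<integral>\<^sup>+x. A * (\<integral>\<^sup>+y. k x y * (f y)\<^sup>2 \<partial>N) \<partial>M)"
    by (rule nn_integral_mono)
  also have "\<dots> = A * (\<integral>\<^sup>+x. (\<integral>\<^sup>+y. k x y * (f y)\<^sup>2 \<partial>N) \<partial>M)"
    by (rule nn_integral_cmult) measurable
  also have "(\<integral>\<^sup>+x. (\<integral>\<^sup>+y. k x y * (f y)\<^sup>2 \<partial>N) \<partial>M) = (\<integral>\<^sup>+y. (\<integral>\<^sup>+x. k x y * (f y)\<^sup>2 \<partial>M) \<partial>N)"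
    by (rule Fubini'[symmetric]) measurable
  also have "\<dots> = (\<integral>\<^sup>+y. (\<integral>\<^sup>+x. k x y \<partial>M) * (f y)\<^sup>2 \<partial>N)"
    by (intro nn_integral_cong nn_integral_multc) measurable
  also have "\<dots> \<le> (\<integral>\<^sup>+y. B * (f y)\<^sup>2 \<partial>N)"
    by (intro nn_integral_mono mult_right_mono B) auto
  also have "\<dots> = B * (\<integral>\<^sup>+y. (f y)\<^sup>2 \<partial>N)" by (rule nn_integral_cmult) measurable
  finally show ?thesis by (simp add: mult_left_mono mult.assoc)
qed

text \<open>For \<open>\<zeta> = exp (- t) * z\<close> this is the kernel of the solution formula
  with the two times separated. A control thus has a single transform, in one complex variable, that
  serves all times \<open>t\<close> at once.\<close>

definition cauchy_kernel :: "complex \<Rightarrow> real \<times> complex \<Rightarrow> complex" where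
  "cauchy_kernel \<zeta> p = 1 / (1 - \<zeta> * of_real (exp (fst p)) * cnj (snd p))"

definition cauchy_transform :: "(real \<times> complex \<Rightarrow> complex) \<Rightarrow> complex \<Rightarrow> complex" where
  "cauchy_transform u \<zeta> = (LINT p|cylinder. u p * cauchy_kernel \<zeta> p)"

lemma measurable_of_real [measurable (raw)]:
  "f \<in> borel_measurable M \<Longrightarrow> (\<lambda>x. complex_of_real (f x)) \<in> borel_measurable M"
  by (rule borel_measurable_continuous_on[where f = complex_of_real]) (intro continuous_intros)

lemma cauchy_kernel_measurable [measurable (raw)]:
  assumes "f \<in> borel_measurable M" "g \<in> borel_measurable M" "h \<in> borel_measurable M"
  shows "(\<lambda>x. cauchy_kernel (f x) (g x, h x)) \<in> borel_measurable M"
  unfolding cauchy_kernel_def fst_conv snd_conv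
  by (intro borel_measurable_divide borel_measurable_diff borel_measurable_times borel_measurable_const
      measurable_of_real borel_measurable_cnj measurable_compose[OF _ borel_measurable_exp] assms)

lemma nn_integral_weights:
  assumes "0 \<le> T"
  obtains A where "A < \<infinity>"
    "\<And>t z. t \<in> {0..T} \<Longrightarrow> cmod z = 1 \<Longrightarrow>
      (\<integral>\<^sup>+p. time_weight (fst p - t) * chord_weight z (snd p) * indicator {0..T} (fst p) \<partial>cylinder) \<le> A"
proof -
  obtain P where P: "P < \<infinity>" "\<And>t. t \<in> {0..T} \<Longrightarrow> (\<integral>\<^sup>+s\<in>{0..T}. time_weight (s - t) \<partial>lborel) \<le> P"
    using time_weight_integral_bounded[OF assms] by metis
  obtain Q where Q: "Q < \<infinity>" "\<And>z. cmod z = 1 \<Longrightarrow> (\<integral>\<^sup>+w. chord_weight w z \<partial>circle) \<le> Q"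
    using chord_weight_integral_bounded by metis
  have "(\<integral>\<^sup>+p. time_weight (fst p - t) * chord_weight z (snd p) * indicator {0..T} (fst p) \<partial>cylinder) \<le> P * Q"
    if t: "t \<in> {0..T}" and z: "cmod z = 1" for t z
  proof -
    have "(\<integral>\<^sup>+p. time_weight (fst p - t) * chord_weight z (snd p) * indicator {0..T} (fst p) \<partial>cylinder)
       = (\<integral>\<^sup>+s. (\<integral>\<^sup>+w. (time_weight (s - t) * indicator {0..T} s) * chord_weight w z \<partial>circle) \<partial>lborel)"
      by (subst circle.nn_integral_fst[symmetric]) (simp_all add: chord_weight_commute[of z] ac_simps)
    also have "\<dots> = (\<integral>\<^sup>+s. (time_weight (s - t) * indicator {0..T} s) * (\<integral>\<^sup>+w. chord_weight w z \<partial>circle) \<partial>lborel)"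
      by (intro nn_integral_cong nn_integral_cmult) measurable
    also have "\<dots> = (\<integral>\<^sup>+s. time_weight (s - t) * indicator {0..T} s \<partial>lborel) * (\<integral>\<^sup>+w. chord_weight w z \<partial>circle)"
      by (rule nn_integral_multc) measurable
    also have "\<dots> \<le> P * Q" by (intro mult_mono P Q t z) auto
    finally show ?thesis .
  qed
  with P(1) Q(1) show ?thesis by (intro that[of "P * Q"]) (auto simp: ennreal_mult_less_top)
qed

lemma cauchy_kernel_bound:
  assumes "fst p \<in> {0..T}" "t \<in> {0..T}" "cmod z = 1" "p \<in> space cylinder"
  shows "ennreal (cmod (cauchy_kernel (of_real (exp (- t)) * z) p))
    \<le> ennreal (2 * exp T) * (time_weight (fst p - t) * chord_weight z (snd p))"
  using kernel_bound[of "fst p" T t z "snd p"] assms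
  by (auto simp: cauchy_kernel_def norm_divide space_pair_measure)

text \<open>Schur's test with the product weight, cut off to \<open>{0..T}\<close> in both times;
  the dominating kernel \<open>k\<close> is symmetric, so one bound serves for rows and
  columns.\<close>

lemma cauchy_transform_L2:
  assumes T: "0 \<le> T" and u: "u \<in> L2 cylinder" and supp: "\<forall>p. fst p \<notin> {0..T} \<longrightarrow> u p = 0"
  shows "(\<lambda>p. indicator {0..T} (fst p) *\<^sub>R cauchy_transform u (of_real (exp (- fst p)) * snd p)) \<in> L2 cylinder"
    (is "?v \<in> _")
proof -
  note [measurable] = L2_measurable[OF u]
  define E where "E = ennreal (2 * exp T)"
  obtain A where A: "A < \<infinity>" "\<And>t z. t \<in> {0..T} \<Longrightarrow> cmod z = 1 \<Longrightarrow>
      (\<integral>\<^sup>+p. time_weight (fst p - t) * chord_weight z (snd p) * indicator {0..T} (fst p) \<partial>cylinder) \<le> A"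
    using nn_integral_weights[OF T] by blast
  define k where "k q p = indicator {0..T} (fst q) * (E * (time_weight (fst p - fst q) * chord_weight (snd q) (snd p) * indicator {0..T} (fst p)))" for q p :: "real \<times> complex"
  have k_sym: "k q p = k p q" for p q
    by (simp add: k_def time_weight_minus[of "fst p"] chord_weight_commute[of "snd p"] ac_simps)
  have kA: "(\<integral>\<^sup>+p. k q p \<partial>cylinder) \<le> E * A" if "q \<in> space cylinder" for q
  proof (cases "fst q \<in> {0..T}")
    case True
    have "(\<integral>\<^sup>+p. k q p \<partial>cylinder) = E * (\<integral>\<^sup>+p. time_weight (fst p - fst q) * chord_weight (snd q) (snd p) * indicator {0..T} (fst p) \<partial>cylinder)"
      using True unfolding k_def by (simp add: nn_integral_cmult)
    also have "\<dots> \<le> E * A" using that by (intro mult_left_mono A(2) True) (auto simp: space_pair_measure)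
    finally show ?thesis .
  qed (simp add: k_def)
  have "(\<integral>\<^sup>+q. (\<integral>\<^sup>+p. k q p * ennreal (cmod (u p)) \<partial>cylinder)\<^sup>2 \<partial>cylinder)
      \<le> (E * A) * (E * A) * (\<integral>\<^sup>+p. (ennreal (cmod (u p)))\<^sup>2 \<partial>cylinder)"
  proof (rule nn_integral_schur)
    show "pair_sigma_finite cylinder cylinder" ..
    show "(\<lambda>(q, p). k q p) \<in> borel_measurable (cylinder \<Otimes>\<^sub>M cylinder)"
      unfolding k_def by measurable
    show "(\<integral>\<^sup>+q. k q p \<partial>cylinder) \<le> E * A" if "p \<in> space cylinder" for p
      using kA[OF that] by (simp add: k_sym[of _ p])
  qed (use kA in auto)
  also have "\<dots> < \<infinity>"
    using A(1) u by (auto simp: E_def L2_iff_nn_integral ennreal_power ennreal_mult_less_top)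
  finally have fin: "(\<integral>\<^sup>+q. (\<integral>\<^sup>+p. k q p * ennreal (cmod (u p)) \<partial>cylinder)\<^sup>2 \<partial>cylinder) < \<infinity>" .
  have bound: "ennreal ((cmod (?v q))\<^sup>2) \<le> (\<integral>\<^sup>+p. k q p * ennreal (cmod (u p)) \<partial>cylinder)\<^sup>2" if q: "q \<in> space cylinder" for q
  proof (cases "fst q \<in> {0..T}")
    case True
    let ?F = "\<lambda>p. u p * cauchy_kernel (of_real (exp (- fst q)) * snd q) p"
    have "ennreal (cmod (cauchy_transform u (of_real (exp (- fst q)) * snd q))) \<le> (\<integral>\<^sup>+p. ennreal (cmod (?F p)) \<partial>cylinder)"
    \<comment> \<open>Where the slice is not integrable the Bochner integral is \<open>0\<close> by
      convention, and the bound is trivial.\<close>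
    proof (cases "integrable cylinder ?F")
      case True
      then show ?thesis unfolding cauchy_transform_def by (rule integral_norm_bound_ennreal)
    qed (simp add: cauchy_transform_def not_integrable_integral_eq)
    also have "\<dots> \<le> (\<integral>\<^sup>+p. k q p * ennreal (cmod (u p)) \<partial>cylinder)"
    proof (rule nn_integral_mono)
      fix p assume p: "p \<in> space cylinder"
      show "ennreal (cmod (?F p)) \<le> k q p * ennreal (cmod (u p))"
      proof (cases "fst p \<in> {0..T}")
        case pT: True
        have "ennreal (cmod (?F p)) = ennreal (cmod (cauchy_kernel (of_real (exp (- fst q)) * snd q) p)) * ennreal (cmod (u p))"
          by (simp add: norm_mult ennreal_mult mult.commute)
        also have "\<dots> \<le> k q p * ennreal (cmod (u p))"
          unfolding k_def E_def using pT True q p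
          by (intro mult_right_mono) (auto simp: space_pair_measure intro!: cauchy_kernel_bound)
        finally show ?thesis .
      qed (simp add: supp)
    qed
    finally have "ennreal (cmod (?v q)) \<le> (\<integral>\<^sup>+p. k q p * ennreal (cmod (u p)) \<partial>cylinder)"
      using True by simp
    then have "(ennreal (cmod (?v q)))\<^sup>2 \<le> (\<integral>\<^sup>+p. k q p * ennreal (cmod (u p)) \<partial>cylinder)\<^sup>2"
      by (rule power_mono_ennreal)
    then show ?thesis by (simp add: ennreal_power)
  qed simp
  have "(\<integral>\<^sup>+q. ennreal ((cmod (?v q))\<^sup>2) \<partial>cylinder) \<le> (\<integral>\<^sup>+q. (\<integral>\<^sup>+p. k q p * ennreal (cmod (u p)) \<partial>cylinder)\<^sup>2 \<partial>cylinder)"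
    by (rule nn_integral_mono[OF bound])
  with fin have "(\<integral>\<^sup>+q. ennreal ((cmod (?v q))\<^sup>2) \<partial>cylinder) < \<infinity>" by (rule le_less_trans[rotated])
  moreover have "?v \<in> borel_measurable cylinder"
    unfolding cauchy_transform_def cauchy_kernel_def by measurable
  ultimately show ?thesis by (simp add: L2_iff_nn_integral)
qed

text \<open>Justifies Fubini at each fixed \<open>t\<close>, the final time included. Integrating in
  \<open>z\<close> first absorbs the chord weight uniformly; what remains is
  \<open>cmod (u p)\<close> against the time weight, finite by Cauchy-Schwarz because
  \<open>1/4 < 1/2\<close>.\<close>

lemma integrable_cauchy_kernel:
  assumes T: "0 \<le> T" and u: "u \<in> L2 cylinder" and supp: "\<forall>p. fst p \<notin> {0..T} \<longrightarrow> u p = 0"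
    and t: "t \<in> {0..T}"
  shows "integrable (circle \<Otimes>\<^sub>M cylinder) (\<lambda>(z, p). u p * cauchy_kernel (of_real (exp (- t)) * z) p)"
proof -
  note [measurable] = L2_measurable[OF u]
  define E where "E = ennreal (2 * exp T)"
  let ?w = "\<lambda>p. time_weight (fst p - t) * indicator {0..T} (fst p)"
  obtain P where P: "P < \<infinity>" "\<And>t. t \<in> {0..T} \<Longrightarrow> (\<integral>\<^sup>+s\<in>{0..T}. (time_weight (s - t))\<^sup>2 \<partial>lborel) \<le> P"
    using time_weight_integral_bounded[OF T] by metis
  obtain Q where Q: "Q < \<infinity>" "\<And>z. cmod z = 1 \<Longrightarrow> (\<integral>\<^sup>+w. chord_weight w z \<partial>circle) \<le> Q"
    using chord_weight_integral_bounded by metis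
  have "(\<integral>\<^sup>+p. (?w p)\<^sup>2 \<partial>cylinder) = (\<integral>\<^sup>+s. (\<integral>\<^sup>+w. (time_weight (s - t))\<^sup>2 * indicator {0..T} s \<partial>circle) \<partial>lborel)"
    by (subst circle.nn_integral_fst[symmetric]) (auto intro!: nn_integral_cong simp: indicator_def)
  also have "\<dots> = (\<integral>\<^sup>+s\<in>{0..T}. (time_weight (s - t))\<^sup>2 \<partial>lborel) * ennreal (2 * pi)"
    using emeasure_circle by (simp add: nn_integral_multc)
  also have "\<dots> < \<infinity>" using P(2)[OF t] P(1) by (auto simp: ennreal_mult_less_top intro: le_less_trans)
  finally have w2: "(\<integral>\<^sup>+p. (?w p)\<^sup>2 \<partial>cylinder) < \<infinity>" .
  have u2: "(\<integral>\<^sup>+p. (ennreal (cmod (u p)))\<^sup>2 \<partial>cylinder) < \<infinity>"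
    using u by (simp add: L2_iff_nn_integral ennreal_power)
  have "(\<integral>\<^sup>+p. ennreal (cmod (u p)) * ?w p \<partial>cylinder)\<^sup>2
      \<le> (\<integral>\<^sup>+p. (ennreal (cmod (u p)))\<^sup>2 \<partial>cylinder) * (\<integral>\<^sup>+p. (?w p)\<^sup>2 \<partial>cylinder)"
    by (rule Cauchy_Schwarz_nn_integral) measurable
  also have "\<dots> < \<infinity>" using u2 w2 by (simp add: ennreal_mult_less_top)
  finally have uw: "(\<integral>\<^sup>+p. ennreal (cmod (u p)) * ?w p \<partial>cylinder) < \<infinity>"
    by (simp add: power_less_top_ennreal)
  have "(\<integral>\<^sup>+x. ennreal (cmod (case x of (z, p) \<Rightarrow> u p * cauchy_kernel (of_real (exp (- t)) * z) p)) \<partial>(circle \<Otimes>\<^sub>M cylinder))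
     \<le> (\<integral>\<^sup>+x. E * (ennreal (cmod (u (snd x))) * ?w (snd x)) * chord_weight (fst x) (snd (snd x)) \<partial>(circle \<Otimes>\<^sub>M cylinder))"
  proof (rule nn_integral_mono, clarsimp simp: space_pair_measure)
    fix z w :: complex and s :: real assume zw: "cmod z = 1" "cmod w = 1"
    show "ennreal (cmod (u (s, w) * cauchy_kernel (of_real (exp (- t)) * z) (s, w)))
      \<le> E * (ennreal (cmod (u (s, w))) * (time_weight (s - t) * indicator {0..T} s)) * chord_weight z w"
    proof (cases "s \<in> {0..T}")
      case True
      have "ennreal (cmod (u (s, w) * cauchy_kernel (of_real (exp (- t)) * z) (s, w)))
        = ennreal (cmod (u (s, w))) * ennreal (cmod (cauchy_kernel (of_real (exp (- t)) * z) (s, w)))"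
        by (simp add: norm_mult ennreal_mult)
      also have "\<dots> \<le> ennreal (cmod (u (s, w))) * (E * (time_weight (s - t) * chord_weight z w))"
        unfolding E_def using cauchy_kernel_bound[of "(s, w)" T t z] True t zw
        by (intro mult_left_mono) (auto simp: space_pair_measure)
      also have "\<dots> = E * (ennreal (cmod (u (s, w))) * (time_weight (s - t) * indicator {0..T} s)) * chord_weight z w"
        using True by (simp add: ac_simps)
      finally show ?thesis .
    qed (simp add: supp)
  qed
  also have "\<dots> = (\<integral>\<^sup>+p. (\<integral>\<^sup>+z. E * (ennreal (cmod (u p)) * ?w p) * chord_weight z (snd p) \<partial>circle) \<partial>cylinder)"
    by (subst circ_cyl.nn_integral_snd[symmetric]) simp_all
  also have "\<dots> = (\<integral>\<^sup>+p. E * (ennreal (cmod (u p)) * ?w p) * (\<integral>\<^sup>+z. chord_weight z (snd p) \<partial>circle) \<partial>cylinder)"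
    by (intro nn_integral_cong nn_integral_cmult) measurable
  also have "\<dots> \<le> (\<integral>\<^sup>+p. E * (ennreal (cmod (u p)) * ?w p) * Q \<partial>cylinder)"
    by (intro nn_integral_mono mult_left_mono Q(2)) (auto simp: space_pair_measure)
  also have "\<dots> = E * (\<integral>\<^sup>+p. ennreal (cmod (u p)) * ?w p \<partial>cylinder) * Q"
    by (simp add: nn_integral_multc nn_integral_cmult)
  also have "\<dots> < \<infinity>" using uw Q(1) by (auto simp: E_def ennreal_mult_less_top)
  finally show ?thesis
    unfolding integrable_iff_bounded cauchy_kernel_def by (simp add: split_beta')
qed


section \<open>Null controllability as a moment problem\<close>

lemma H2_facts:
  assumes "f \<in> H2"
  shows "f \<in> L2 circle" and "integrable circle f" and "\<And>n. n < 0 \<Longrightarrow> fourier_coeff f n = 0"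
proof -
  from assms obtain g where f: "f \<in> L2 circle" and g: "g \<in> L2 circle" "AE z in circle. f z = riesz_projector g z"
    unfolding H2_def by blast
  show "f \<in> L2 circle" by fact
  show "integrable circle f" by (rule L2_circle_integrable[OF f])
  have "fourier_coeff f n = fourier_coeff (riesz_projector g) n" for n
    by (rule fourier_coeff_cong_AE[OF L2_measurable[OF f] L2_measurable[OF riesz_projector_L2[OF g(1)]] g(2)])
  then show "fourier_coeff f n = 0" if "n < 0" for n
    using that by (simp add: fourier_coeff_riesz[OF g(1)])
qed

lemma power_ext_riesz: "power_ext (riesz_projector g) \<zeta> = power_ext g \<zeta>" if "g \<in> L2 circle"
  by (simp add: power_ext_def fourier_coeff_riesz[OF that])

lemma AE_time_neq: "AE p in cylinder. fst p \<noteq> t"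
proof (rule nu.AE_pair_measure)
  show "AE s in lborel. AE w in circle. fst (s, w) \<noteq> t"
    using AE_lborel_singleton[of t] by eventually_elim simp
qed measurable

lemma L2_cylinder_integrable:
  assumes u: "u \<in> L2 cylinder" and supp: "\<forall>p. fst p \<notin> {0..T} \<longrightarrow> u p = 0"
  shows "integrable cylinder u"
proof (rule Bochner_Integration.integrable_bound)
  have "emeasure cylinder ({0..T} \<times> space circle) < \<infinity>"
    by (subst circle.emeasure_pair_measure_Times)
       (simp_all del: space_circle add: emeasure_circle ennreal_mult_less_top emeasure_lborel_Icc_eq)
  then have "integrable cylinder (\<lambda>p. indicator ({0..T} \<times> space circle) p :: real)"
    by (intro integrable_real_indicator pair_measureI sets.top) auto
  then show "integrable cylinder (\<lambda>p. indicator ({0..T} \<times> space circle) p + (cmod (u p))\<^sup>2)"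
    using L2_integrable[OF u] by simp
  show "AE p in cylinder. norm (u p) \<le> norm (indicator ({0..T} \<times> space circle) p + (cmod (u p))\<^sup>2 :: real)"
  proof (rule AE_I2)
    fix p assume "p \<in> space cylinder"
    show "norm (u p) \<le> norm (indicator ({0..T} \<times> space circle) p + (cmod (u p))\<^sup>2 :: real)"
    proof (cases "fst p \<in> {0..T}")
      case True
      then have "p \<in> {0..T} \<times> space circle" using \<open>p \<in> space cylinder\<close> by (auto simp: space_pair_measure)
      moreover have "cmod (u p) \<le> 1 + (cmod (u p))\<^sup>2"
        using zero_le_power2[of "2 * cmod (u p) - 1"] by (simp add: power2_eq_square algebra_simps)
      ultimately show ?thesis by simp
    qed (simp add: supp)
  qed
qed (rule L2_measurable[OF u])

text \<open>Duhamel's integral with the factor \<open>exp (- n T)\<close> removed: mode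
  \<open>n\<close> of the controlled state at time \<open>T\<close> is \<open>exp (- n T)\<close>
  times the sum of \<open>fourier_coeff f n\<close> and \<open>moment u n / (2 pi)\<close>. The
  integral runs over the whole cylinder, so the final time is visible only in the support of
  \<open>u\<close>.\<close>

definition moment :: "(real \<times> complex \<Rightarrow> complex) \<Rightarrow> nat \<Rightarrow> complex" where
  "moment u n = (LINT p|cylinder. u p * (of_real (exp (fst p)) * cnj (snd p)) ^ n)"

lemma power_ext_fourier:
  assumes f: "integrable circle f" and \<rho>: "cmod \<rho> < 1"
  shows "integrable circle (\<lambda>z. power_ext f (\<rho> * z) * cnj z ^ n)"
    and "(LINT z|circle. power_ext f (\<rho> * z) * cnj z ^ n) = complex_of_real (2 * pi) * fourier_coeff f (int n) * \<rho> ^ n"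
proof -
  let ?c = "\<lambda>k. fourier_coeff f (int k) * \<rho> ^ k"
  let ?g = "\<lambda>k z. ?c k * (z ^ k * cnj z ^ n)"
  have sm: "summable (\<lambda>k. cmod (?c k))" by (rule power_ext_summable[OF f \<rho>])
  have i: "integrable circle (\<lambda>z. z ^ k * cnj z ^ n)" for k
    by (rule integrable_circle_bounded[of _ 1]) (auto simp: norm_mult norm_power)
  have nrm: "cmod (?g k z) = cmod (?c k)" if "cmod z = 1" for k z
    using that by (simp add: norm_mult norm_power)
  have *: "integrable circle (?g k)" "AE z in circle. summable (\<lambda>k. norm (?g k z))" for k
    using i sm by (auto simp: nrm simp del: norm_mult intro!: AE_I2)
  have **: "summable (\<lambda>k. LINT z|circle. norm (?g k z))"
  proof -
    have "(LINT z|circle. norm (?g k z)) = 2 * pi * cmod (?c k)" for k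
    proof -
      have "(LINT z|circle. norm (?g k z)) = (LINT z|circle. cmod (?c k))"
        by (rule Bochner_Integration.integral_cong[OF refl]) (simp add: nrm del: norm_mult)
      then show ?thesis using emeasure_circle by (simp add: measure_def)
    qed
    then show ?thesis using sm by (simp only: summable_mult)
  qed
  have eq: "(\<Sum>k. ?g k z) = power_ext f (\<rho> * z) * cnj z ^ n" if "cmod z = 1" for z
  proof -
    have "summable (\<lambda>k. fourier_coeff f (int k) * (\<rho> * z) ^ k)"
      by (rule summable_norm_cancel, rule power_ext_summable[OF f]) (use \<rho> that in \<open>simp add: norm_mult\<close>)
    from suminf_mult2[OF this, of "cnj z ^ n"] show ?thesis
      unfolding power_ext_def by (simp add: power_mult_distrib mult_ac)
  qed
  have "integrable circle (\<lambda>z. \<Sum>k. ?g k z)"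
    by (rule integrable_suminf) (use * ** in auto)
  then show "integrable circle (\<lambda>z. power_ext f (\<rho> * z) * cnj z ^ n)"
    by (rule Bochner_Integration.integrable_cong[THEN iffD1, rotated -1]) (auto simp: eq)
  have "(\<lambda>k. LINT z|circle. ?g k z) sums (LINT z|circle. (\<Sum>k. ?g k z))"
    by (rule sums_integral) (use * ** in auto)
  also have "(LINT z|circle. (\<Sum>k. ?g k z)) = (LINT z|circle. power_ext f (\<rho> * z) * cnj z ^ n)"
    by (rule Bochner_Integration.integral_cong[OF refl]) (auto simp: eq)
  finally have s1: "(\<lambda>k. LINT z|circle. ?g k z) sums (LINT z|circle. power_ext f (\<rho> * z) * cnj z ^ n)" .
  have "(LINT z|circle. ?g k z) = (if k = n then complex_of_real (2 * pi) * ?c n else 0)" for k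
  proof -
    have "(LINT z|circle. z ^ k * cnj z ^ n) = (LINT z|circle. z powi (int k - int n))"
      by (rule Bochner_Integration.integral_cong[OF refl]) (simp add: cnj_power_circle)
    then show ?thesis by (simp add: integral_powi_circle)
  qed
  then have "(\<lambda>k. LINT z|circle. ?g k z) sums (complex_of_real (2 * pi) * ?c n)"
    using sums_single[of n "\<lambda>k. complex_of_real (2 * pi) * ?c k"] by (simp cong: if_cong)
  from sums_unique2[OF s1 this] show "(LINT z|circle. power_ext f (\<rho> * z) * cnj z ^ n) = complex_of_real (2 * pi) * fourier_coeff f (int n) * \<rho> ^ n"
    by simp
qed

context
  fixes u :: "real \<times> complex \<Rightarrow> complex" and T :: real
  assumes T: "0 \<le> T" and u: "u \<in> L2 cylinder" and supp: "\<forall>p. fst p \<notin> {0..T} \<longrightarrow> u p = 0"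
begin

lemma cauchy_transform_AE_integrable:
  assumes "t \<in> {0..T}"
  shows "AE z in circle. integrable cylinder (\<lambda>p. u p * cauchy_kernel (of_real (exp (- t)) * z) p)"
  using circ_cyl.AE_integrable_fst'[OF integrable_cauchy_kernel[OF T u supp assms]] by simp

text \<open>Fubini reduces the claim to \<open>integral_cauchy_kernel\<close> with
  \<open>a = exp (s - t) * cnj w\<close>: the times \<open>s < t\<close> survive,
  \<open>s > t\<close> contributes zero, and \<open>s = t\<close> is a null set. The nonnegative
  modes on the circle of radius \<open>exp (- t)\<close> are thus the forward Duhamel integral up to
  time \<open>t\<close>.\<close>

lemma cauchy_transform_fourier:
  assumes t: "t \<in> {0..T}"
  shows "integrable circle (\<lambda>z. cauchy_transform u (of_real (exp (- t)) * z) * cnj z ^ n)"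
    and "(LINT z|circle. cauchy_transform u (of_real (exp (- t)) * z) * cnj z ^ n) =
      complex_of_real (2 * pi) * (LINT p|cylinder. indicator {..<t} (fst p) *\<^sub>R (u p * (of_real (exp (fst p - t)) * cnj (snd p)) ^ n))"
proof -
  note [measurable] = L2_measurable[OF u]
  let ?F = "\<lambda>z p. u p * cauchy_kernel (of_real (exp (- t)) * z) p * cnj z ^ n"
  have int: "integrable (circle \<Otimes>\<^sub>M cylinder) (\<lambda>(z, p). ?F z p)"
  proof (rule Bochner_Integration.integrable_bound[OF integrable_cauchy_kernel[OF T u supp t]])
    show "(\<lambda>(z, p). ?F z p) \<in> borel_measurable (circle \<Otimes>\<^sub>M cylinder)"
      unfolding cauchy_kernel_def by measurable
  qed (auto simp: space_pair_measure norm_mult norm_power intro!: AE_I2)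
  show "integrable circle (\<lambda>z. cauchy_transform u (of_real (exp (- t)) * z) * cnj z ^ n)"
    using circ_cyl.integrable_fst'[OF int] by (simp add: cauchy_transform_def)
  have "(LINT z|circle. cauchy_transform u (of_real (exp (- t)) * z) * cnj z ^ n) = (LINT z|circle. (LINT p|cylinder. ?F z p))"
    by (simp add: cauchy_transform_def)
  also have "\<dots> = (LINT p|cylinder. (LINT z|circle. ?F z p))"
    by (rule circ_cyl.Fubini_integral[symmetric, OF int])
  also have "\<dots> = (LINT p|cylinder. complex_of_real (2 * pi) * (indicator {..<t} (fst p) *\<^sub>R (u p * (of_real (exp (fst p - t)) * cnj (snd p)) ^ n)))"
  proof (rule integral_cong_AE)
    show "AE p in cylinder. (LINT z|circle. ?F z p) = complex_of_real (2 * pi) * (indicator {..<t} (fst p) *\<^sub>R (u p * (of_real (exp (fst p - t)) * cnj (snd p)) ^ n))"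
      using AE_time_neq[of t] AE_space
    proof eventually_elim
      case (elim p)
      define a where "a = of_real (exp (fst p - t)) * cnj (snd p)"
      have a: "cmod a = exp (fst p - t)" using elim(2) by (auto simp: a_def norm_mult space_pair_measure)
      have "(LINT z|circle. ?F z p) = (LINT z|circle. u p * (cnj z ^ n / (1 - a * z)))"
        by (simp add: cauchy_kernel_def a_def exp_diff exp_minus field_simps)
      also have "\<dots> = u p * (if cmod a < 1 then complex_of_real (2 * pi) * a ^ n else 0)"
        by (subst integral_mult_right_zero, subst integral_cauchy_kernel) (use elim(1) a in auto)
      finally show ?case using elim(1) by (simp add: a a_def[symmetric])
    qed
  qed (use circ_cyl.integrable_snd[OF int] in auto)
  finally show "(LINT z|circle. cauchy_transform u (of_real (exp (- t)) * z) * cnj z ^ n) =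
      complex_of_real (2 * pi) * (LINT p|cylinder. indicator {..<t} (fst p) *\<^sub>R (u p * (of_real (exp (fst p - t)) * cnj (snd p)) ^ n))"
    unfolding integral_mult_right_zero .
qed

lemma integrable_moment:
  "integrable cylinder (\<lambda>p. u p * (of_real (exp (fst p)) * cnj (snd p)) ^ n)"
proof (rule Bochner_Integration.integrable_bound)
  note [measurable] = L2_measurable[OF u]
  show "integrable cylinder (\<lambda>p. of_real (exp T ^ n) * u p)"
    using L2_cylinder_integrable[OF u supp] by simp
  show "AE p in cylinder. norm (u p * (of_real (exp (fst p)) * cnj (snd p)) ^ n) \<le> norm (of_real (exp T ^ n) * u p)"
  proof (rule AE_I2)
    fix p assume p: "p \<in> space cylinder"
    show "norm (u p * (of_real (exp (fst p)) * cnj (snd p)) ^ n) \<le> norm (of_real (exp T ^ n) * u p)"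
    proof (cases "fst p \<in> {0..T}")
      case True
      then have "exp (fst p) ^ n \<le> exp T ^ n" by (intro power_mono) auto
      then show ?thesis using p
        by (auto simp: space_pair_measure norm_mult norm_power mult.commute intro!: mult_right_mono)
    qed (simp add: supp)
  qed
  show "(\<lambda>p. u p * (of_real (exp (fst p)) * cnj (snd p)) ^ n) \<in> borel_measurable cylinder" by measurable
qed

text \<open>Below radius \<open>exp (- T)\<close> the product of \<open>\<zeta>\<close> with
  \<open>exp s * cnj w\<close> stays in a disc of radius \<open>q < 1\<close> for all
  \<open>s\<close> in \<open>{0..T}\<close>, so the kernel is a geometric series and the moments are
  Taylor coefficients.\<close>

lemma cauchy_transform_sums:
  assumes \<zeta>: "cmod \<zeta> < exp (- T)"
  shows "(\<lambda>n. \<zeta> ^ n * moment u n) sums cauchy_transform u \<zeta>"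
proof -
  note [measurable] = L2_measurable[OF u]
  let ?x = "\<lambda>p. of_real (exp (fst p)) * cnj (snd p)"
  let ?g = "\<lambda>n p. \<zeta> ^ n * (u p * ?x p ^ n)"
  define q where "q = cmod \<zeta> * exp T"
  have q: "0 \<le> q" "q < 1" using \<zeta> by (auto simp: q_def exp_minus field_simps)
  have xq: "cmod (\<zeta> * ?x p) \<le> q" if "fst p \<in> {0..T}" "p \<in> space cylinder" for p
    using that by (auto simp: q_def norm_mult space_pair_measure intro!: mult_left_mono)
  have nrm: "cmod (?g n p) \<le> q ^ n * cmod (u p)" if "p \<in> space cylinder" for n p
  proof (cases "fst p \<in> {0..T}")
    case True
    have "cmod (?g n p) = cmod (\<zeta> * ?x p) ^ n * cmod (u p)"
      by (simp add: norm_mult norm_power power_mult_distrib)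
    also have "\<dots> \<le> q ^ n * cmod (u p)"
      by (intro mult_right_mono power_mono xq True that) auto
    finally show ?thesis .
  qed (simp add: supp)
  have i: "integrable cylinder (?g n)" for n using integrable_moment by simp
  have "(\<lambda>n. LINT p|cylinder. ?g n p) sums (LINT p|cylinder. (\<Sum>n. ?g n p))"
  proof (rule sums_integral[OF i])
    show "AE p in cylinder. summable (\<lambda>n. norm (?g n p))"
    proof (rule AE_I2)
      fix p assume p: "p \<in> space cylinder"
      show "summable (\<lambda>n. norm (?g n p))"
        by (rule summable_comparison_test'[of "\<lambda>n. q ^ n * cmod (u p)"])
           (use q nrm[OF p] in \<open>auto intro!: summable_mult2 summable_geometric\<close>)
    qed
    show "summable (\<lambda>n. LINT p|cylinder. norm (?g n p))"
    proof (rule summable_comparison_test')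
      show "summable (\<lambda>n. q ^ n * (LINT p|cylinder. cmod (u p)))"
        using q by (auto intro!: summable_mult2 summable_geometric)
      fix n
      have "(LINT p|cylinder. norm (?g n p)) \<le> (LINT p|cylinder. q ^ n * cmod (u p))"
        by (rule integral_mono) (use i nrm L2_cylinder_integrable[OF u supp] in auto)
      then show "norm (LINT p|cylinder. norm (?g n p)) \<le> q ^ n * (LINT p|cylinder. cmod (u p))" by simp
    qed
  qed
  also have "(LINT p|cylinder. (\<Sum>n. ?g n p)) = cauchy_transform u \<zeta>"
    unfolding cauchy_transform_def
  proof (rule Bochner_Integration.integral_cong[OF refl])
    fix p assume p: "p \<in> space cylinder"
    show "(\<Sum>n. ?g n p) = u p * cauchy_kernel \<zeta> p"
    proof (cases "fst p \<in> {0..T}")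
      case True
      then have "cmod (\<zeta> * ?x p) < 1" using xq[OF True p] q by simp
      from sums_mult[OF geometric_sums[OF this], of "u p"]
      have "(\<lambda>n. ?g n p) sums (u p * cauchy_kernel \<zeta> p)"
        by (simp add: cauchy_kernel_def power_mult_distrib mult_ac)
      then show ?thesis by (rule sums_unique[symmetric])
    qed (simp add: supp)
  qed
  also have "(\<lambda>n. LINT p|cylinder. ?g n p) = (\<lambda>n. \<zeta> ^ n * moment u n)"
    using integrable_moment by (simp add: moment_def)
  finally show ?thesis .
qed

lemma cauchy_transform_eq_power_ext:
  assumes f: "integrable circle f"
    and m: "\<And>n. moment u n = - (complex_of_real (2 * pi) * fourier_coeff f (int n))"
    and \<zeta>: "cmod \<zeta> < exp (- T)"
  shows "cauchy_transform u \<zeta> = - (complex_of_real (2 * pi) * power_ext f \<zeta>)"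
proof -
  have "cmod \<zeta> < 1" using \<zeta> T by (meson exp_le_one_iff less_le_trans neg_le_0_iff_le)
  then have "summable (\<lambda>n. fourier_coeff f (int n) * \<zeta> ^ n)"
    by (intro summable_norm_cancel[OF power_ext_summable[OF f]])
  from sums_mult[OF summable_sums[OF this], of "- complex_of_real (2 * pi)"]
  have "(\<lambda>n. \<zeta> ^ n * moment u n) sums (- (complex_of_real (2 * pi) * power_ext f \<zeta>))"
    by (simp add: m power_ext_def mult_ac)
  then show ?thesis using cauchy_transform_sums[OF \<zeta>] sums_unique2 by blast
qed

text \<open>The final state lives on the circle of radius \<open>exp (- T)\<close>, the border of
  the disc in which the Taylor expansion is available. For \<open>cmod x < 1\<close> and
  \<open>0 <= r <= 1\<close> one has \<open>cmod (1 - x) <= 2 * cmod (1 - r * x)\<close>, so twice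
  the limit kernel dominates.\<close>

lemma cauchy_transform_radial_limit:
  assumes z: "cmod z = 1" and int: "integrable cylinder (\<lambda>p. u p * cauchy_kernel (of_real (exp (- T)) * z) p)"
  shows "(\<lambda>k. cauchy_transform u (of_real (1 - inverse (real (Suc k))) * (of_real (exp (- T)) * z)))
    \<longlonglongrightarrow> cauchy_transform u (of_real (exp (- T)) * z)"
  unfolding cauchy_transform_def
proof (rule integral_dominated_convergence)
  note [measurable] = L2_measurable[OF u]
  let ?r = "\<lambda>k. 1 - inverse (real (Suc k))" and ?\<zeta> = "of_real (exp (- T)) * z"
  show "(\<lambda>p. u p * cauchy_kernel ?\<zeta> p) \<in> borel_measurable cylinder"
    "(\<lambda>p. u p * cauchy_kernel (of_real (?r k) * ?\<zeta>) p) \<in> borel_measurable cylinder" for k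
    unfolding cauchy_kernel_def by measurable
  show "integrable cylinder (\<lambda>p. 2 * cmod (u p * cauchy_kernel ?\<zeta> p))"
    using int by simp
  have r: "0 \<le> ?r k" "?r k \<le> 1" for k by (auto simp: field_simps)
  have lim: "?r \<longlonglongrightarrow> 1 - 0" by (intro tendsto_intros LIMSEQ_inverse_real_of_nat)
  have facts: "cmod (?\<zeta> * of_real (exp (fst p)) * cnj (snd p)) < 1"
    if "fst p \<in> {0..T}" "fst p \<noteq> T" "p \<in> space cylinder" for p
    using that z by (auto simp: space_pair_measure norm_mult simp flip: exp_add)
  show "AE p in cylinder. (\<lambda>k. u p * cauchy_kernel (of_real (?r k) * ?\<zeta>) p) \<longlonglongrightarrow> u p * cauchy_kernel ?\<zeta> p"
    using AE_time_neq[of T] AE_space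
  proof eventually_elim
    case (elim p)
    show ?case
    proof (cases "fst p \<in> {0..T}")
      case True
      from facts[OF this elim] have "1 - ?\<zeta> * of_real (exp (fst p)) * cnj (snd p) \<noteq> 0" by auto
      then have "(\<lambda>k. u p * cauchy_kernel (of_real (?r k) * ?\<zeta>) p) \<longlonglongrightarrow> u p * (1 / (1 - of_real (1 - 0) * ?\<zeta> * of_real (exp (fst p)) * cnj (snd p)))"
        unfolding cauchy_kernel_def by (intro tendsto_intros lim) simp_all
      then show ?thesis by (simp add: cauchy_kernel_def)
    qed (simp add: supp)
  qed
  fix k
  show "AE p in cylinder. norm (u p * cauchy_kernel (of_real (?r k) * ?\<zeta>) p) \<le> 2 * cmod (u p * cauchy_kernel ?\<zeta> p)"
    using AE_time_neq[of T] AE_space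
  proof eventually_elim
    case (elim p)
    show ?case
    proof (cases "fst p \<in> {0..T}")
      case True
      define x where "x = ?\<zeta> * of_real (exp (fst p)) * cnj (snd p)"
      have x: "cmod x < 1" unfolding x_def by (rule facts[OF True elim])
      have "cmod (of_real (1 - ?r k) * x) \<le> 1 - ?r k"
        using x r[of k] by (simp only: norm_mult norm_of_real) (auto intro!: mult_left_le)
      moreover have "1 - ?r k \<le> cmod (1 - of_real (?r k) * x)"
      proof -
        have "1 - ?r k \<le> 1 - ?r k * cmod x" using x r[of k] by (intro diff_left_mono mult_left_le) auto
        also have "\<dots> \<le> cmod (1 - of_real (?r k) * x)"
          using norm_triangle_ineq2[of 1 "of_real (?r k) * x"] r[of k] by (simp only: norm_mult norm_of_real norm_one abs_of_nonneg)
        finally show ?thesis .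
      qed
      moreover have "cmod (1 - x) \<le> cmod (1 - of_real (?r k) * x) + cmod (of_real (1 - ?r k) * x)"
        using norm_triangle_ineq4[of "1 - of_real (?r k) * x" "of_real (1 - ?r k) * x"] by (simp add: algebra_simps)
      ultimately have le: "cmod (1 - x) \<le> 2 * cmod (1 - of_real (?r k) * x)" by linarith
      have pos: "0 < cmod (1 - x)" using x by auto
      have "1 / cmod (1 - of_real (?r k) * x) \<le> 2 / cmod (1 - x)"
        using le pos by (simp add: divide_simps)
      then have "cmod (u p) * (1 / cmod (1 - of_real (?r k) * x)) \<le> cmod (u p) * (2 / cmod (1 - x))"
        by (rule mult_left_mono) simp
      then show ?thesis
        by (simp add: cauchy_kernel_def norm_mult norm_divide x_def mult.assoc mult.commute[of _ 2])
    qed (simp add: supp)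
  qed
qed

end

text \<open>The integrand of \<open>input_to_output\<close> contains a choice made separately for
  each \<open>s\<close>, and on the null set of bad slices nothing is known of it. Completeness of
  \<open>lebesgue\<close> is what makes it measurable.\<close>

lemma borel_measurable_lebesgue_cong_AE:
  fixes f g :: "real \<Rightarrow> complex"
  assumes g: "g \<in> borel_measurable lborel" and eq: "AE x in lborel. f x = g x"
  shows "f \<in> borel_measurable lebesgue"
proof (rule measurableI)
  fix B :: "complex set" assume B: "B \<in> sets borel"
  show "f -` B \<inter> space lebesgue \<in> sets lebesgue"
  proof (rule completion.in_sets_AE)
    show "AE x in lebesgue. x \<in> g -` B \<inter> space lebesgue \<longleftrightarrow> x \<in> f -` B \<inter> space lebesgue"
      using AE_completion[OF eq] by eventually_elim auto
    show "g -` B \<inter> space lebesgue \<in> sets lebesgue"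
      by (rule measurable_sets[OF measurable_completion[OF g] B])
  qed simp
qed simp

text \<open>For almost every \<open>s\<close> the slice is in \<open>L2\<close>, and there
  projector, semigroup and Cauchy's formula combine to the kernel at \<open>exp (- T) * z\<close>.
  Integrability of the kernel for almost every \<open>z\<close> turns the iterated integral into one
  over the cylinder.\<close>

lemma input_to_output_eq:
  assumes \<omega>: "\<omega> \<in> sets circle" and T: "0 < T" and u: "u \<in> L2 (control_space T \<omega>)"
  defines "v \<equiv> \<lambda>p. indicator ({0..T} \<times> \<omega>) p *\<^sub>R u p"
  shows "AE z in circle. input_to_output \<omega> T u z = cauchy_transform v (of_real (exp (- T)) * z) / complex_of_real (2 * pi)"
proof -
  have S: "{0..T} \<times> \<omega> \<in> sets cylinder" using \<omega> by auto
  have v: "v \<in> L2 cylinder" using u unfolding control_space_eq[OF \<omega>] v_def L2_restrict_space(1)[OF S] .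
  have supp: "\<forall>p. fst p \<notin> {0..T} \<longrightarrow> v p = 0" by (auto simp: v_def indicator_def)
  note [measurable] = L2_measurable[OF v]
  have "(\<integral>\<^sup>+s. (\<integral>\<^sup>+w. ennreal ((cmod (v (s, w)))\<^sup>2) \<partial>circle) \<partial>lborel) \<noteq> \<infinity>"
    using v by (subst circle.nn_integral_fst) (auto simp: L2_iff_nn_integral)
  then have "AE s in lborel. (\<integral>\<^sup>+w. ennreal ((cmod (v (s, w)))\<^sup>2) \<partial>circle) \<noteq> \<infinity>"
    by (intro nn_integral_PInf_AE) auto
  then have sliceL2: "AE s in lborel. (\<lambda>w. v (s, w)) \<in> L2 circle"
    by eventually_elim (auto simp: L2_iff_nn_integral top.not_eq_extremum)
  have "T \<in> {0..T}" "0 \<le> T" using T by auto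
  from cauchy_transform_AE_integrable[OF \<open>0 \<le> T\<close> v supp \<open>T \<in> {0..T}\<close>] AE_space
  show ?thesis
  proof eventually_elim
    case (elim z)
    then have z: "cmod z = 1" by simp
    let ?K = "\<lambda>p. v p * cauchy_kernel (of_real (exp (- T)) * z) p"
    let ?G = "\<lambda>s. indicator {0..T} s *\<^sub>R semigroup_S (T - s) (riesz_projector (extend_by_zero \<omega> (\<lambda>w. u (s, w)))) z"
    let ?g = "\<lambda>s. (LINT w|circle. ?K (s, w)) / complex_of_real (2 * pi)"
    have g: "?g \<in> borel_measurable lborel"
      unfolding cauchy_kernel_def by measurable
    have eq: "AE s in lborel. ?G s = ?g s"
      \<comment> \<open>The time \<open>s = T\<close> is discarded: \<open>semigroup_S 0\<close>
        returns the chosen representative itself and not a power series.\<close>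
      using sliceL2 AE_lborel_singleton[of T]
    proof eventually_elim
      case (elim s)
      show ?case
      proof (cases "s \<in> {0..T}")
        case True
        then have s: "0 < T - s" using elim(2) by auto
        have ext: "extend_by_zero \<omega> (\<lambda>w. u (s, w)) = (\<lambda>w. v (s, w))"
          using True by (auto simp: extend_by_zero_def v_def indicator_def fun_eq_iff)
        have "semigroup_S (T - s) (riesz_projector (\<lambda>w. v (s, w))) z = power_ext (\<lambda>w. v (s, w)) (of_real (exp (- (T - s))) * z)"
          using semigroup_S_eq_power_ext[OF L2_circle_integrable[OF riesz_projector_L2[OF elim(1)]] _ s z]
          by (simp add: fourier_coeff_riesz[OF elim(1)] power_ext_riesz[OF elim(1)])
        also have "\<dots> = (LINT w|circle. v (s, w) / (1 - of_real (exp (- (T - s))) * z * cnj w)) / complex_of_real (2 * pi)"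
          by (rule power_ext_cauchy[OF L2_circle_integrable[OF elim(1)]]) (use s z in \<open>simp add: norm_mult\<close>)
        also have "\<dots> = ?g s"
          by (simp add: cauchy_kernel_def exp_diff exp_minus field_simps)
        finally show ?thesis using True by (simp add: ext)
      next
        case False
        then show ?thesis by (simp add: supp)
      qed
    qed
    have "input_to_output \<omega> T u z = (LINT s|lebesgue. ?G s)"
      by (simp add: input_to_output_def set_lebesgue_integral_def)
    also have "\<dots> = (LINT s|lebesgue. ?g s)"
      by (rule integral_cong_AE[OF borel_measurable_lebesgue_cong_AE[OF g eq] measurable_completion[OF g] AE_completion[OF eq]])
    also have "\<dots> = (LINT s|lborel. ?g s)"
      by (rule integral_completion[OF g])
    also have "\<dots> = (LINT s|lborel. (LINT w|circle. ?K (s, w))) / complex_of_real (2 * pi)"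
      by simp
    also have "(LINT s|lborel. (LINT w|circle. ?K (s, w))) = cauchy_transform v (of_real (exp (- T)) * z)"
      unfolding cauchy_transform_def by (rule nu.integral_fst'[OF elim(1)])
    finally show ?case .
  qed
qed

text \<open>Forwards, mode \<open>n\<close> of the final state is a nonzero multiple of the defect
  in moment \<open>n\<close>. Backwards, the moments give the identity on radii below
  \<open>exp (- T)\<close>, and the radial limit carries it to the circle. One direction reads the
  moments off the given control, the other certifies new controls.\<close>

lemma null_control_iff_moments:
  assumes \<omega>: "\<omega> \<in> sets circle" and T: "0 < T" and u: "u \<in> L2 (control_space T \<omega>)" and f: "f \<in> H2"
  defines "v \<equiv> \<lambda>p. indicator ({0..T} \<times> \<omega>) p *\<^sub>R u p"
  shows "(AE z in circle. semigroup_S T f z + input_to_output \<omega> T u z = 0) \<longleftrightarrow>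
    (\<forall>n. moment v n = - (complex_of_real (2 * pi) * fourier_coeff f (int n)))" (is "?L \<longleftrightarrow> ?R")
proof -
  have S: "{0..T} \<times> \<omega> \<in> sets cylinder" using \<omega> by auto
  have v: "v \<in> L2 cylinder" using u unfolding control_space_eq[OF \<omega>] v_def L2_restrict_space(1)[OF S] .
  have supp: "\<forall>p. fst p \<notin> {0..T} \<longrightarrow> v p = 0" by (auto simp: v_def indicator_def)
  have T': "T \<in> {0..T}" "0 \<le> T" using T by auto
  note ctx = T'(2) v supp
  define e where "e = complex_of_real (exp (- T))"
  have e: "cmod e < 1" "e \<noteq> 0" using T by (auto simp: e_def)
  note fi = H2_facts(2)[OF f]
  have sg: "semigroup_S T f z = power_ext f (e * z)" if "cmod z = 1" for z
    unfolding e_def by (rule semigroup_S_eq_power_ext[OF fi H2_facts(3)[OF f] T that])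
  have io: "AE z in circle. input_to_output \<omega> T u z = cauchy_transform v (e * z) / complex_of_real (2 * pi)"
    unfolding e_def v_def by (rule input_to_output_eq[OF \<omega> T u])
  have "?L \<longleftrightarrow> (AE z in circle. power_ext f (e * z) + cauchy_transform v (e * z) / complex_of_real (2 * pi) = 0)" (is "_ \<longleftrightarrow> ?M")
  proof
    assume ?L
    with io AE_space show ?M by eventually_elim (simp add: sg)
  next
    assume ?M
    with io AE_space show ?L by eventually_elim (simp add: sg)
  qed
  also have "?M \<longleftrightarrow> ?R"
  proof
    assume M: ?M
    show ?R
    proof
      fix n
      note pf = power_ext_fourier[OF fi e(1), of n]
      note cf = cauchy_transform_fourier[OF ctx T'(1), of n, folded e_def]
      have m: "e ^ n * moment v n = (LINT p|cylinder. indicator {..<T} (fst p) *\<^sub>R (v p * (of_real (exp (fst p - T)) * cnj (snd p)) ^ n))"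
      proof -
        note [measurable] = L2_measurable[OF v]
        have "e ^ n * moment v n = (LINT p|cylinder. e ^ n * (v p * (of_real (exp (fst p)) * cnj (snd p)) ^ n))"
          using integrable_moment[OF ctx] by (simp add: moment_def)
        also have "\<dots> = (LINT p|cylinder. indicator {..<T} (fst p) *\<^sub>R (v p * (of_real (exp (fst p - T)) * cnj (snd p)) ^ n))"
        proof (rule integral_cong_AE)
          show "AE p in cylinder. e ^ n * (v p * (of_real (exp (fst p)) * cnj (snd p)) ^ n) = indicator {..<T} (fst p) *\<^sub>R (v p * (of_real (exp (fst p - T)) * cnj (snd p)) ^ n)"
            using AE_time_neq[of T]
          proof eventually_elim
            case (elim p)
            show ?case
            proof (cases "fst p < T")
              case True
              have "e * of_real (exp (fst p)) = complex_of_real (exp (fst p - T))"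
                by (simp add: e_def exp_diff exp_minus field_simps)
              then have "e ^ n * (of_real (exp (fst p)) * cnj (snd p)) ^ n = (of_real (exp (fst p - T)) * cnj (snd p)) ^ n"
                by (simp flip: power_mult_distrib mult.assoc)
              then show ?thesis using True by (simp add: mult.left_commute)
            next
              case False
              then show ?thesis using elim by (simp add: supp)
            qed
          qed
        qed measurable
        finally show ?thesis .
      qed
      have "(LINT z|circle. power_ext f (e * z) * cnj z ^ n + (1 / complex_of_real (2 * pi)) * (cauchy_transform v (e * z) * cnj z ^ n)) = (LINT z|circle. 0)"
      proof (rule integral_cong_AE)
        show "AE z in circle. power_ext f (e * z) * cnj z ^ n + (1 / complex_of_real (2 * pi)) * (cauchy_transform v (e * z) * cnj z ^ n) = 0"
          using M
        proof eventually_elim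
          case (elim z)
          have "power_ext f (e * z) * cnj z ^ n + (1 / complex_of_real (2 * pi)) * (cauchy_transform v (e * z) * cnj z ^ n)
            = (power_ext f (e * z) + cauchy_transform v (e * z) / complex_of_real (2 * pi)) * cnj z ^ n"
            by (simp add: algebra_simps)
          then show ?case using elim by simp
        qed
      qed (use pf(1) cf(1) in auto)
      also have "(LINT z|circle. power_ext f (e * z) * cnj z ^ n + (1 / complex_of_real (2 * pi)) * (cauchy_transform v (e * z) * cnj z ^ n))
        = complex_of_real (2 * pi) * fourier_coeff f (int n) * e ^ n + (1 / complex_of_real (2 * pi)) * (complex_of_real (2 * pi) * (e ^ n * moment v n))"
        using pf cf by (simp add: m)
      finally have "e ^ n * (complex_of_real (2 * pi) * fourier_coeff f (int n) + moment v n) = 0"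
        by (simp add: algebra_simps)
      then show "moment v n = - (complex_of_real (2 * pi) * fourier_coeff f (int n))"
        using e(2) by (simp add: eq_neg_iff_add_eq_0 add.commute)
    qed
  next
    assume R: ?R
    have inner: "cauchy_transform v \<zeta> = - (complex_of_real (2 * pi) * power_ext f \<zeta>)" if "cmod \<zeta> < exp (- T)" for \<zeta>
      using cauchy_transform_eq_power_ext[OF ctx fi _ that] R by blast
    show ?M
      using cauchy_transform_AE_integrable[OF ctx T'(1)] AE_space
    proof eventually_elim
      case (elim z)
      then have z: "cmod z = 1" by simp
      let ?r = "\<lambda>k. 1 - inverse (real (Suc k))"
      have r: "0 \<le> ?r k" "?r k < 1" for k by (auto simp: field_simps)
      have lim: "?r \<longlonglongrightarrow> 1 - 0" by (intro tendsto_intros LIMSEQ_inverse_real_of_nat)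
      have "(\<lambda>k. cauchy_transform v (of_real (?r k) * (e * z))) \<longlonglongrightarrow> cauchy_transform v (e * z)"
        using cauchy_transform_radial_limit[OF ctx z elim(1)] by (simp add: e_def)
      moreover have "cauchy_transform v (of_real (?r k) * (e * z)) = - (complex_of_real (2 * pi) * power_ext f (of_real (?r k) * (e * z)))" for k
        by (rule inner) (use r[of k] z in \<open>simp only: norm_mult norm_of_real abs_of_nonneg e_def\<close>, simp)
      moreover have "(\<lambda>k. power_ext f (of_real (?r k) * (e * z))) \<longlonglongrightarrow> power_ext f (e * z)"
      proof -
        have "isCont (power_ext f) (e * z)"
        proof -
          obtain x where x: "cmod e < x" "x < 1" using dense[OF e(1)] by blast
          from norm_ge_zero[of e] x(1) have "0 < x" by (rule le_less_trans)
          with x(2) have "cmod (of_real x :: complex) < 1" by simp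
          then have "summable (\<lambda>n. fourier_coeff f (int n) * (of_real x) ^ n)"
            by (intro summable_norm_cancel[OF power_ext_summable[OF fi]])
          then have "isCont (\<lambda>\<zeta>. \<Sum>n. fourier_coeff f (int n) * \<zeta> ^ n) (e * z)"
            by (rule isCont_powser) (use x \<open>0 < x\<close> z in \<open>simp add: norm_mult\<close>)
          then show ?thesis by (simp add: power_ext_def[abs_def])
        qed
        moreover have "(\<lambda>k. of_real (?r k) * (e * z)) \<longlonglongrightarrow> of_real (1 - 0) * (e * z)"
          by (intro tendsto_intros lim)
        ultimately show ?thesis by (intro isCont_tendsto_compose[of _ "power_ext f"]) simp_all
      qed
      ultimately have "cauchy_transform v (e * z) = - (complex_of_real (2 * pi) * power_ext f (e * z))"
        by (intro LIMSEQ_unique[OF _ tendsto_minus[OF tendsto_mult_left]]) (simp_all only:)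
      then show ?case by simp
    qed
  qed
  finally show ?thesis .
qed


section \<open>Unique continuation\<close>

text \<open>The closed arc is introduced because a compact set of singularities leaves an open
  domain of holomorphy; the price, at most two end points, is a null set.\<close>

lemma open_strict_interval_closure:
  assumes "open_strict_interval \<omega>"
  obtains A where "compact A" "A \<subseteq> sphere 0 1" "\<omega> \<subseteq> A" "finite (A - \<omega>)" "\<omega> \<in> sets circle"
proof -
  obtain a b where ab: "\<omega> = {cis x |x. a < x \<and> x < b}"
    using assms unfolding open_strict_interval_def by blast
  define A where "A = cis ` {a..b}"
  have A: "compact A" unfolding A_def by (intro compact_continuous_image continuous_intros compact_Icc)
  have sub: "A \<subseteq> sphere 0 1" by (auto simp: A_def)
  have \<omega>A: "\<omega> \<subseteq> A" by (auto simp: A_def ab)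
  have "A - \<omega> \<subseteq> {cis a, cis b}" by (force simp: A_def ab)
  then have fin: "finite (A - \<omega>)" by (rule finite_subset) simp
  have "\<omega> = A - (A - \<omega>)" using \<omega>A by blast
  also have "\<dots> \<in> sets borel"
    using A fin by (intro sets.Diff borel_closed compact_imp_closed finite_imp_closed)
  finally have "\<omega> \<in> sets circle" using \<omega>A sub
    by (auto simp: sets_circle sets_restrict_space image_iff intro!: bexI[of _ \<omega>])
  with A sub \<omega>A fin show ?thesis by (rule that)
qed

text \<open>Differentiation under the integral: with all denominators at least
  \<open>\<delta>\<close>, the difference quotient differs from the integral \<open>D\<close> of the
  differentiated kernel by at most a constant times
  \<open>cmod (\<zeta>' - \<zeta>)\<close>.\<close>

lemma cauchy_transform_has_field_derivative:
  assumes u: "integrable cylinder u" and supp: "\<forall>p. p \<notin> {0..T} \<times> A \<longrightarrow> u p = 0" and A: "A \<subseteq> sphere 0 1"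
    and \<epsilon>: "0 < \<epsilon>" and \<delta>: "0 < \<delta>"
    and away: "\<And>\<zeta>' s w. dist \<zeta>' \<zeta> < \<epsilon> \<Longrightarrow> s \<in> {0..T} \<Longrightarrow> w \<in> A \<Longrightarrow> \<delta> \<le> cmod (1 - \<zeta>' * (of_real (exp s) * cnj w))"
  shows "\<exists>D. (cauchy_transform u has_field_derivative D) (at \<zeta>)"
proof -
  note [measurable] = borel_measurable_integrable[OF u]
  define X where "X p = complex_of_real (exp (fst p)) * cnj (snd p)" for p :: "real \<times> complex"
  have ck: "cauchy_kernel \<zeta>' p = 1 / (1 - \<zeta>' * X p)" for \<zeta>' p
    by (simp add: cauchy_kernel_def X_def mult.assoc)
  have [measurable]: "X \<in> borel_measurable cylinder" unfolding X_def by measurable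
  define D where "D = (LINT p|cylinder. u p * (X p / (1 - \<zeta> * X p)\<^sup>2))"
  have X: "cmod (X p) \<le> exp T" if "p \<in> {0..T} \<times> A" for p
    using that A by (auto simp: X_def norm_mult)
  have aw: "\<delta> \<le> cmod (1 - \<zeta>' * X p)" if "p \<in> {0..T} \<times> A" "dist \<zeta>' \<zeta> < \<epsilon>" for p \<zeta>'
    using away[OF that(2)] that(1) by (auto simp: X_def)
  have bint: "integrable cylinder (\<lambda>p. u p * g p)"
    if [measurable]: "g \<in> borel_measurable cylinder" and B: "\<And>p. p \<in> {0..T} \<times> A \<Longrightarrow> cmod (g p) \<le> B" for g B
  proof (rule Bochner_Integration.integrable_bound)
    show "integrable cylinder (\<lambda>p. of_real B * u p)" using u by simp
    show "AE p in cylinder. norm (u p * g p) \<le> norm (of_real B * u p)"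
    proof (rule AE_I2)
      fix p show "norm (u p * g p) \<le> norm (of_real B * u p)"
      proof (cases "p \<in> {0..T} \<times> A")
        case True
        then have "cmod (g p) \<le> \<bar>B\<bar>" using B by force
        then show ?thesis by (simp add: norm_mult mult.commute mult_right_mono)
      next
        case False
        then have "u p = 0" using supp by blast
        then show ?thesis by simp
      qed
    qed
  qed measurable
  have i1: "integrable cylinder (\<lambda>p. u p * cauchy_kernel \<zeta>' p)" if "dist \<zeta>' \<zeta> < \<epsilon>" for \<zeta>'
    unfolding ck
  proof (rule bint[of _ "1 / \<delta>"])
    fix p assume "p \<in> {0..T} \<times> A"
    from aw[OF this that] show "cmod (1 / (1 - \<zeta>' * X p)) \<le> 1 / \<delta>"
      using \<delta> by (simp add: norm_divide frac_le)
  qed measurable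
  have i2: "integrable cylinder (\<lambda>p. u p * (X p / (1 - \<zeta> * X p)\<^sup>2))"
  proof (rule bint[of _ "exp T / \<delta>\<^sup>2"])
    fix p assume p: "p \<in> {0..T} \<times> A"
    have "\<delta>\<^sup>2 \<le> (cmod (1 - \<zeta> * X p))\<^sup>2" using aw[OF p, of \<zeta>] \<epsilon> \<delta> by (intro power_mono) auto
    then show "cmod (X p / (1 - \<zeta> * X p)\<^sup>2) \<le> exp T / \<delta>\<^sup>2"
      using X[OF p] \<delta> by (auto simp: norm_divide norm_power intro!: frac_le)
  qed measurable
  define C where "C = (exp T)\<^sup>2 / \<delta> ^ 3 * (LINT p|cylinder. cmod (u p))"
  have bound: "cmod ((cauchy_transform u \<zeta>' - cauchy_transform u \<zeta>) / (\<zeta>' - \<zeta>) - D) \<le> cmod (\<zeta>' - \<zeta>) * C"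
    if \<zeta>': "dist \<zeta>' \<zeta> < \<epsilon>" "\<zeta>' \<noteq> \<zeta>" for \<zeta>'
  proof -
    let ?E = "\<lambda>p. (u p * cauchy_kernel \<zeta>' p - u p * cauchy_kernel \<zeta> p) / (\<zeta>' - \<zeta>) - u p * (X p / (1 - \<zeta> * X p)\<^sup>2)"
    have iE: "integrable cylinder ?E" using i1[of \<zeta>'] i1[of \<zeta>] i2 \<zeta>' \<epsilon> by auto
    have "(cauchy_transform u \<zeta>' - cauchy_transform u \<zeta>) / (\<zeta>' - \<zeta>) - D = (LINT p|cylinder. ?E p)"
      using i1[of \<zeta>'] i1[of \<zeta>] i2 \<zeta>' \<epsilon> by (simp add: cauchy_transform_def D_def)
    also have "cmod \<dots> \<le> (LINT p|cylinder. cmod (\<zeta>' - \<zeta>) * ((exp T)\<^sup>2 / \<delta> ^ 3) * cmod (u p))"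
    proof (rule Bochner_Integration.integral_norm_bound_integral[OF iE])
      show "integrable cylinder (\<lambda>p. cmod (\<zeta>' - \<zeta>) * ((exp T)\<^sup>2 / \<delta> ^ 3) * cmod (u p))" using u by simp
      fix p
      show "norm (?E p) \<le> cmod (\<zeta>' - \<zeta>) * ((exp T)\<^sup>2 / \<delta> ^ 3) * cmod (u p)"
      proof (cases "p \<in> {0..T} \<times> A")
        case True
        define a b where "a = 1 - \<zeta> * X p" and "b = 1 - \<zeta>' * X p"
        have ab: "\<delta> \<le> cmod a" "\<delta> \<le> cmod b" unfolding a_def b_def using aw[OF True] \<zeta>' \<epsilon> by auto
        then have nz: "a \<noteq> 0" "b \<noteq> 0" using \<delta> by auto
        have "(1 / b - 1 / a) / (\<zeta>' - \<zeta>) = X p / (a * b)"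
        proof -
          have "a - b = X p * (\<zeta>' - \<zeta>)" by (simp add: a_def b_def algebra_simps)
          moreover have "1 / b - 1 / a = (a - b) / (a * b)" using nz by (simp add: field_simps)
          ultimately show ?thesis using \<zeta>'(2) by simp
        qed
        \<comment> \<open>Subtracting the derivative leaves one more factor
          \<open>\<zeta>' - \<zeta>\<close>; three denominators remain, hence the constant with
          \<open>\<delta> ^ 3\<close>.\<close>
        moreover have "X p / (a * b) - X p / a\<^sup>2 = (\<zeta>' - \<zeta>) * ((X p)\<^sup>2 / (a\<^sup>2 * b))"
        proof -
          have "a - b = X p * (\<zeta>' - \<zeta>)" by (simp add: a_def b_def algebra_simps)
          moreover have "X p / (a * b) - X p / a\<^sup>2 = X p * (a - b) / (a\<^sup>2 * b)"
            using nz by (simp add: field_simps power2_eq_square)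
          ultimately show ?thesis by (simp add: power2_eq_square)
        qed
        moreover have "?E p = u p * ((1 / b - 1 / a) / (\<zeta>' - \<zeta>) - X p / a\<^sup>2)"
          by (simp add: ck a_def b_def diff_divide_distrib right_diff_distrib)
        ultimately have E: "?E p = (\<zeta>' - \<zeta>) * ((X p)\<^sup>2 / (a\<^sup>2 * b)) * u p" by simp
        have "cmod ((X p)\<^sup>2 / (a\<^sup>2 * b)) \<le> (exp T)\<^sup>2 / \<delta> ^ 3"
        proof -
          have "\<delta>\<^sup>2 * \<delta> \<le> (cmod a)\<^sup>2 * cmod b" using ab \<delta> by (intro mult_mono power_mono) auto
          moreover have "(cmod (X p))\<^sup>2 \<le> (exp T)\<^sup>2" using X[OF True] by (intro power_mono) auto
          ultimately show ?thesis using \<delta>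
            by (auto simp: norm_divide norm_mult norm_power power3_eq_cube power2_eq_square intro!: frac_le)
        qed
        then show ?thesis unfolding E norm_mult by (intro mult_right_mono mult_left_mono) auto
      next
        case False
        then have "u p = 0" using supp by blast
        then show ?thesis by simp
      qed
    qed
    also have "\<dots> = cmod (\<zeta>' - \<zeta>) * C" by (simp add: C_def)
    finally show ?thesis .
  qed
  have "((\<lambda>\<zeta>'. (cauchy_transform u \<zeta>' - cauchy_transform u \<zeta>) / (\<zeta>' - \<zeta>) - D) \<longlongrightarrow> 0) (at \<zeta>)"
  proof (rule Lim_null_comparison)
    show "\<forall>\<^sub>F \<zeta>' in at \<zeta>. norm ((cauchy_transform u \<zeta>' - cauchy_transform u \<zeta>) / (\<zeta>' - \<zeta>) - D) \<le> cmod (\<zeta>' - \<zeta>) * C"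
      unfolding eventually_at using \<epsilon> bound by (intro exI[of _ \<epsilon>]) (auto simp: dist_commute)
    have "((\<lambda>\<zeta>'. cmod (\<zeta>' - \<zeta>) * C) \<longlongrightarrow> cmod (\<zeta> - \<zeta>) * C) (at \<zeta>)" by (intro tendsto_intros)
    then show "((\<lambda>\<zeta>'. cmod (\<zeta>' - \<zeta>) * C) \<longlongrightarrow> 0) (at \<zeta>)" by simp
  qed
  then have "(cauchy_transform u has_field_derivative D) (at \<zeta>)"
    unfolding has_field_derivative_iff by (rule LIM_zero_cancel)
  then show ?thesis by blast
qed

text \<open>The domain on which both \<open>f\<close> and the Cauchy transform are holomorphic is star-shaped with
  respect to the origin, and near the origin the moment conditions say that the sum vanishes.\<close>

lemma unique_continuation:
  assumes T: "0 < T" and u: "u \<in> L2 cylinder" and supp: "\<forall>p. p \<notin> {0..T} \<times> A \<longrightarrow> u p = 0"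
    and A: "compact A" "A \<subseteq> sphere 0 1" and f: "integrable circle f"
    and m: "\<And>n. moment u n = - (complex_of_real (2 * pi) * fourier_coeff f (int n))"
    and t: "0 < t" and z: "cmod z = 1" "z \<notin> A"
  shows "power_ext f (of_real (exp (- t)) * z) + cauchy_transform u (of_real (exp (- t)) * z) / complex_of_real (2 * pi) = 0"
proof -
  have T0: "0 \<le> T" using T by simp
  have supp': "\<forall>p. fst p \<notin> {0..T} \<longrightarrow> u p = 0" using supp by auto
  have ui: "integrable cylinder u" by (rule L2_cylinder_integrable[OF u supp'])
  \<comment> \<open>The poles of the kernel are the inverses of the points of \<open>K\<close>, that
    is the points \<open>exp (- s) * w\<close>: radial cuts from the arc \<open>A\<close> inwards to
    radius \<open>exp (- T)\<close>.\<close>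
  define K where "K = (\<lambda>(s, w). complex_of_real (exp s) * cnj w) ` ({0..T} \<times> A)"
  have K: "compact K" unfolding K_def split_beta'
    by (intro compact_continuous_image continuous_intros compact_Times compact_Icc A)
  have KT: "cmod X \<le> exp T" if "X \<in> K" for X using that A by (auto simp: K_def norm_mult)
  define U where "U = {\<zeta> \<in> ball 0 1. \<forall>X\<in>K. \<zeta> * X \<noteq> 1}"
  have away: "\<exists>\<epsilon>>0. \<exists>\<delta>>0. \<forall>\<zeta>'. dist \<zeta>' \<zeta> < \<epsilon> \<longrightarrow> (\<forall>X\<in>K. \<delta> \<le> cmod (1 - \<zeta>' * X))" if "\<zeta> \<in> U" for \<zeta>
  proof -
    have "compact ((\<lambda>X. 1 - \<zeta> * X) ` K)" by (intro compact_continuous_image continuous_intros K)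
    moreover have "0 \<notin> (\<lambda>X. 1 - \<zeta> * X) ` K" using that by (auto simp: U_def)
    ultimately obtain d where d: "0 < d" "\<And>x. x \<in> (\<lambda>X. 1 - \<zeta> * X) ` K \<Longrightarrow> d \<le> dist 0 x"
      using separate_point_closed[OF compact_imp_closed] by metis
    have "d / 2 \<le> cmod (1 - \<zeta>' * X)" if "dist \<zeta>' \<zeta> < d / (2 * exp T)" "X \<in> K" for \<zeta>' X
    proof -
      have "cmod ((\<zeta>' - \<zeta>) * X) \<le> d / (2 * exp T) * exp T"
        unfolding norm_mult using that KT[OF that(2)] d(1) by (intro mult_mono) (auto simp: dist_norm)
      also have "\<dots> = d / 2" by simp
      finally have "cmod ((\<zeta>' - \<zeta>) * X) \<le> d / 2" .
      moreover have "d \<le> cmod (1 - \<zeta> * X)" using d(2)[OF imageI[OF that(2)]] by simp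
      moreover have "cmod (1 - \<zeta> * X) \<le> cmod (1 - \<zeta>' * X) + cmod ((\<zeta>' - \<zeta>) * X)"
        using norm_triangle_ineq[of "1 - \<zeta>' * X" "(\<zeta>' - \<zeta>) * X"] by (simp add: algebra_simps)
      ultimately show ?thesis by linarith
    qed
    then show ?thesis using d(1) by (intro exI[of _ "d / (2 * exp T)"] conjI exI[of _ "d / 2"]) auto
  qed
  have openU: "open U" unfolding open_dist
  proof
    fix \<zeta> assume \<zeta>: "\<zeta> \<in> U"
    obtain \<epsilon> \<delta> where e: "0 < \<epsilon>" "0 < \<delta>" "\<And>\<zeta>' X. dist \<zeta>' \<zeta> < \<epsilon> \<Longrightarrow> X \<in> K \<Longrightarrow> \<delta> \<le> cmod (1 - \<zeta>' * X)"
      using away[OF \<zeta>] by metis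
    obtain r where r: "0 < r" "\<And>\<zeta>'. dist \<zeta>' \<zeta> < r \<Longrightarrow> \<zeta>' \<in> ball 0 1"
      using \<zeta> open_ball[of "0::complex" 1] unfolding open_dist U_def by blast
    show "\<exists>e>0. \<forall>\<zeta>'. dist \<zeta>' \<zeta> < e \<longrightarrow> \<zeta>' \<in> U"
      using e r by (intro exI[of _ "min \<epsilon> r"]) (force simp: U_def)
  qed
  \<comment> \<open>Each cut reaches the unit circle, so a ray from the origin that has met a cut
    stays in it until it leaves the disc. Starlikeness is used for connectedness.\<close>
  have "starlike U" unfolding starlike_def
  proof (intro bexI ballI subsetI)
    show "0 \<in> U" by (simp add: U_def)
    fix \<zeta> x assume \<zeta>: "\<zeta> \<in> U" and "x \<in> closed_segment 0 \<zeta>"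
    then obtain r where r: "0 \<le> r" "r \<le> 1" "x = of_real r * \<zeta>" by (auto simp: in_segment scaleR_conv_of_real)
    have c\<zeta>: "cmod \<zeta> < 1" using \<zeta> by (simp add: U_def)
    have "cmod x \<le> 1 * cmod \<zeta>" unfolding r(3) norm_mult using r by (intro mult_right_mono) auto
    then have "x \<in> ball 0 1" using c\<zeta> by simp
    moreover have "x * X \<noteq> 1" if XK: "X \<in> K" for X
    proof
      assume eq: "x * X = 1"
      obtain s w where sw: "s \<in> {0..T}" "w \<in> A" "X = of_real (exp s) * cnj w" using XK by (auto simp: K_def)
      have "r \<noteq> 0" using eq r by auto
      then have r0: "0 < r" using r by simp
      have "cmod w = 1" using sw(2) A by auto
      have "r * cmod \<zeta> * exp s = 1"
        using arg_cong[OF eq, of cmod] r \<open>cmod w = 1\<close> by (simp add: norm_mult sw(3))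
      moreover have "r * cmod \<zeta> * exp s \<le> r * 1 * exp s"
        using c\<zeta> r by (intro mult_right_mono mult_left_mono) auto
      ultimately have "1 \<le> r * exp s" by simp
      \<comment> \<open>\<open>s + ln r\<close> is the time at which \<open>\<zeta>\<close> itself
        would lie on the cut: nonnegative because \<open>cmod \<zeta> < 1\<close>, at most
        \<open>T\<close> because \<open>r <= 1\<close>.\<close>
      then have "0 \<le> ln (r * exp s)" by simp
      then have "0 \<le> s + ln r" using r0 by (simp add: ln_mult)
      moreover have "s + ln r \<le> T"
      proof -
        have "ln r \<le> 0" using r(2) r0 by (simp add: ln_le_zero_iff)
        then have "s + ln r \<le> T + 0" using sw(1) by (intro add_mono) auto
        then show ?thesis by simp
      qed
      ultimately have "of_real (exp (s + ln r)) * cnj w \<in> K" using sw(2) by (force simp: K_def)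
      moreover have "\<zeta> * (of_real (exp (s + ln r)) * cnj w) = 1"
        using eq r0 by (simp add: sw(3) r(3) exp_add mult_ac)
      ultimately show False using \<zeta> by (auto simp: U_def)
    qed
    ultimately show "x \<in> U" by (simp add: U_def)
  qed
  then have connU: "connected U" by (rule starlike_imp_connected)
  have "cauchy_transform u holomorphic_on U"
  proof (rule holomorphic_onI)
    fix \<zeta> assume \<zeta>: "\<zeta> \<in> U"
    obtain \<epsilon> \<delta> where e: "0 < \<epsilon>" "0 < \<delta>" "\<And>\<zeta>' X. dist \<zeta>' \<zeta> < \<epsilon> \<Longrightarrow> X \<in> K \<Longrightarrow> \<delta> \<le> cmod (1 - \<zeta>' * X)"
      using away[OF \<zeta>] by metis
    have "\<exists>D. (cauchy_transform u has_field_derivative D) (at \<zeta>)"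
      by (rule cauchy_transform_has_field_derivative[OF ui supp A(2) e(1,2) e(3)]) (auto simp: K_def)
    then show "cauchy_transform u field_differentiable at \<zeta> within U"
      unfolding field_differentiable_def using has_field_derivative_at_within by blast
  qed
  moreover have "power_ext f holomorphic_on U"
  proof (rule holomorphic_on_subset)
    show "power_ext f holomorphic_on ball 0 1"
    proof (rule power_series_holomorphic[of 0 1 "\<lambda>n. fourier_coeff f (int n)"])
      fix w :: complex assume "w \<in> ball 0 1"
      then have "summable (\<lambda>n. fourier_coeff f (int n) * w ^ n)"
        by (intro summable_norm_cancel[OF power_ext_summable[OF f]]) simp
      then show "(\<lambda>n. fourier_coeff f (int n) * (w - 0) ^ n) sums power_ext f w"
        by (simp add: power_ext_def summable_sums)
    qed
  qed (auto simp: U_def)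
  ultimately have hol: "(\<lambda>\<zeta>. power_ext f \<zeta> + cauchy_transform u \<zeta> / complex_of_real (2 * pi)) holomorphic_on U"
    by (intro holomorphic_intros) auto
  have sub: "ball 0 (exp (- T)) \<subseteq> U"
  proof
    fix \<zeta> :: complex assume "\<zeta> \<in> ball 0 (exp (- T))"
    then have \<zeta>: "cmod \<zeta> < exp (- T)" by simp
    then have "cmod \<zeta> < 1" using T0 by (meson exp_le_one_iff less_le_trans neg_le_0_iff_le)
    moreover have "\<zeta> * X \<noteq> 1" if "X \<in> K" for X
    proof
      assume "\<zeta> * X = 1"
      then have "1 = cmod \<zeta> * cmod X" by (metis norm_mult norm_one)
      also have "\<dots> \<le> cmod \<zeta> * exp T" by (intro mult_left_mono KT that) auto
      also have "\<dots> < exp (- T) * exp T" using \<zeta> by simp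
      finally show False by (simp flip: exp_add)
    qed
    ultimately show "\<zeta> \<in> U" by (simp add: U_def)
  qed
  \<comment> \<open>Taking moduli forces \<open>s = t\<close>, after which the pole condition reads
    \<open>z = w\<close>, against \<open>z \<notin> A\<close>.\<close>
  have tU: "of_real (exp (- t)) * z \<in> U"
  proof -
    have "of_real (exp (- t)) * z * X \<noteq> 1" if XK: "X \<in> K" for X
    proof
      assume eq: "of_real (exp (- t)) * z * X = 1"
      obtain s w where sw: "s \<in> {0..T}" "w \<in> A" "X = of_real (exp s) * cnj w" using XK by (auto simp: K_def)
      have w: "cmod w = 1" using sw(2) A by auto
      have "exp (- t) * exp s = 1" using arg_cong[OF eq, of cmod] z(1) w by (simp add: norm_mult sw(3))
      then have "complex_of_real (exp (- t)) * of_real (exp s) = 1" by (metis of_real_1 of_real_mult)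
      then have "z * cnj w = 1" using eq by (simp add: sw(3) mult_ac)
      moreover have "w * cnj w = 1" using w by (simp flip: complex_norm_square)
      ultimately have "z = w" by (metis mult.commute mult.left_commute mult.right_neutral)
      then show False using sw(2) z(2) by simp
    qed
    then show ?thesis using t z(1) by (simp add: U_def norm_mult)
  qed
  show ?thesis
  proof (rule analytic_continuation_open[OF open_ball openU _ connU sub hol])
    show "(\<lambda>_. 0) holomorphic_on U" by (rule holomorphic_on_const)
    show "ball 0 (exp (- T)) \<noteq> ({} :: complex set)" by simp
    fix \<zeta> :: complex assume "\<zeta> \<in> ball 0 (exp (- T))"
    then have "cmod \<zeta> < exp (- T)" by simp
    from cauchy_transform_eq_power_ext[OF T0 u supp' f m this]
    show "power_ext f \<zeta> + cauchy_transform u \<zeta> / complex_of_real (2 * pi) = 0" by simp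
  qed (rule tU)
qed


section \<open>Controls in short time\<close>

lemma L2_bounded_mult:
  assumes f: "f \<in> L2 M" and g: "g \<in> borel_measurable M" "\<And>x. x \<in> space M \<Longrightarrow> cmod (g x * f x) \<le> B * cmod (f x)"
  shows "(\<lambda>x. g x * f x) \<in> L2 M"
proof -
  note [measurable] = L2_measurable[OF f] g(1)
  have "integrable M (\<lambda>x. (cmod (g x * f x))\<^sup>2)"
  proof (rule Bochner_Integration.integrable_bound)
    show "integrable M (\<lambda>x. B\<^sup>2 * (cmod (f x))\<^sup>2)" using L2_integrable[OF f] by simp
    show "AE x in M. norm ((cmod (g x * f x))\<^sup>2) \<le> norm (B\<^sup>2 * (cmod (f x))\<^sup>2)"
    proof (rule AE_I2)
      fix x assume "x \<in> space M"
      from power_mono[OF g(2)[OF this], of 2] show "norm ((cmod (g x * f x))\<^sup>2) \<le> norm (B\<^sup>2 * (cmod (f x))\<^sup>2)"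
        by (simp add: power_mult_distrib del: norm_mult)
    qed
  qed measurable
  then show ?thesis by (simp add: L2_def)
qed

lemma (in pair_sigma_finite) integrable_pair_mult:
  fixes f g :: "_ \<Rightarrow> complex"
  assumes f: "integrable M1 f" and g: "integrable M2 g"
  shows "integrable (M1 \<Otimes>\<^sub>M M2) (\<lambda>(x, y). f x * g y)"
proof (rule Fubini_integrable)
  show "(\<lambda>(x, y). f x * g y) \<in> borel_measurable (M1 \<Otimes>\<^sub>M M2)" using f g by measurable
  show "integrable M1 (\<lambda>x. \<integral>y. norm (case (x, y) of (x, y) \<Rightarrow> f x * g y) \<partial>M2)"
    using f by (simp add: norm_mult)
  show "AE x in M1. integrable M2 (\<lambda>y. case (x, y) of (x, y) \<Rightarrow> f x * g y)" using g by simp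
qed

text \<open>Dilation shrinks the coefficients, so Bessel's inequality bounds all partial sums
  uniformly in \<open>s\<close>; Fatou passes to the pointwise limit.\<close>

lemma power_ext_circle_L2:
  assumes f: "f \<in> L2 circle" and s: "0 < s"
  shows "(\<integral>\<^sup>+w. ennreal ((cmod (power_ext f (of_real (exp (- s)) * w)))\<^sup>2) \<partial>circle) \<le> ennreal (LINT z|circle. (cmod (f z))\<^sup>2)"
proof -
  define c where "c n = fourier_coeff f (int n) * of_real (exp (- s)) ^ n" for n
  define S where "S N w = (\<Sum>n<N. c n * w ^ n)" for N and w :: complex
  have [measurable]: "S N \<in> borel_measurable circle" for N unfolding S_def by measurable
  have lim: "(\<lambda>N. S N w) \<longlonglongrightarrow> power_ext f (of_real (exp (- s)) * w)" if "cmod w = 1" for w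
  proof -
    have "summable (\<lambda>n. fourier_coeff f (int n) * (of_real (exp (- s)) * w) ^ n)"
      by (intro summable_norm_cancel[OF power_ext_summable[OF L2_circle_integrable[OF f]]]) (use s that in \<open>simp add: norm_mult\<close>)
    then show ?thesis unfolding S_def c_def power_ext_def
      by (simp add: power_mult_distrib mult.assoc summable_LIMSEQ)
  qed
  have "(\<integral>\<^sup>+w. ennreal ((cmod (power_ext f (of_real (exp (- s)) * w)))\<^sup>2) \<partial>circle)
      = (\<integral>\<^sup>+w. liminf (\<lambda>N. ennreal ((cmod (S N w))\<^sup>2)) \<partial>circle)"
  proof (rule nn_integral_cong)
    fix w assume "w \<in> space circle"
    then have "(\<lambda>N. ennreal ((cmod (S N w))\<^sup>2)) \<longlonglongrightarrow> ennreal ((cmod (power_ext f (of_real (exp (- s)) * w)))\<^sup>2)"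
      by (intro tendsto_intros tendsto_ennrealI lim) simp
    then show "ennreal ((cmod (power_ext f (of_real (exp (- s)) * w)))\<^sup>2) = liminf (\<lambda>N. ennreal ((cmod (S N w))\<^sup>2))"
      by (rule lim_imp_Liminf[OF sequentially_bot, symmetric])
  qed
  also have "\<dots> \<le> liminf (\<lambda>N. (\<integral>\<^sup>+w. ennreal ((cmod (S N w))\<^sup>2) \<partial>circle))"
    by (rule nn_integral_liminf) measurable
  also have "\<dots> \<le> liminf (\<lambda>N. ennreal (LINT z|circle. (cmod (f z))\<^sup>2))"
  proof (intro Liminf_mono always_eventually allI)
    fix N
    have "(\<Sum>n<N. (cmod (c n))\<^sup>2) \<le> (\<Sum>n<N. (cmod (fourier_coeff f (int n)))\<^sup>2)"
    proof (rule sum_mono)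
      fix n
      have "cmod (c n) \<le> cmod (fourier_coeff f (int n)) * 1"
        unfolding c_def norm_mult by (intro mult_left_mono) (use s in \<open>auto simp: norm_power intro: power_le_one\<close>)
      then show "(cmod (c n))\<^sup>2 \<le> (cmod (fourier_coeff f (int n)))\<^sup>2" by (intro power_mono) auto
    qed
    then have "2 * pi * (\<Sum>n<N. (cmod (c n))\<^sup>2) \<le> 2 * pi * (\<Sum>n<N. (cmod (fourier_coeff f (int n)))\<^sup>2)"
      by (intro mult_left_mono) auto
    from order_trans[OF this bessel[OF f, of N]] show "(\<integral>\<^sup>+w. ennreal ((cmod (S N w))\<^sup>2) \<partial>circle) \<le> ennreal (LINT z|circle. (cmod (f z))\<^sup>2)"
      unfolding S_def by (subst trig_poly_square) (auto intro!: ennreal_leI)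
  qed
  also have "\<dots> = ennreal (LINT z|circle. (cmod (f z))\<^sup>2)" by (simp add: Liminf_const)
  finally show ?thesis .
qed

text \<open>Time \<open>0\<close> is left out because there the power series is evaluated on the
  unit circle, where its convergence is not known.\<close>

lemma power_ext_L2:
  assumes f: "f \<in> L2 circle"
  shows "(\<lambda>p. indicator {0<..T} (fst p) *\<^sub>R power_ext f (of_real (exp (- fst p)) * snd p)) \<in> L2 cylinder" (is "?v \<in> _")
proof -
  have meas: "?v \<in> borel_measurable cylinder" unfolding power_ext_def by measurable
  define B where "B = ennreal (LINT z|circle. (cmod (f z))\<^sup>2)"
  have "(\<integral>\<^sup>+p. ennreal ((cmod (?v p))\<^sup>2) \<partial>cylinder) = (\<integral>\<^sup>+s. (\<integral>\<^sup>+w. ennreal ((cmod (?v (s, w)))\<^sup>2) \<partial>circle) \<partial>lborel)"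
    by (rule circle.nn_integral_fst[symmetric]) (use meas in measurable)
  also have "\<dots> \<le> (\<integral>\<^sup>+s. B * indicator {0<..T} s \<partial>lborel)"
  proof (rule nn_integral_mono)
    fix s :: real
    show "(\<integral>\<^sup>+w. ennreal ((cmod (?v (s, w)))\<^sup>2) \<partial>circle) \<le> B * indicator {0<..T} s"
      using power_ext_circle_L2[OF f, of s] by (cases "s \<in> {0<..T}") (auto simp: B_def)
  qed
  also have "\<dots> < \<infinity>"
    by (subst nn_integral_cmult_indicator, simp, cases "0 \<le> T") (auto simp: B_def ennreal_mult_less_top)
  finally show ?thesis using meas by (simp add: L2_iff_nn_integral)
qed

lemma AE_cylinder_notin_finite:
  assumes "finite F" "F \<subseteq> sphere 0 1"
  shows "AE p in cylinder. snd p \<notin> F"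
proof (rule nu.AE_pair_measure)
  have [measurable]: "F \<in> sets borel" using assms(1) by (intro borel_closed finite_imp_closed)
  show "{p \<in> space cylinder. snd p \<notin> F} \<in> sets cylinder" by measurable
  have "(\<Union>x\<in>F. {x}) \<in> null_sets circle"
    using assms by (intro null_sets_UN') (auto simp: countable_finite intro!: circle_singleton_null)
  then have "AE w in circle. w \<notin> F" by (auto dest: AE_not_in)
  then show "AE s in lborel. AE w in circle. snd (s, w) \<notin> F" by simp
qed

text \<open>The inner time integral after the exchange in \<open>moment_short_control\<close>: the
  source of the weight \<open>\<tau> - \<sigma>\<close> and thus of the cut-off
  \<open>1 - \<sigma> / \<tau>\<close>.\<close>

lemma integral_indicator_interval_less:
  assumes "0 \<le> \<sigma>"
  shows "(LINT s|lborel. indicator {0<..\<tau>} s *\<^sub>R (indicator {..<s} \<sigma> *\<^sub>R (h::complex))) = of_real (max 0 (\<tau> - \<sigma>)) * h"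
proof -
  have "(LINT s|lborel. indicator {0<..\<tau>} s *\<^sub>R (indicator {..<s} \<sigma> *\<^sub>R h)) = (LINT s|lborel. indicator {\<sigma><..\<tau>} s *\<^sub>R h)"
    by (rule Bochner_Integration.integral_cong[OF refl]) (use assms in \<open>auto simp: indicator_def\<close>)
  then show ?thesis by (simp add: scaleR_conv_of_real max_def)
qed

section \<open>The state as a control, and its interpolation to zero\<close>

locale controlled =
  fixes T :: real and \<omega> A :: "complex set" and f :: "complex \<Rightarrow> complex" and v :: "real \<times> complex \<Rightarrow> complex"
  assumes T: "0 < T" and A: "compact A" "A \<subseteq> sphere 0 1" and \<omega>: "\<omega> \<subseteq> A" "finite (A - \<omega>)" "\<omega> \<in> sets circle"
    and f: "f \<in> H2" and v: "v \<in> L2 cylinder" and supp: "\<forall>p. p \<notin> {0..T} \<times> \<omega> \<longrightarrow> v p = 0"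
    and m: "\<And>n. moment v n = - (complex_of_real (2 * pi) * fourier_coeff f (int n))"
begin

text \<open>In this locale \<open>v\<close> is the given control, called \<open>u\<close> in the introduction, and \<open>V\<close> is the
  function called \<open>v\<close> there.\<close>

definition V :: "real \<times> complex \<Rightarrow> complex" where
  "V p = indicator {0<..T} (fst p) *\<^sub>R (power_ext f (of_real (exp (- fst p)) * snd p)
     + cauchy_transform v (of_real (exp (- fst p)) * snd p) / complex_of_real (2 * pi))"

lemma T0: "0 \<le> T" using T by simp

lemma supp_time: "\<forall>p. fst p \<notin> {0..T} \<longrightarrow> v p = 0"
  using supp by auto

lemma V_L2: "V \<in> L2 cylinder"
proof -
  have "(\<lambda>p. complex_of_real (indicator {0<..T} (fst p) / (2 * pi)) * (indicator {0..T} (fst p) *\<^sub>R cauchy_transform v (of_real (exp (- fst p)) * snd p))) \<in> L2 cylinder"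
    by (rule L2_bounded_mult[OF cauchy_transform_L2[OF T0 v supp_time], of _ "1 / (2 * pi)"])
       (measurable, auto simp: norm_mult norm_divide indicator_def)
  from L2_add[OF power_ext_L2[OF H2_facts(1)[OF f], of T] this]
  show ?thesis
    by (rule back_subst[of "\<lambda>g. g \<in> L2 cylinder"]) (auto simp: V_def fun_eq_iff indicator_def)
qed

text \<open>Unique continuation covers the points outside \<open>A\<close>, and the finite set
  \<open>A - \<omega>\<close> is negligible. This is why cutting \<open>V\<close> off to
  \<open>\<omega>\<close> does not change its moments.\<close>

lemma V_vanishes: "AE p in cylinder. snd p \<notin> \<omega> \<longrightarrow> V p = 0"
proof -
  have supp': "\<forall>p. p \<notin> {0..T} \<times> A \<longrightarrow> v p = 0" using supp \<omega>(1) by auto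
  have "AE p in cylinder. snd p \<notin> A - \<omega>"
    by (rule AE_cylinder_notin_finite) (use \<omega>(2) A(2) in auto)
  with AE_space show ?thesis
  proof eventually_elim
    case (elim p)
    show ?case
    proof
      assume "snd p \<notin> \<omega>"
      then have w: "snd p \<notin> A" "cmod (snd p) = 1" using elim by (auto simp: space_pair_measure)
      show "V p = 0"
      proof (cases "fst p \<in> {0<..T}")
        case True
        then show ?thesis
          using unique_continuation[OF T v supp' A H2_facts(2)[OF f] m, of "fst p" "snd p"] w by (simp add: V_def)
      qed (simp add: V_def)
    qed
  qed
qed

text \<open>The identity \<open>P\<^sub>+ V(s) = f(s)\<close> mode by mode, scaled by
  \<open>2 pi exp (n s)\<close>: the right-hand side is Duhamel's formula for the state at time
  \<open>s\<close>, with the control acting up to \<open>s\<close>.\<close>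

lemma V_slice:
  assumes s: "s \<in> {0<..T}"
  shows "(LINT w|circle. V (s, w) * (of_real (exp s) * cnj w) ^ n) = complex_of_real (2 * pi) * fourier_coeff f (int n)
    + (LINT p|cylinder. indicator {..<s} (fst p) *\<^sub>R (v p * (of_real (exp (fst p)) * cnj (snd p)) ^ n))"
proof -
  define e where "e = complex_of_real (exp (- s))"
  have e: "cmod e < 1" "complex_of_real (exp s) * e = 1" using s
    by (auto simp: e_def simp flip: of_real_mult exp_add)
  have s': "s \<in> {0..T}" using s by auto
  note pf = power_ext_fourier[OF H2_facts(2)[OF f] e(1), of n]
  note cf = cauchy_transform_fourier[OF T0 v supp_time s', of n, folded e_def]
  have "(LINT w|circle. V (s, w) * (of_real (exp s) * cnj w) ^ n)
    = (LINT w|circle. of_real (exp s) ^ n * (power_ext f (e * w) * cnj w ^ n + (cauchy_transform v (e * w) * cnj w ^ n) / complex_of_real (2 * pi)))"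
    by (rule Bochner_Integration.integral_cong[OF refl])
       (use s in \<open>simp add: V_def e_def power_mult_distrib distrib_left distrib_right mult_ac\<close>)
  also have "\<dots> = of_real (exp s) ^ n * (complex_of_real (2 * pi) * fourier_coeff f (int n) * e ^ n
      + (LINT p|cylinder. indicator {..<s} (fst p) *\<^sub>R (v p * (of_real (exp (fst p - s)) * cnj (snd p)) ^ n)))"
    using pf cf by simp
  also have "\<dots> = complex_of_real (2 * pi) * fourier_coeff f (int n) * (of_real (exp s) * e) ^ n
      + (LINT p|cylinder. of_real (exp s) ^ n * (indicator {..<s} (fst p) *\<^sub>R (v p * (of_real (exp (fst p - s)) * cnj (snd p)) ^ n)))"
    by (simp only: integral_mult_right_zero distrib_left power_mult_distrib) (simp only: mult_ac)
  also have "(\<lambda>p. of_real (exp s) ^ n * (indicator {..<s} (fst p) *\<^sub>R (v p * (of_real (exp (fst p - s)) * cnj (snd p)) ^ n)))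
    = (\<lambda>p. indicator {..<s} (fst p) *\<^sub>R (v p * (of_real (exp (fst p)) * cnj (snd p)) ^ n))"
  proof
    fix p :: "real \<times> complex"
    have "complex_of_real (exp (fst p)) = of_real (exp s) * of_real (exp (fst p - s))"
      by (simp flip: of_real_mult exp_add)
    then show "of_real (exp s) ^ n * (indicator {..<s} (fst p) *\<^sub>R (v p * (of_real (exp (fst p - s)) * cnj (snd p)) ^ n))
      = indicator {..<s} (fst p) *\<^sub>R (v p * (of_real (exp (fst p)) * cnj (snd p)) ^ n)"
      by (simp add: power_mult_distrib scaleR_conv_of_real mult_ac)
  qed
  finally show ?thesis using e(2) by simp
qed

text \<open>The control steering the solution \<open>(1 - t / \<tau>) f(t)\<close> to rest at time \<open>\<tau>\<close>.\<close>

definition short_control :: "real \<Rightarrow> real \<times> complex \<Rightarrow> complex" where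
  "short_control \<tau> p = indicator ({0<..\<tau>} \<times> \<omega>) p *\<^sub>R (of_real (1 - fst p / \<tau>) * v p - V p / of_real \<tau>)"

context
  fixes \<tau> :: real
  assumes \<tau>: "0 < \<tau>" "\<tau> \<le> T"
begin

text \<open>On the support the factor \<open>1 - s / \<tau>\<close> lies in \<open>[0, 1]\<close>,
  so only \<open>V / \<tau>\<close> grows as \<open>\<tau>\<close> tends to \<open>0\<close>. Taking
  the norms of \<open>v\<close> and \<open>V\<close> over the whole cylinder keeps both constants
  independent of \<open>\<tau>\<close>.\<close>

lemma short_control_L2:
  shows "short_control \<tau> \<in> L2 cylinder"
    and "L2_norm cylinder (short_control \<tau>) \<le> 2 * (L2_norm cylinder v + L2_norm cylinder V / \<tau>)"
proof -
  note [measurable] = L2_measurable[OF v] L2_measurable[OF V_L2] \<omega>(3)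
  have bound: "(cmod (short_control \<tau> p))\<^sup>2 \<le> 2 * (cmod (v p))\<^sup>2 + 2 / \<tau>\<^sup>2 * (cmod (V p))\<^sup>2" for p
  proof (cases "p \<in> {0<..\<tau>} \<times> \<omega>")
    case True
    then have "0 \<le> 1 - fst p / \<tau>" "1 - fst p / \<tau> \<le> 1" using \<tau> by (auto simp: field_simps)
    then have le: "cmod (of_real (1 - fst p / \<tau>) * v p) \<le> cmod (v p)"
      by (simp only: norm_mult norm_of_real abs_of_nonneg mult_left_le_one_le norm_ge_zero)
    have "(cmod (short_control \<tau> p))\<^sup>2 \<le> 2 * (cmod (of_real (1 - fst p / \<tau>) * v p))\<^sup>2 + 2 * (cmod (- (V p / of_real \<tau>)))\<^sup>2"
      using cmod_add_square_le[of "of_real (1 - fst p / \<tau>) * v p" "- (V p / of_real \<tau>)"] True by (simp add: short_control_def)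
    also have "\<dots> \<le> 2 * (cmod (v p))\<^sup>2 + 2 / \<tau>\<^sup>2 * (cmod (V p))\<^sup>2"
      using le by (intro add_mono mult_left_mono power_mono) (auto simp: norm_divide power_divide)
    finally show ?thesis .
  qed (simp add: short_control_def)
  have meas: "short_control \<tau> \<in> borel_measurable cylinder" unfolding short_control_def by measurable
  have int: "integrable cylinder (\<lambda>p. 2 * (cmod (v p))\<^sup>2 + 2 / \<tau>\<^sup>2 * (cmod (V p))\<^sup>2)"
    using L2_integrable[OF v] L2_integrable[OF V_L2] by simp
  have "integrable cylinder (\<lambda>p. (cmod (short_control \<tau> p))\<^sup>2)"
    by (rule Bochner_Integration.integrable_bound[OF int])
       (use meas in measurable, auto intro!: AE_I2 order_trans[OF bound])
  then show L2: "short_control \<tau> \<in> L2 cylinder" using meas by (simp add: L2_def)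
  have "(LINT p|cylinder. (cmod (short_control \<tau> p))\<^sup>2) \<le> (LINT p|cylinder. 2 * (cmod (v p))\<^sup>2 + 2 / \<tau>\<^sup>2 * (cmod (V p))\<^sup>2)"
    by (rule integral_mono[OF L2_integrable[OF L2] int bound])
  also have "\<dots> = 2 * (L2_norm cylinder v)\<^sup>2 + 2 / \<tau>\<^sup>2 * (L2_norm cylinder V)\<^sup>2"
    using L2_integrable[OF v] L2_integrable[OF V_L2] by (simp add: L2_norm_def)
  also have "\<dots> \<le> (2 * (L2_norm cylinder v + L2_norm cylinder V / \<tau>))\<^sup>2"
  proof -
    have "2 * a\<^sup>2 + 2 / \<tau>\<^sup>2 * b\<^sup>2 \<le> (2 * (a + b / \<tau>))\<^sup>2" if "0 \<le> a" "0 \<le> b" for a b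
    proof -
      have "(2 * (a + b / \<tau>))\<^sup>2 = 2 * a\<^sup>2 + 2 / \<tau>\<^sup>2 * b\<^sup>2 + (2 * a\<^sup>2 + 8 * (a * (b / \<tau>)) + 2 * (b / \<tau>)\<^sup>2)"
        by (simp add: power2_eq_square algebra_simps)
      moreover have "0 \<le> 2 * a\<^sup>2 + 8 * (a * (b / \<tau>)) + 2 * (b / \<tau>)\<^sup>2" using that \<tau> by simp
      ultimately show ?thesis by linarith
    qed
    then show ?thesis by (simp add: L2_norm_nonneg)
  qed
  finally show "L2_norm cylinder (short_control \<tau>) \<le> 2 * (L2_norm cylinder v + L2_norm cylinder V / \<tau>)"
    unfolding L2_norm_def[of _ "short_control \<tau>"]
    by (rule real_le_lsqrt[rotated]) (use \<tau> in \<open>auto simp: L2_norm_nonneg\<close>)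
qed

text \<open>Integrating \<open>V_slice\<close> over \<open>s\<close> in \<open>{0<..\<tau>}\<close>
  and exchanging integrals gives each \<open>v (\<sigma>, w)\<close> the weight
  \<open>\<tau> - \<sigma>\<close>. With \<open>R\<close> the damped control and \<open>W\<close>
  the truncated \<open>V\<close>, the moment of \<open>W\<close> is therefore \<open>\<tau>\<close>
  times the sum of \<open>2 pi fourier_coeff f n\<close> and the moment of \<open>R\<close>; in
  \<open>moment R n - moment W n / \<tau>\<close> the contribution of \<open>R\<close>
  cancels.\<close>

lemma moment_short_control: "moment (short_control \<tau>) n = - (complex_of_real (2 * pi) * fourier_coeff f (int n))"
proof -
  note [measurable] = L2_measurable[OF v] L2_measurable[OF V_L2] \<omega>(3)
  define W where "W p = complex_of_real (indicator {0<..\<tau>} (fst p)) * V p" for p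
  define R where "R p = complex_of_real (indicator {0<..\<tau>} (fst p) * (1 - fst p / \<tau>)) * v p" for p
  define h where "h p = v p * (of_real (exp (fst p)) * cnj (snd p)) ^ n" for p
  have W: "W \<in> L2 cylinder" unfolding W_def
    by (rule L2_bounded_mult[OF V_L2, of _ 1]) (measurable, auto simp: norm_mult indicator_def)
  have R: "R \<in> L2 cylinder" unfolding R_def
  proof (rule L2_bounded_mult[OF v, of _ 1])
    fix p :: "real \<times> complex"
    have "\<bar>indicator {0<..\<tau>} (fst p) * (1 - fst p / \<tau>)\<bar> \<le> 1" using \<tau> by (auto simp: indicator_def field_simps)
    then show "cmod (complex_of_real (indicator {0<..\<tau>} (fst p) * (1 - fst p / \<tau>)) * v p) \<le> 1 * cmod (v p)"
      unfolding norm_mult norm_of_real by (intro mult_right_mono) auto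
  qed measurable
  have sW: "\<forall>p. fst p \<notin> {0..T} \<longrightarrow> W p = 0" using \<tau> by (auto simp: W_def indicator_def)
  have sR: "\<forall>p. fst p \<notin> {0..T} \<longrightarrow> R p = 0" using \<tau> by (auto simp: R_def indicator_def)
  note iW = integrable_moment[OF T0 W sW, of n]
  note iR = integrable_moment[OF T0 R sR, of n]
  have ih: "integrable cylinder h" unfolding h_def by (rule integrable_moment[OF T0 v supp_time])
  have [measurable]: "h \<in> borel_measurable cylinder" using ih by auto
  have "moment (short_control \<tau>) n = (LINT p|cylinder. R p * (of_real (exp (fst p)) * cnj (snd p)) ^ n
      - (W p * (of_real (exp (fst p)) * cnj (snd p)) ^ n) / of_real \<tau>)"
    unfolding moment_def
  proof (rule integral_cong_AE)
    show "AE p in cylinder. short_control \<tau> p * (of_real (exp (fst p)) * cnj (snd p)) ^ n = R p * (of_real (exp (fst p)) * cnj (snd p)) ^ n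
      - (W p * (of_real (exp (fst p)) * cnj (snd p)) ^ n) / of_real \<tau>"
      \<comment> \<open>\<open>W\<close> is not cut off to \<open>\<omega>\<close>, unlike
        \<open>short_control\<close>; the two sides agree off \<open>\<omega>\<close> because
        \<open>V\<close> vanishes there.\<close>
      using V_vanishes
    proof eventually_elim
      case (elim p)
      have "short_control \<tau> p = R p - W p / of_real \<tau>"
      proof (cases "snd p \<in> \<omega>")
        case True
        then show ?thesis by (cases p) (auto simp: short_control_def R_def W_def indicator_def)
      next
        case False
        then have "p \<notin> {0..T} \<times> \<omega>" "p \<notin> {0<..\<tau>} \<times> \<omega>" by auto
        moreover from this have "v p = 0" using supp by blast
        ultimately show ?thesis using elim False by (simp add: short_control_def R_def W_def)
      qed
      then show ?case by (simp add: left_diff_distrib)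
    qed
  qed (use iW iR L2_measurable[OF short_control_L2(1)] in measurable)
  also have "\<dots> = moment R n - moment W n / of_real \<tau>"
    using iW iR by (simp add: moment_def)
  finally have mom: "moment (short_control \<tau>) n = moment R n - moment W n / of_real \<tau>" .
  \<comment> \<open>\<open>J\<close> couples the averaging time \<open>s\<close> with the control
    times before \<open>s\<close>; it is dominated by the product of the indicator in
    \<open>s\<close> with \<open>h\<close>, which permits Fubini.\<close>
  define J where "J s p = indicator {0<..\<tau>} s *\<^sub>R (indicator {..<s} (fst p) *\<^sub>R h p)" for s p
  interpret lc: pair_sigma_finite lborel cylinder ..
  have i\<tau>: "integrable lborel (\<lambda>s. complex_of_real (indicator {0<..\<tau>} s))"
    by (intro integrable_of_real integrable_real_indicator) (use \<tau> in auto)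
  have iJ: "integrable (lborel \<Otimes>\<^sub>M cylinder) (\<lambda>(s, p). J s p)"
  proof (rule Bochner_Integration.integrable_bound[OF lc.integrable_pair_mult[OF i\<tau> ih]])
    have "(\<lambda>x. h (snd x)) \<in> borel_measurable (lborel \<Otimes>\<^sub>M cylinder)"
      by (rule measurable_compose[OF measurable_snd]) simp
    then have "(\<lambda>x. if 0 < fst x \<and> fst x \<le> \<tau> \<and> fst (snd x) < fst x then h (snd x) else 0) \<in> borel_measurable (lborel \<Otimes>\<^sub>M cylinder)"
      by measurable
    then show "(\<lambda>(s, p). J s p) \<in> borel_measurable (lborel \<Otimes>\<^sub>M cylinder)"
      by (rule back_subst[of "\<lambda>g. g \<in> borel_measurable (lborel \<Otimes>\<^sub>M cylinder)"])
         (auto simp: J_def indicator_def fun_eq_iff)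
  qed (auto simp: J_def indicator_def)
  have "moment W n = (LINT s|lborel. (LINT w|circle. W (s, w) * (of_real (exp s) * cnj w) ^ n))"
    unfolding moment_def using nu.integral_fst'[OF iW] by simp
  also have "\<dots> = (LINT s|lborel. complex_of_real (indicator {0<..\<tau>} s) * (complex_of_real (2 * pi) * fourier_coeff f (int n)) + (LINT p|cylinder. J s p))"
  proof (rule Bochner_Integration.integral_cong[OF refl])
    fix s
    show "(LINT w|circle. W (s, w) * (of_real (exp s) * cnj w) ^ n) =
      complex_of_real (indicator {0<..\<tau>} s) * (complex_of_real (2 * pi) * fourier_coeff f (int n)) + (LINT p|cylinder. J s p)"
    proof (cases "s \<in> {0<..\<tau>}")
      case True
      then have "s \<in> {0<..T}" using \<tau> by auto
      from V_slice[OF this, of n] True show ?thesis by (simp add: W_def J_def h_def)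
    qed (simp add: W_def J_def)
  qed
  also have "\<dots> = of_real \<tau> * (complex_of_real (2 * pi) * fourier_coeff f (int n)) + (LINT s|lborel. (LINT p|cylinder. J s p))"
  proof -
    have "integrable lborel (\<lambda>s. (LINT p|cylinder. J s p))" using lc.integrable_fst'[OF iJ] by simp
    then show ?thesis using i\<tau> \<tau> by (subst Bochner_Integration.integral_add) auto
  qed
  also have "(LINT s|lborel. (LINT p|cylinder. J s p)) = (LINT p|cylinder. (LINT s|lborel. J s p))"
    by (rule lc.Fubini_integral[symmetric, OF iJ])
  also have "\<dots> = (LINT p|cylinder. of_real \<tau> * (R p * (of_real (exp (fst p)) * cnj (snd p)) ^ n))"
  proof (rule integral_cong_AE)
    show "AE p in cylinder. (LINT s|lborel. J s p) = of_real \<tau> * (R p * (of_real (exp (fst p)) * cnj (snd p)) ^ n)"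
      \<comment> \<open>At control time \<open>0\<close> the weight is \<open>\<tau>\<close>,
        whereas the half-open indicator makes \<open>R\<close> zero.\<close>
      using AE_time_neq[of 0]
    proof eventually_elim
      case (elim p)
      show ?case
      proof (cases "0 \<le> fst p")
        case True
        then have "(LINT s|lborel. J s p) = of_real (max 0 (\<tau> - fst p)) * h p"
          unfolding J_def by (rule integral_indicator_interval_less)
        moreover have "max 0 (\<tau> - fst p) = \<tau> * (indicator {0<..\<tau>} (fst p) * (1 - fst p / \<tau>))"
          using True elim \<tau> by (auto simp: indicator_def field_simps)
        ultimately show ?thesis unfolding R_def h_def by (simp only: of_real_mult mult_ac)
      next
        case False
        then have "fst p \<notin> {0..T}" by simp
        then have "v p = 0" using supp_time by blast
        then show ?thesis by (simp add: J_def h_def R_def)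
      qed
    qed
    show "(\<lambda>p. LINT s|lborel. J s p) \<in> borel_measurable cylinder"
      using lc.integrable_snd[OF iJ] by auto
  qed (use iR in auto)
  also have "\<dots> = of_real \<tau> * moment R n" using iR by (simp add: moment_def)
  finally show ?thesis unfolding mom using \<tau> by (simp add: field_simps)
qed

end

end

text \<open>The passage back from the cylinder to controls: for a function with this support the
  extension by zero is the function itself, so moments and norm carry over.\<close>

lemma control_of_moments:
  assumes \<omega>: "\<omega> \<in> sets circle" and T: "0 < T" and f: "f \<in> H2" and u: "u \<in> L2 cylinder"
    and supp: "\<forall>p. p \<notin> {0..T} \<times> \<omega> \<longrightarrow> u p = 0"
    and m: "\<And>n. moment u n = - (complex_of_real (2 * pi) * fourier_coeff f (int n))"
  shows "u \<in> L2 (control_space T \<omega>)"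
    and "AE z in circle. semigroup_S T f z + input_to_output \<omega> T u z = 0"
    and "L2_norm (control_space T \<omega>) u = L2_norm cylinder u"
proof -
  have S: "{0..T} \<times> \<omega> \<in> sets cylinder" using \<omega> by auto
  have eq: "(\<lambda>p. indicator ({0..T} \<times> \<omega>) p *\<^sub>R u p) = u" using supp by (auto simp: fun_eq_iff indicator_def)
  show L2: "u \<in> L2 (control_space T \<omega>)" unfolding control_space_eq[OF \<omega>] L2_restrict_space(1)[OF S] eq by (rule u)
  show "L2_norm (control_space T \<omega>) u = L2_norm cylinder u"
    unfolding control_space_eq[OF \<omega>] L2_restrict_space(2)[OF S] eq ..
  show "AE z in circle. semigroup_S T f z + input_to_output \<omega> T u z = 0"
    unfolding null_control_iff_moments[OF \<omega> T L2 f] eq using m by blast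
qed

theorem theorem2p2:
  fixes \<omega> :: "complex set" and T :: real and f0 :: "complex \<Rightarrow> complex"
  assumes "open_strict_interval \<omega>"
    and "T > 0"
    and "f0 \<in> null_controllable \<omega> T"
  shows "\<exists>C>0. \<forall>T'>0. \<exists>u \<in> L2 (control_space T' \<omega>).
           (AE z in circle. semigroup_S T' f0 z + input_to_output \<omega> T' u z = 0) \<and>
           L2_norm (control_space T' \<omega>) u \<le> C * max 1 (T' powr (- 3 / 2))"
proof -
  obtain A where arc: "compact A" "A \<subseteq> sphere 0 1" "\<omega> \<subseteq> A" "finite (A - \<omega>)" "\<omega> \<in> sets circle"
    using open_strict_interval_closure[OF assms(1)] by blast
  from assms(3) obtain u where f0: "f0 \<in> H2" and u: "u \<in> L2 (control_space T \<omega>)"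
    and nc: "AE z in circle. semigroup_S T f0 z + input_to_output \<omega> T u z = 0"
    unfolding null_controllable_def by blast
  define v where "v p = indicator ({0..T} \<times> \<omega>) p *\<^sub>R u p" for p
  have S: "{0..T} \<times> \<omega> \<in> sets cylinder" using arc(5) by auto
  have v: "v \<in> L2 cylinder" using u unfolding control_space_eq[OF arc(5)] L2_restrict_space(1)[OF S] v_def .
  have supp: "\<forall>p. p \<notin> {0..T} \<times> \<omega> \<longrightarrow> v p = 0" by (simp add: v_def)
  have m: "moment v n = - (complex_of_real (2 * pi) * fourier_coeff f0 (int n))" for n
    using nc unfolding null_control_iff_moments[OF arc(5) assms(2) u f0] v_def[abs_def] by blast
  interpret controlled T \<omega> A f0 v
    by standard (use arc assms(2) f0 v supp m in auto)
  \<comment> \<open>The summand \<open>1\<close> keeps \<open>C\<close> positive even if both norms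
    are zero.\<close>
  define C where "C = 2 * (L2_norm cylinder v + L2_norm cylinder V) + 1"
  have C: "0 < C" using L2_norm_nonneg[of cylinder v] L2_norm_nonneg[of cylinder V] by (simp add: C_def)
  have "\<exists>u \<in> L2 (control_space T' \<omega>). (AE z in circle. semigroup_S T' f0 z + input_to_output \<omega> T' u z = 0) \<and>
      L2_norm (control_space T' \<omega>) u \<le> C * max 1 (T' powr (- 3 / 2))" if T': "0 < T'" for T'
  proof (cases "T' \<le> T")
    case True
    have supp': "\<forall>p. p \<notin> {0..T'} \<times> \<omega> \<longrightarrow> short_control T' p = 0"
      by (auto simp: short_control_def indicator_def)
    note c = control_of_moments[OF arc(5) T' f0 short_control_L2(1)[OF T' True] supp' moment_short_control[OF T' True]]
    \<comment> \<open>The construction costs \<open>1 / T'\<close>, which is a stronger estimate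
      than the one claimed.\<close>
    have "1 / T' \<le> max 1 (T' powr (- 3 / 2))"
    proof (cases "T' \<le> 1")
      case True
      have "T' powr (- 1) \<le> T' powr (- 3 / 2)" by (rule powr_mono') (use True T' in auto)
      then show ?thesis using T' by (simp add: powr_minus_divide)
    next
      case False
      then have "1 / T' \<le> 1" by simp
      then show ?thesis by simp
    qed
    then have "2 * (L2_norm cylinder v * 1 + L2_norm cylinder V * (1 / T'))
      \<le> 2 * (L2_norm cylinder v * max 1 (T' powr (- 3 / 2)) + L2_norm cylinder V * max 1 (T' powr (- 3 / 2)))"
      by (intro mult_left_mono add_mono) (auto simp: L2_norm_nonneg)
    also have "\<dots> \<le> C * max 1 (T' powr (- 3 / 2))" by (simp add: C_def algebra_simps)
    finally have "L2_norm (control_space T' \<omega>) (short_control T') \<le> C * max 1 (T' powr (- 3 / 2))"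
      unfolding c(3) using short_control_L2(2)[OF T' True] by simp
    with c(1,2) show ?thesis by blast
  next
    case False
    \<comment> \<open>For \<open>T' > T\<close> the given control, switched off after
      \<open>T\<close>, keeps its moments and serves unchanged.\<close>
    have supp': "\<forall>p. p \<notin> {0..T'} \<times> \<omega> \<longrightarrow> v p = 0" using False supp by auto
    note c = control_of_moments[OF arc(5) T' f0 v supp' m]
    have "L2_norm cylinder v \<le> C * 1" using L2_norm_nonneg[of cylinder v] L2_norm_nonneg[of cylinder V] by (simp add: C_def)
    also have "\<dots> \<le> C * max 1 (T' powr (- 3 / 2))" using C by (intro mult_left_mono) auto
    finally show ?thesis using c by auto
  qed
  with C show ?thesis by blast
qed

end
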